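(* Consider the Gaussian Wigner correlation testing problem with parameters $n$ and $\rho=\rho_n\in[0,1]$, with null law $\mathcal{Q}$ and planted law $\mathcal{P}$ of the pair $(A,B)$ as defined in the context. As $n\to\infty$: (i) If $\rho^2 \ge \frac{4\log n}{n-1}$ (for all $n$), then $\mathrm{TV}(\mathcal{P},\mathcal{Q}) = 1+o(1)$, i.e. $\mathrm{TV}(\mathcal{P},\mathcal{Q})\to 1$. (ii) Conversely, if $\rho^2 \le \frac{(4-\epsilon)\log n}{n}$ for any constant $\epsilon>0$ (not depending on $n$), then $\mathrm{TV}(\mathcal{P},\mathcal{Q}) = o(1)$.
   Context: Gaussian Wigner model. $A=(A_{ij})$ and $B=(B_{ij})$ are symmetric $n\times n$ weighted adjacency matrices with zero diagonal (so $A_{ij}=A_{ji}$, $B_{ij}=B_{ji}$), determined by their entries with $1\le i<j\le n$. Under $\mathcal{H}_0$ (law $\mathcal{Q}$), the pairs $(A_{ij},B_{ij})$, $1\le i<j\le n$, are i.i.d. pairs of independent standard normal variables. Under $\mathcal{H}_1$ (law $\mathcal{P}$), first a latent permutation $\pi$ is drawn uniformly at random from the set $\mathcal{S}_n$ of permutations of $[n]=\{1,\dots,n\}$; conditionally on $\pi$, the pairs $(A_{ij},B_{\pi(i)\pi(j)})$, $1\le i<j\le n$, are i.i.d. bivariate normal with zero means, unit variances and correlation coefficient $\rho$. $\mathcal{P}$ and $\mathcal{Q}$ denote the resulting (marginal) laws of the observation $(A,B)$ (the permutation $\pi$ is not observed). Observing $(A,B)$ is equivalent to observing the two unlabeled weighted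 graphs (isomorphism classes) of $A$ and $B$. $\mathrm{TV}(\mathcal{P},\mathcal{Q})=\frac12\int|d\mathcal{P}-d\mathcal{Q}|$ is the total variation distance. All logarithms are natural. *)

theory Defs
  imports "HOL-Probability.Probability" "HOL-Combinatorics.Permutations"
begin

text \<open>
  Total variation distance \<open>TV(P,Q) = 1/2 \<integral> |dP - dQ|\<close>. The densities are taken with respect
  to \<open>P + Q\<close>, which dominates both laws; no absolute continuity between \<open>P\<close> and \<open>Q\<close> is
  assumed (it fails for the planted law at correlation \<open>1\<close>). Meant for finite measures on the
  same measurable space.
\<close>

definition measure_plus :: "'a measure \<Rightarrow> 'a measure \<Rightarrow> 'a measure" where
  "measure_plus P Q = measure_of (space P) (sets P) (\<lambda>X. emeasure P X + emeasure Q X)"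

definition tv_dist :: "'a measure \<Rightarrow> 'a measure \<Rightarrow> real" where
  "tv_dist P Q = (let M = measure_plus P Q in
     1 / 2 * (\<integral>x. \<bar>enn2real (RN_deriv M P x) - enn2real (RN_deriv M Q x)\<bar> \<partial>M))"

definition std_normal :: "real measure" where
  "std_normal = density lborel (\<lambda>x. ennreal (std_normal_density x))"

text \<open>
  The bivariate normal law with zero means, unit variances and correlation \<open>\<rho>\<close>, as the law of
  \<open>(X, \<rho> X + sqrt (1 - \<rho>\<^sup>2) Y)\<close> for independent standard normal \<open>X\<close>, \<open>Y\<close>; this includes the
  degenerate case \<open>\<rho> = 1\<close>.
\<close>

definition bivariate_normal :: "real \<Rightarrow> (real \<times> real) measure" where
  "bivariate_normal \<rho> = distr (std_normal \<Otimes>\<^sub>M std_normal) (borel \<Otimes>\<^sub>M borel)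
     (\<lambda>(x, y). (x, \<rho> * x + sqrt (1 - \<rho>\<^sup>2) * y))"

definition edges :: "nat \<Rightarrow> (nat \<times> nat) set" where
  "edges n = {(i, j). 1 \<le> i \<and> i < j \<and> j \<le> n}"

text \<open>An \<open>n \<times> n\<close> matrix is a function on index pairs, \<open>undefined\<close> outside \<open>{1..n} \<times> {1..n}\<close>.\<close>

type_synonym mat_fun = "nat \<times> nat \<Rightarrow> real"

definition mat_space :: "nat \<Rightarrow> mat_fun measure" where
  "mat_space n = (\<Pi>\<^sub>M ij\<in>{1..n} \<times> {1..n}. borel)"

definition obs_space :: "nat \<Rightarrow> (mat_fun \<times> mat_fun) measure" where
  "obs_space n = mat_space n \<Otimes>\<^sub>M mat_space n"

definition sym_mat :: "nat \<Rightarrow> mat_fun \<Rightarrow> mat_fun" where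
  "sym_mat n w = (\<lambda>(i, j) \<in> {1..n} \<times> {1..n}.
     if i < j then w (i, j) else if j < i then w (j, i) else 0)"

definition null_law :: "nat \<Rightarrow> (mat_fun \<times> mat_fun) measure" where
  "null_law n = distr (\<Pi>\<^sub>M e\<in>edges n. std_normal \<Otimes>\<^sub>M std_normal) (obs_space n)
     (\<lambda>w. (sym_mat n (\<lambda>e. fst (w e)), sym_mat n (\<lambda>e. snd (w e))))"

text \<open>
  Given \<open>\<pi>\<close>, the pair \<open>w (i, j) = (A\<^bsub>i,j\<^esub>, B\<^bsub>\<pi> i, \<pi> j\<^esub>)\<close> is drawn for each \<open>i < j\<close>, so that
  \<open>C\<^bsub>i,j\<^esub> = B\<^bsub>\<pi> i, \<pi> j\<^esub>\<close> is the symmetric matrix built from the second components and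
  \<open>B\<^bsub>k,l\<^esub> = C\<^bsub>inv \<pi> k, inv \<pi> l\<^esub>\<close>.
\<close>

definition planted_law_given :: "nat \<Rightarrow> real \<Rightarrow> (nat \<Rightarrow> nat) \<Rightarrow> (mat_fun \<times> mat_fun) measure" where
  "planted_law_given n \<rho> \<pi> = distr (\<Pi>\<^sub>M e\<in>edges n. bivariate_normal \<rho>) (obs_space n)
     (\<lambda>w. (sym_mat n (\<lambda>e. fst (w e)),
           \<lambda>(k, l) \<in> {1..n} \<times> {1..n}. sym_mat n (\<lambda>e. snd (w e)) (inv \<pi> k, inv \<pi> l)))"

definition planted_law :: "nat \<Rightarrow> real \<Rightarrow> (mat_fun \<times> mat_fun) measure" where
  "planted_law n \<rho> =
     measure_pmf (pmf_of_set {\<pi>. \<pi> permutes {1..n}}) \<bind> planted_law_given n \<rho>"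


text \<open>Well-formedness of the definitions above.\<close>

lemma space_measure_plus [simp]: "space (measure_plus P Q) = space P"
  by (simp add: measure_plus_def)

lemma sets_measure_plus [simp, measurable_cong]: "sets (measure_plus P Q) = sets P"
  by (simp add: measure_plus_def)

lemma emeasure_measure_plus:
  assumes "sets P = sets Q" "X \<in> sets P"
  shows "emeasure (measure_plus P Q) X = emeasure P X + emeasure Q X"
proof (rule emeasure_measure_of[OF measure_plus_def])
  show "countably_additive (sets (measure_plus P Q)) (\<lambda>X. emeasure P X + emeasure Q X)"
    using assms(1)
    by (auto simp: countably_additive_def suminf_add[symmetric] suminf_emeasure)
qed (use assms sets.space_closed in \<open>auto simp: positive_def\<close>)

lemma
  assumes "prob_space P" "prob_space Q" and sets: "sets P = sets Q"
  shows density_RN_deriv_measure_plus1: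
      "density (measure_plus P Q) (RN_deriv (measure_plus P Q) P) = P"
    and density_RN_deriv_measure_plus2:
      "density (measure_plus P Q) (RN_deriv (measure_plus P Q) Q) = Q"
proof -
  interpret P: prob_space P by fact
  interpret Q: prob_space Q by fact
  let ?M = "measure_plus P Q"
  have "space P = space Q"
    using sets by (rule sets_eq_imp_space_eq)
  then have "emeasure ?M (space ?M) = emeasure P (space P) + emeasure Q (space Q)"
    using emeasure_measure_plus[OF sets sets.top] by simp
  then have "emeasure ?M (space ?M) = 1 + 1"
    by (simp only: P.emeasure_space_1 Q.emeasure_space_1)
  then have "emeasure ?M (space ?M) \<noteq> \<infinity>"
    by simp
  then interpret M: finite_measure ?M
    by (rule finite_measureI)
  have ac: "absolutely_continuous ?M P" "absolutely_continuous ?M Q"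
    unfolding absolutely_continuous_def null_sets_def
    using emeasure_measure_plus[OF sets] sets by auto
  show "density ?M (RN_deriv ?M P) = P"
    by (rule M.density_RN_deriv[OF ac(1)]) simp
  show "density ?M (RN_deriv ?M Q) = Q"
    by (rule M.density_RN_deriv[OF ac(2)]) (simp add: sets)
qed

lemma prob_space_std_normal: "prob_space std_normal"
  unfolding std_normal_def by (rule prob_space_normal_density) simp

lemma sets_std_normal [simp, measurable_cong]: "sets std_normal = sets borel"
  by (simp add: std_normal_def)

lemma space_std_normal [simp]: "space std_normal = UNIV"
  by (simp add: std_normal_def)

lemma sets_bivariate_normal [simp, measurable_cong]:
  "sets (bivariate_normal \<rho>) = sets (borel \<Otimes>\<^sub>M borel)"
  by (simp add: bivariate_normal_def)

lemma prob_space_bivariate_normal: "prob_space (bivariate_normal \<rho>)"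
proof -
  interpret pair_prob_space std_normal std_normal
    by (simp add: pair_prob_space_def pair_sigma_finite_def prob_space_std_normal
        prob_space_imp_sigma_finite)
  show ?thesis
    unfolding bivariate_normal_def by (rule prob_space_distr) measurable
qed

lemma sym_mat_measurable:
  assumes [measurable]: "\<And>e. e \<in> edges n \<Longrightarrow> (\<lambda>w. f w e) \<in> borel_measurable M"
  shows "(\<lambda>w. sym_mat n (f w)) \<in> measurable M (mat_space n)"
  unfolding mat_space_def sym_mat_def
proof (rule measurable_restrict)
  fix ij :: "nat \<times> nat" assume "ij \<in> {1..n} \<times> {1..n}"
  then show "(\<lambda>w. case ij of (i, j) \<Rightarrow>
      if i < j then f w (i, j) else if j < i then f w (j, i) else 0) \<in> borel_measurable M"
  proof (cases ij)
    case (Pair i j)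
    have "i < j \<Longrightarrow> (\<lambda>w. f w (i, j)) \<in> borel_measurable M"
         "j < i \<Longrightarrow> (\<lambda>w. f w (j, i)) \<in> borel_measurable M"
      using \<open>ij \<in> {1..n} \<times> {1..n}\<close> Pair by (auto simp: edges_def intro!: assms)
    then show ?thesis
      by (cases i j rule: linorder_cases) (simp_all add: Pair)
  qed
qed

lemma prob_space_null_law: "prob_space (null_law n)"
proof -
  interpret pair_prob_space std_normal std_normal
    by (simp add: pair_prob_space_def pair_sigma_finite_def prob_space_std_normal
        prob_space_imp_sigma_finite)
  have "prob_space (\<Pi>\<^sub>M e\<in>edges n. std_normal \<Otimes>\<^sub>M std_normal)"
    by (intro prob_space_PiM) unfold_locales
  then show ?thesis
    unfolding null_law_def obs_space_def
    by (rule prob_space.prob_space_distr) (intro measurable_Pair sym_mat_measurable; measurable)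
qed

lemma planted_law_given_measurable:
  "(\<lambda>w. (sym_mat n (\<lambda>e. fst (w e)),
      \<lambda>(k, l) \<in> {1..n} \<times> {1..n}. sym_mat n (\<lambda>e. snd (w e)) (inv \<pi> k, inv \<pi> l)))
   \<in> measurable (\<Pi>\<^sub>M e\<in>edges n. bivariate_normal \<rho>) (obs_space n)" (is "_ \<in> measurable ?W _")
  unfolding obs_space_def
proof (rule measurable_Pair)
  have snd: "(\<lambda>w. sym_mat n (\<lambda>e. snd (w e))) \<in> measurable ?W (mat_space n)"
    by (rule sym_mat_measurable) measurable
  show "(\<lambda>w. sym_mat n (\<lambda>e. fst (w e))) \<in> measurable ?W (mat_space n)"
    by (rule sym_mat_measurable) measurable
  have entry: "(\<lambda>w. sym_mat n (\<lambda>e. snd (w e)) ij) \<in> borel_measurable ?W" for ij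
  proof (cases "ij \<in> {1..n} \<times> {1..n}")
    case True
    then have "(\<lambda>x. x ij) \<in> borel_measurable (mat_space n)"
      unfolding mat_space_def by (rule measurable_component_singleton)
    from measurable_compose[OF snd this] show ?thesis .
  next
    case False
    then show ?thesis by (simp add: sym_mat_def restrict_def)
  qed
  show "(\<lambda>w. \<lambda>(k, l) \<in> {1..n} \<times> {1..n}. sym_mat n (\<lambda>e. snd (w e)) (inv \<pi> k, inv \<pi> l))
      \<in> measurable ?W (mat_space n)"
    unfolding mat_space_def
    by (rule measurable_restrict) (auto intro: entry)
qed

lemma prob_space_planted_law_given: "prob_space (planted_law_given n \<rho> \<pi>)"
  unfolding planted_law_given_def
  by (intro prob_space.prob_space_distr planted_law_given_measurable
      prob_space_PiM prob_space_bivariate_normal)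

lemma sets_null_law [simp]: "sets (null_law n) = sets (obs_space n)"
  by (simp add: null_law_def)

lemma sets_planted_law [simp]: "sets (planted_law n \<rho>) = sets (obs_space n)"
  unfolding planted_law_def by (rule sets_bind) (auto simp: planted_law_given_def)

lemma planted_law_given_kernel:
  "planted_law_given n \<rho> \<in> measurable (measure_pmf p) (prob_algebra (obs_space n))"
proof (rule measurableI)
  show "planted_law_given n \<rho> \<pi> \<in> space (prob_algebra (obs_space n))" for \<pi>
    using prob_space_planted_law_given[of n \<rho> \<pi>]
    by (simp add: space_prob_algebra planted_law_given_def)
qed simp

lemma prob_space_planted_law: "prob_space (planted_law n \<rho>)"
  unfolding planted_law_def
  by (rule prob_space_bind'[OF _ planted_law_given_kernel])
     (simp add: space_prob_algebra measure_pmf.prob_space_axioms)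

lemma emeasure_planted_law:
  assumes "X \<in> sets (obs_space n)"
  shows "emeasure (planted_law n \<rho>) X =
    (\<Sum>\<pi> | \<pi> permutes {1..n}. emeasure (planted_law_given n \<rho> \<pi>) X) / fact n"
proof -
  have fin: "finite {\<pi>. \<pi> permutes {1..n}}" by (simp add: finite_permutations)
  have ne: "{\<pi>. \<pi> permutes {1..n}} \<noteq> {}" using permutes_id by blast
  have "emeasure (planted_law n \<rho>) X = (\<integral>\<^sup>+\<pi>. emeasure (planted_law_given n \<rho> \<pi>) X
      \<partial>measure_pmf (pmf_of_set {\<pi>. \<pi> permutes {1..n}}))"
    unfolding planted_law_def
    by (rule emeasure_bind[OF _ measurable_prob_algebraD[OF planted_law_given_kernel] assms]) simp
  also have "\<dots> = (\<Sum>\<pi> | \<pi> permutes {1..n}. emeasure (planted_law_given n \<rho> \<pi>) X) / fact n"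
    by (subst nn_integral_pmf_of_set[OF ne fin], subst card_permutations[of _ n]) simp_all
  finally show ?thesis .
qed

end

theory Submission
  imports Defs "HOL-Real_Asymp.Real_Asymp"
begin

text \<open>
  Above the threshold, maximise \<open>\<Sum> A\<^bsub>i,j\<^esub> B\<^bsub>\<pi> i,\<pi> j\<^esub>\<close> over \<open>\<pi>\<close>: Chernoff bounds put it above
  \<open>\<tau> = t N - n\<^bsup>5/4\<^esup>\<close> (with \<open>N\<close> the number of edges and \<open>t\<^sup>2 = 4 ln n / (n - 1)\<close>) under the planted law,
  while a union bound over \<open>n!\<close> permutations, with exponent \<open>t\<^sup>2 N / 2 = n ln n\<close> against
  \<open>ln n! \<approx> n ln n - n\<close>, keeps it below \<open>\<tau>\<close> under the null law.

  Below the threshold, the likelihood ratio is truncated to the event that, for every vertex set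
  \<open>F\<close>, the aligned sum over the edges inside \<open>F\<close> exceeds its planted mean by at most \<open>5 n\<^bsup>3/2\<^esup>\<close>.
  The second moment of the truncated ratio is an average over a uniform permutation \<open>\<sigma>\<close> of a product
  over the orbits of \<open>\<sigma>\<close> on edges, an orbit of length \<open>l\<close> contributing \<open>1 / (1 - \<rho>\<^bsup>2l\<^esup>)\<close>. Only
  orbits of length one matter: \<open>k\<close> fixed points contribute about \<open>exp (\<rho>\<^sup>2 k\<^sup>2 / 2)\<close>, against the
  probability \<open>1 / k!\<close> of having them. For \<open>k > n / 8\<close> the truncation halves this exponent to
  \<open>\<rho>\<^sup>2 k\<^sup>2 / 4 \<le> (1 - \<epsilon> / 4) k ln n\<close>, which \<open>1 / k!\<close>
  outweighs.
\<close>

section \<open>Gaussian integrals\<close>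

text \<open>The second moment is inflated by pairs with a large common part, the fixed set of
  \<open>inv \<pi>' \<circ> \<pi>\<close>. A truncation event may depend on \<pi> alone, so it
  cannot name that set; hence it quantifies over all vertex sets and must survive a union bound over
  2^n of them, which forces a slack of order n^(3/2). The indicator of the event does not factor
  over edges. It is replaced by \<open>exp (l * (t - S))\<close>, with S the aligned sum and
  \<open>l = \<rho> / (1 - \<rho>^2)\<close>, which does factor; to leading order this
  \<open>l\<close> minimises the exponent and turns \<rho>^2 M, for M common edges, into \<rho>^2 M
  / 2. For few fixed points the slack would cost more than this gains, hence two regimes. Up to n /
  8 the plain bound is affordable even with the factor 2 lost in
  \<open>1 / (1 - q) \<le> exp (2 * q)\<close>: to leading order it spends at most half of the k ln
  k that 1 / k! provides. At the upper threshold the leading terms of the union bound cancel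
  exactly, so everything rests on the linear term - n in ln n!.\<close>

lemma measurable_std_normal_iff [simp]: "borel_measurable std_normal = borel_measurable borel"
  by (simp add: measurable_def)

lemma nn_integral_std_normal:
  assumes [measurable]: "f \<in> borel_measurable borel"
  shows "(\<integral>\<^sup>+x. f x \<partial>std_normal) = (\<integral>\<^sup>+x. ennreal (std_normal_density x) * f x \<partial>lborel)"
  unfolding std_normal_def by (subst nn_integral_density) auto

text \<open>Completing the square makes the integrand a multiple of the normal density with mean
  \<open>u / w\<close> and variance \<open>1 / w\<close>, where \<open>w = 1 - 2 * v\<close>. The
  closed-form integrals below are all reduced to this one.\<close>

lemma nn_integral_std_normal_exp_quadratic:
  fixes u v :: real
  assumes v: "v < 1/2"
  shows "(\<integral>\<^sup>+x. ennreal (exp (u * x + v * x\<^sup>2)) \<partial>std_normal) =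
         ennreal (exp (u\<^sup>2 / (2 * (1 - 2 * v))) / sqrt (1 - 2 * v))"
proof -
  define w where "w = 1 - 2 * v"
  have w: "w > 0" and v_eq: "v = (1 - w) / 2" using v by (auto simp: w_def)
  define c where "c = exp (u\<^sup>2 / (2 * w)) / sqrt w"
  have c: "c \<ge> 0" using w by (simp add: c_def)
  have eq: "std_normal_density x * exp (u * x + v * x\<^sup>2) = c * normal_density (u / w) (1 / sqrt w) x" for x
  proof -
    have e: "-(x\<^sup>2) / 2 + (u * x + v * x\<^sup>2) = u\<^sup>2 / (2 * w) + (-((x - u / w)\<^sup>2) / (2 * (1 / sqrt w)\<^sup>2))"
      using w unfolding v_eq by (simp add: power_divide field_simps power2_eq_square)
    have "std_normal_density x * exp (u * x + v * x\<^sup>2) = 1 / sqrt (2 * pi) * exp (-(x\<^sup>2) / 2 + (u * x + v * x\<^sup>2))"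
      by (simp add: std_normal_density_def mult_ac flip: exp_add)
    also have "\<dots> = c * normal_density (u / w) (1 / sqrt w) x"
      unfolding e exp_add using w by (simp add: c_def normal_density_def real_sqrt_mult real_sqrt_divide field_simps)
    finally show ?thesis .
  qed
  interpret N: prob_space "density lborel (normal_density (u / w) (1 / sqrt w))"
    using w by (intro prob_space_normal_density) auto
  have one: "(\<integral>\<^sup>+x. ennreal (normal_density (u / w) (1 / sqrt w) x) \<partial>lborel) = 1"
    using N.emeasure_space_1 by (simp add: emeasure_density)
  have "(\<integral>\<^sup>+x. ennreal (exp (u * x + v * x\<^sup>2)) \<partial>std_normal) =
     (\<integral>\<^sup>+x. ennreal c * ennreal (normal_density (u / w) (1 / sqrt w) x) \<partial>lborel)"
    by (subst nn_integral_std_normal) (auto simp flip: ennreal_mult simp: c eq intro!: nn_integral_cong)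
  also have "\<dots> = ennreal c" by (subst nn_integral_cmult) (auto simp: one)
  finally show ?thesis unfolding c_def w_def .
qed

section \<open>The Mehler kernel: semigroup law, trace and tilted square\<close>

text \<open>The density of \<open>bivariate_normal q\<close> with respect to two independent standard normals
  (the Mehler kernel).\<close>

definition mehler :: "real \<Rightarrow> real \<Rightarrow> real \<Rightarrow> real" where
  "mehler q x y = exp ((2 * q * x * y - q\<^sup>2 * (x\<^sup>2 + y\<^sup>2)) / (2 * (1 - q\<^sup>2))) / sqrt (1 - q\<^sup>2)"

lemma mehler_measurable [measurable (raw)]:
  assumes [measurable]: "f \<in> borel_measurable M" "g \<in> borel_measurable M"
  shows "(\<lambda>w. mehler q (f w) (g w)) \<in> borel_measurable M"
  unfolding mehler_def by measurable

lemma mehler_nonneg: "\<bar>q\<bar> \<le> 1 \<Longrightarrow> mehler q x y \<ge> 0"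
  by (simp add: mehler_def abs_square_le_1)

lemma mehler_0 [simp]: "mehler 0 x y = 1"
  by (simp add: mehler_def)

lemma mehler_commute: "mehler q x y = mehler q y x"
  by (simp add: mehler_def algebra_simps)

lemma power2_less_1: "0 \<le> q \<Longrightarrow> q < 1 \<Longrightarrow> (q::real)\<^sup>2 < 1"
  by (simp add: abs_square_less_1)

text \<open>Semigroup law: correlations multiply along a Markov chain x - y - z of standard normals.
  In \<open>y\<close> the product of the two kernels is the exponential of a quadratic, so one
  Gaussian integral suffices.\<close>

lemma mehler_convolution:
  assumes p: "0 \<le> p" "p < 1" and q: "0 \<le> q" "q < 1"
  shows "(\<integral>\<^sup>+y. ennreal (mehler p x y) * ennreal (mehler q y z) \<partial>std_normal) = ennreal (mehler (p * q) x z)"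
proof -
  define P Q where "P = 1 - p\<^sup>2" and "Q = 1 - q\<^sup>2"
  have PQ: "P > 0" "Q > 0" using power2_less_1 p q by (auto simp: P_def Q_def)
  have p2: "p\<^sup>2 = 1 - P" "q\<^sup>2 = 1 - Q" by (auto simp: P_def Q_def)
  define u v where "u = p * x / P + q * z / Q" and "v = - (p\<^sup>2 / (2 * P) + q\<^sup>2 / (2 * Q))"
  define c where "c = exp (- p\<^sup>2 * x\<^sup>2 / (2 * P) - q\<^sup>2 * z\<^sup>2 / (2 * Q)) / (sqrt P * sqrt Q)"
  have v: "v \<le> 0" using PQ unfolding v_def by (simp add: add_nonneg_nonneg del: neg_le_iff_le minus_add_distrib)
  have c: "c \<ge> 0" using PQ by (simp add: c_def)
  define W where "W = P + Q - P * Q"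
  have W: "W = 1 - (p * q)\<^sup>2" by (simp add: W_def P_def Q_def power_mult_distrib algebra_simps)
  have "p * q < 1" using p q by (metis mult_strict_mono' mult.left_neutral)
  then have "W > 0" using p q power2_less_1[of "p*q"] by (simp add: W)
  have v': "1 - 2 * v = W / (P * Q)" using PQ by (simp add: v_def p2 W_def field_simps)
  have eq: "mehler p x y * mehler q y z = c * exp (u * y + v * y\<^sup>2)" for y
  proof -
    have "(2 * p * x * y - p\<^sup>2 * (x\<^sup>2 + y\<^sup>2)) / (2 * P) + (2 * q * y * z - q\<^sup>2 * (y\<^sup>2 + z\<^sup>2)) / (2 * Q)
      = (- p\<^sup>2 * x\<^sup>2 / (2 * P) - q\<^sup>2 * z\<^sup>2 / (2 * Q)) + (u * y + v * y\<^sup>2)"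
      using PQ by (simp add: u_def v_def field_simps)
    then show ?thesis
      by (simp add: mehler_def P_def[symmetric] Q_def[symmetric] c_def flip: exp_add)
  qed
  have "(\<integral>\<^sup>+y. ennreal (mehler p x y) * ennreal (mehler q y z) \<partial>std_normal)
      = (\<integral>\<^sup>+y. ennreal c * ennreal (exp (u * y + v * y\<^sup>2)) \<partial>std_normal)"
    using p q c by (simp add: mehler_nonneg eq flip: ennreal_mult)
  also have "\<dots> = ennreal c * ennreal (exp (u\<^sup>2 / (2 * (1 - 2 * v))) / sqrt (1 - 2 * v))"
    using v by (subst nn_integral_cmult) (auto simp: nn_integral_std_normal_exp_quadratic)
  also have "\<dots> = ennreal (c * (exp (u\<^sup>2 / (2 * (1 - 2 * v))) / sqrt (1 - 2 * v)))"
    using c v by (intro ennreal_mult[symmetric]) auto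
  also have "c * (exp (u\<^sup>2 / (2 * (1 - 2 * v))) / sqrt (1 - 2 * v)) = mehler (p * q) x z"
  proof -
    have s: "sqrt P * sqrt Q * sqrt (1 - 2 * v) = sqrt W"
      using PQ \<open>W > 0\<close> by (simp add: v' real_sqrt_divide real_sqrt_mult)
    have uu: "u = (p * x * Q + q * z * P) / (P * Q)" using PQ by (simp add: u_def field_simps)
    have "(- p\<^sup>2 * x\<^sup>2 / (2 * P) - q\<^sup>2 * z\<^sup>2 / (2 * Q)) + u\<^sup>2 / (2 * (1 - 2 * v)) =
       ((- p\<^sup>2 * x\<^sup>2 * Q - q\<^sup>2 * z\<^sup>2 * P) * W + (p * x * Q + q * z * P)\<^sup>2) / (2 * P * Q * W)"
      using PQ \<open>W > 0\<close> unfolding v' uu by (simp add: field_simps power2_eq_square)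
    also have "(- p\<^sup>2 * x\<^sup>2 * Q - q\<^sup>2 * z\<^sup>2 * P) * W + (p * x * Q + q * z * P)\<^sup>2 =
       P * Q * (2 * (p * q) * x * z - (p * q)\<^sup>2 * (x\<^sup>2 + z\<^sup>2))"
      unfolding W_def P_def Q_def by algebra
    also have "\<dots> / (2 * P * Q * W) = (2 * (p * q) * x * z - (p * q)\<^sup>2 * (x\<^sup>2 + z\<^sup>2)) / (2 * W)"
      using PQ \<open>W > 0\<close> by (simp add: field_simps)
    finally have e: "(- p\<^sup>2 * x\<^sup>2 / (2 * P) - q\<^sup>2 * z\<^sup>2 / (2 * Q)) + u\<^sup>2 / (2 * (1 - 2 * v)) =
       (2 * (p * q) * x * z - (p * q)\<^sup>2 * (x\<^sup>2 + z\<^sup>2)) / (2 * W)" .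
    have "c * (exp (u\<^sup>2 / (2 * (1 - 2 * v))) / sqrt (1 - 2 * v)) =
      exp ((- p\<^sup>2 * x\<^sup>2 / (2 * P) - q\<^sup>2 * z\<^sup>2 / (2 * Q)) + u\<^sup>2 / (2 * (1 - 2 * v))) /
        (sqrt P * sqrt Q * sqrt (1 - 2 * v))"
      unfolding c_def exp_add by simp
    also have "\<dots> = mehler (p * q) x z" unfolding e s unfolding mehler_def W ..
    finally show ?thesis .
  qed
  finally show ?thesis .
qed

text \<open>The trace of the kernel operator, whose eigenvalues on the Hermite polynomials are
  \<open>q ^ j\<close>, hence a geometric series. The computation here is direct: on the diagonal
  the exponent collapses to \<open>q / (1 + q) * x^2\<close>.\<close>

lemma mehler_trace:
  assumes q: "0 \<le> q" "q < 1"
  shows "(\<integral>\<^sup>+x. ennreal (mehler q x x) \<partial>std_normal) = ennreal (1 / (1 - q))"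
proof -
  define v where "v = q / (1 + q)"
  have v: "v < 1/2" using q by (simp add: v_def field_simps)
  have Q: "1 - q\<^sup>2 = (1 - q) * (1 + q)" by (simp add: algebra_simps power2_eq_square)
  have eq: "mehler q x x = 1 / sqrt (1 - q\<^sup>2) * exp (0 * x + v * x\<^sup>2)" for x
  proof -
    have "(2 * q * x * x - q\<^sup>2 * (x\<^sup>2 + x\<^sup>2)) / (2 * (1 - q\<^sup>2)) = v * x\<^sup>2"
      using q unfolding v_def Q by (simp add: divide_simps) algebra
    then show ?thesis unfolding mehler_def by simp
  qed
  have s: "1 / sqrt (1 - q\<^sup>2) \<ge> 0" using q power2_less_1[of q] by simp
  have "(\<integral>\<^sup>+x. ennreal (mehler q x x) \<partial>std_normal) =
    (\<integral>\<^sup>+x. ennreal (1 / sqrt (1 - q\<^sup>2)) * ennreal (exp (0 * x + v * x\<^sup>2)) \<partial>std_normal)"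
    unfolding eq using s by (intro nn_integral_cong ennreal_mult) auto
  also have "\<dots> = ennreal (1 / sqrt (1 - q\<^sup>2)) * ennreal (exp (0\<^sup>2 / (2 * (1 - 2 * v))) / sqrt (1 - 2 * v))"
    by (subst nn_integral_cmult) (use nn_integral_std_normal_exp_quadratic[OF v, of 0] in auto)
  also have "\<dots> = ennreal (1 / sqrt (1 - q\<^sup>2) * (1 / sqrt (1 - 2 * v)))"
    using s v by (subst ennreal_mult) auto
  also have "1 / sqrt (1 - q\<^sup>2) * (1 / sqrt (1 - 2 * v)) = 1 / sqrt ((1 - q\<^sup>2) * (1 - 2 * v))"
    by (simp add: real_sqrt_mult)
  also have "(1 - q\<^sup>2) * (1 - 2 * v) = (1 - q)\<^sup>2"
    using q unfolding v_def by (simp add: field_simps power2_eq_square)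
  finally show ?thesis using q by simp
qed

text \<open>Tilting the square of the density by \<open>exp (- \<rho> x y / (1 - \<rho>\<^sup>2))\<close> cancels half of the
  exponent; this is the gain that the truncation of the second moment exploits.\<close>

definition tilted_mehler_square :: "real \<Rightarrow> real \<Rightarrow> real \<Rightarrow> real" where
  "tilted_mehler_square q x y = mehler q x y * mehler q x y * exp (- (q / (1 - q\<^sup>2) * (x * y)))"

lemma tilted_mehler_square_measurable [measurable (raw)]:
  assumes [measurable]: "f \<in> borel_measurable M" "g \<in> borel_measurable M"
  shows "(\<lambda>w. tilted_mehler_square q (f w) (g w)) \<in> borel_measurable M"
  unfolding tilted_mehler_square_def by measurable

text \<open>For small \<open>q\<close> the value is about exp(- q^2 / 2), against
  \<open>1 / (1 - q^2)\<close>, about exp(q^2), for the untilted square. Undoing the tilt when the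
  aligned sum is near its mean costs about exp(q^2) per edge, so the net price is exp(q^2 /
  2).\<close>

lemma nn_integral_tilted_mehler_square:
  assumes q: "0 \<le> q" "q < 1"
  shows "(\<integral>\<^sup>+x. \<integral>\<^sup>+y. ennreal (tilted_mehler_square q x y) \<partial>std_normal \<partial>std_normal) =
    ennreal (1 / sqrt (1 + q\<^sup>2 + q^4))"
proof -
  define Q where "Q = 1 - q\<^sup>2"
  have Q: "Q > 0" "Q \<le> 1" using power2_less_1 q by (auto simp: Q_def)
  have q2: "q\<^sup>2 = 1 - Q" by (auto simp: Q_def)
  define v where "v = - q\<^sup>2 / Q"
  have v0: "v \<le> 0" using Q by (simp add: v_def)
  have v1: "1 - 2 * v = (2 - Q) / Q" using Q by (simp add: v_def q2 field_simps)
  have eq: "tilted_mehler_square q x y = exp (v * x\<^sup>2) / Q * exp ((q * x / Q) * y + v * y\<^sup>2)" for x y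
  proof -
    have "sqrt Q * sqrt Q = Q" using Q by simp
    moreover have "2 * ((2 * q * x * y - q\<^sup>2 * (x\<^sup>2 + y\<^sup>2)) / (2 * Q)) - (q / Q * (x * y)) =
      v * x\<^sup>2 + ((q * x / Q) * y + v * y\<^sup>2)"
      using Q by (simp add: v_def field_simps)
    moreover have "exp a / sqrt Q * (exp a / sqrt Q) * exp (- b) = exp (2 * a - b) / (sqrt Q * sqrt Q)" for a b
    proof -
      have "exp (2 * a - b) = exp a * exp a * exp (- b)" by (simp flip: exp_add)
      then show ?thesis by simp
    qed
    ultimately show ?thesis
      unfolding tilted_mehler_square_def mehler_def Q_def[symmetric] by (simp only: exp_add) simp
  qed
  \<comment> \<open>The coefficient of \<open>x^2\<close> left in the exponent once \<open>y\<close>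
    is integrated out.\<close>
  define v' where "v' = v + q\<^sup>2 / (2 * Q * (2 - Q))"
  have v': "1 - 2 * v' = (1 + q\<^sup>2 + q^4) / (Q * (2 - Q))"
  proof -
    have "q^4 = (1 - Q)\<^sup>2" unfolding q2[symmetric] by (simp flip: power_mult)
    then have num: "1 + q\<^sup>2 + q^4 = (2 - Q)\<^sup>2 - (1 - Q)" unfolding q2 by algebra
    have "1 - 2 * v' = (2 - Q) / Q - (1 - Q) / (Q * (2 - Q))"
      unfolding v1[symmetric] v'_def q2 using Q by (simp add: divide_simps) (simp add: algebra_simps)
    also have "\<dots> = ((2 - Q)\<^sup>2 - (1 - Q)) / (Q * (2 - Q))"
      using Q by (simp add: field_simps power2_eq_square)
    finally show ?thesis unfolding num .
  qed
  have pos: "1 + q\<^sup>2 + q^4 > 0" by (simp add: add_pos_nonneg)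
  then have "1 - 2 * v' > 0" unfolding v' using Q by (intro divide_pos_pos) auto
  then have v'2: "v' < 1/2" by simp
  have inner: "(\<integral>\<^sup>+y. ennreal (tilted_mehler_square q x y) \<partial>std_normal) =
     ennreal (1 / (Q * sqrt (1 - 2 * v))) * ennreal (exp (0 * x + v' * x\<^sup>2))" for x
  proof -
    have "(\<integral>\<^sup>+y. ennreal (tilted_mehler_square q x y) \<partial>std_normal) =
      (\<integral>\<^sup>+y. ennreal (exp (v * x\<^sup>2) / Q) * ennreal (exp ((q * x / Q) * y + v * y\<^sup>2)) \<partial>std_normal)"
      unfolding eq using Q by (intro nn_integral_cong ennreal_mult) auto
    also have "\<dots> = ennreal (exp (v * x\<^sup>2) / Q) *
        ennreal (exp ((q * x / Q)\<^sup>2 / (2 * (1 - 2 * v))) / sqrt (1 - 2 * v))"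
      using v0 by (subst nn_integral_cmult, simp, subst nn_integral_std_normal_exp_quadratic) auto
    also have "\<dots> = ennreal (exp (v * x\<^sup>2) / Q * (exp ((q * x / Q)\<^sup>2 / (2 * (1 - 2 * v))) / sqrt (1 - 2 * v)))"
      using v0 Q by (intro ennreal_mult[symmetric]) auto
    also have "exp (v * x\<^sup>2) / Q * (exp ((q * x / Q)\<^sup>2 / (2 * (1 - 2 * v))) / sqrt (1 - 2 * v)) =
        1 / (Q * sqrt (1 - 2 * v)) * exp (v * x\<^sup>2 + (q * x / Q)\<^sup>2 / (2 * (1 - 2 * v)))"
      by (simp add: exp_add)
    also have "v * x\<^sup>2 + (q * x / Q)\<^sup>2 / (2 * (1 - 2 * v)) = 0 * x + v' * x\<^sup>2"
      using Q unfolding v1 v'_def by (simp add: field_simps power2_eq_square)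
    also have "ennreal (1 / (Q * sqrt (1 - 2 * v)) * exp (0 * x + v' * x\<^sup>2)) =
      ennreal (1 / (Q * sqrt (1 - 2 * v))) * ennreal (exp (0 * x + v' * x\<^sup>2))"
      using Q v0 by (intro ennreal_mult) auto
    finally show ?thesis .
  qed
  have "(\<integral>\<^sup>+x. \<integral>\<^sup>+y. ennreal (tilted_mehler_square q x y) \<partial>std_normal \<partial>std_normal) =
      ennreal (1 / (Q * sqrt (1 - 2 * v))) * ennreal (exp (0\<^sup>2 / (2 * (1 - 2 * v'))) / sqrt (1 - 2 * v'))"
    unfolding inner
    by (subst nn_integral_cmult) (use nn_integral_std_normal_exp_quadratic[OF v'2, of 0] in auto)
  also have "\<dots> = ennreal (1 / (Q * sqrt (1 - 2 * v)) * (1 / sqrt (1 - 2 * v')))"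
    using Q v0 v'2 by (subst ennreal_mult) auto
  also have "1 / (Q * sqrt (1 - 2 * v)) * (1 / sqrt (1 - 2 * v')) = 1 / (sqrt (Q\<^sup>2 * (1 - 2 * v) * (1 - 2 * v')))"
    using Q by (simp add: real_sqrt_mult)
  also have "Q\<^sup>2 * (1 - 2 * v) * (1 - 2 * v') = 1 + q\<^sup>2 + q^4"
    unfolding v1 v' using Q by (simp add: field_simps power2_eq_square)
  finally show ?thesis .
qed

text \<open>Brings the moment generating function into Chernoff form: \<open>y / 2\<close> is the
  leading term of \<open>- ln (1 - y) / 2\<close> and \<open>y^2\<close> bounds the rest.\<close>

lemma inverse_sqrt_le_exp:
  assumes "\<bar>y\<bar> \<le> 1/2"
  shows "1 / sqrt (1 - y) \<le> exp (y / 2 + y\<^sup>2)"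
proof -
  have "\<bar>ln (1 + (-y)) - (-y)\<bar> \<le> 2 * (-y)\<^sup>2"
    using assms by (intro abs_ln_one_plus_x_minus_x_bound) auto
  then have "ln (1 - y) \<ge> - y - 2 * y\<^sup>2" by simp
  then have "exp (- (y / 2 + y\<^sup>2)) \<le> exp (ln (1 - y) / 2)" by simp
  also have "\<dots> = sqrt (1 - y)"
    using assms by (simp add: ln_sqrt[symmetric])
  finally have le: "exp (- (y / 2 + y\<^sup>2)) \<le> sqrt (1 - y)" .
  have "sqrt (1 - y) > 0" using assms by simp
  then have "1 / sqrt (1 - y) \<le> 1 / exp (- (y / 2 + y\<^sup>2))" using le by (intro divide_left_mono) auto
  then show ?thesis by (simp only: exp_minus divide_inverse inverse_inverse_eq mult_1_left)
qed

interpretation std_normal: prob_space std_normal by (rule prob_space_std_normal)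

interpretation std_normal2: pair_prob_space std_normal std_normal
  by (simp add: pair_prob_space_def pair_sigma_finite_def prob_space_std_normal
        prob_space_imp_sigma_finite)

lemma nn_integral_bivariate_normal:
  assumes [measurable]: "f \<in> borel_measurable (borel \<Otimes>\<^sub>M borel)"
  shows "(\<integral>\<^sup>+w. f w \<partial>bivariate_normal \<rho>) =
    (\<integral>\<^sup>+x. \<integral>\<^sup>+y. f (x, \<rho> * x + sqrt (1 - \<rho>\<^sup>2) * y) \<partial>std_normal \<partial>std_normal)"
  unfolding bivariate_normal_def
  by (subst nn_integral_distr, measurable, subst std_normal.nn_integral_fst[symmetric], measurable)

text \<open>Given the first coordinate, the exponent is linear in the second noise, which leaves a
  single quadratic in \<open>x\<close>. Working from the definition as an image measure rather than
  from a density also covers \<rho> = 1, which may occur above the threshold.\<close>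

lemma bivariate_normal_mgf:
  assumes \<rho>: "0 \<le> \<rho>" "\<rho> \<le> 1" and s: "2 * s * \<rho> + s\<^sup>2 * (1 - \<rho>\<^sup>2) < 1"
  shows "(\<integral>\<^sup>+w. ennreal (exp (s * (fst w * snd w))) \<partial>bivariate_normal \<rho>) =
    ennreal (1 / sqrt (1 - (2 * s * \<rho> + s\<^sup>2 * (1 - \<rho>\<^sup>2))))"
proof -
  define c where "c = sqrt (1 - \<rho>\<^sup>2)"
  have c2: "c\<^sup>2 = 1 - \<rho>\<^sup>2" using \<rho> by (simp add: c_def power_le_one)
  define v where "v = s * \<rho> + s\<^sup>2 * c\<^sup>2 / 2"
  have v: "v < 1/2" and v2: "2 * v = 2 * s * \<rho> + s\<^sup>2 * (1 - \<rho>\<^sup>2)" using s by (auto simp: v_def c2)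
  have "(\<integral>\<^sup>+w. ennreal (exp (s * (fst w * snd w))) \<partial>bivariate_normal \<rho>) =
     (\<integral>\<^sup>+x. \<integral>\<^sup>+y. ennreal (exp (s * \<rho> * x\<^sup>2)) * ennreal (exp ((s * x * c) * y + 0 * y\<^sup>2)) \<partial>std_normal \<partial>std_normal)"
    by (subst nn_integral_bivariate_normal)
       (auto simp: c_def algebra_simps power2_eq_square simp flip: ennreal_mult exp_add)
  also have "\<dots> = (\<integral>\<^sup>+x. ennreal (exp (s * \<rho> * x\<^sup>2)) * ennreal (exp ((s * x * c)\<^sup>2 / 2)) \<partial>std_normal)"
    by (subst nn_integral_cmult, simp) (subst nn_integral_std_normal_exp_quadratic, auto)
  also have "\<dots> = (\<integral>\<^sup>+x. ennreal (exp (0 * x + v * x\<^sup>2)) \<partial>std_normal)"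
    by (simp add: v_def power_mult_distrib algebra_simps add_divide_distrib flip: ennreal_mult exp_add)
  also have "\<dots> = ennreal (1 / sqrt (1 - (2 * s * \<rho> + s\<^sup>2 * (1 - \<rho>\<^sup>2))))"
    by (subst nn_integral_std_normal_exp_quadratic[OF v]) (simp only: v2, simp)
  finally show ?thesis .
qed

lemma bivariate_normal_density:
  assumes \<rho>: "0 \<le> \<rho>" "\<rho> < 1"
  shows "bivariate_normal \<rho> = density (std_normal \<Otimes>\<^sub>M std_normal) (\<lambda>w. ennreal (mehler \<rho> (fst w) (snd w)))"
proof (rule measure_eqI)
  have sets: "sets (std_normal \<Otimes>\<^sub>M std_normal) = sets (borel \<Otimes>\<^sub>M (borel :: real measure))"
    by (intro sets_pair_measure_cong) auto
  show "sets (bivariate_normal \<rho>) = sets (density (std_normal \<Otimes>\<^sub>M std_normal) (\<lambda>w. ennreal (mehler \<rho> (fst w) (snd w))))"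
    using sets by simp
  fix A assume "A \<in> sets (bivariate_normal \<rho>)"
  then have A[measurable]: "A \<in> sets (borel \<Otimes>\<^sub>M borel)" by simp
  define c where "c = sqrt (1 - \<rho>\<^sup>2)"
  have c: "c > 0" and c2: "c\<^sup>2 = 1 - \<rho>\<^sup>2" using \<rho> power2_less_1[of \<rho>] by (auto simp: c_def)
  have inner: "(\<integral>\<^sup>+y. indicator A (x, \<rho> * x + c * y) \<partial>std_normal) =
     (\<integral>\<^sup>+y. ennreal (mehler \<rho> x y) * indicator A (x, y) \<partial>std_normal)" for x
  proof -
    \<comment> \<open>\<open>mehler \<rho> x\<close> is the density of N(\<rho> x, c^2) relative to
      the standard normal; the factor \<open>c\<close> is the Jacobian of y -> \<rho> x + c
      y.\<close>
    have id: "mehler \<rho> x (\<rho> * x + c * y) * std_normal_density (\<rho> * x + c * y) * c = std_normal_density y" for y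
    proof -
      have "(2 * \<rho> * x * (\<rho> * x + c * y) - \<rho>\<^sup>2 * (x\<^sup>2 + (\<rho> * x + c * y)\<^sup>2)) / (2 * c\<^sup>2) - (\<rho> * x + c * y)\<^sup>2 / 2
         = ((2 * \<rho> * x * (\<rho> * x + c * y) - \<rho>\<^sup>2 * (x\<^sup>2 + (\<rho> * x + c * y)\<^sup>2)) - c\<^sup>2 * (\<rho> * x + c * y)\<^sup>2) / (2 * c\<^sup>2)"
        using c by (simp add: field_simps)
      also have "(2 * \<rho> * x * (\<rho> * x + c * y) - \<rho>\<^sup>2 * (x\<^sup>2 + (\<rho> * x + c * y)\<^sup>2)) - c\<^sup>2 * (\<rho> * x + c * y)\<^sup>2 = - c\<^sup>2 * y\<^sup>2"
        using c2 by algebra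
      also have "\<dots> / (2 * c\<^sup>2) = - y\<^sup>2 / 2" using c by simp
      finally have e: "(2 * \<rho> * x * (\<rho> * x + c * y) - \<rho>\<^sup>2 * (x\<^sup>2 + (\<rho> * x + c * y)\<^sup>2)) / (2 * c\<^sup>2) + - (\<rho> * x + c * y)\<^sup>2 / 2 = - y\<^sup>2 / 2"
        by simp
      show ?thesis
        unfolding mehler_def std_normal_density_def c_def[symmetric] c2[symmetric]
        using c arg_cong[OF e, of exp] unfolding exp_add by simp
    qed
    have "(\<integral>\<^sup>+y. ennreal (mehler \<rho> x y) * indicator A (x, y) \<partial>std_normal) =
      (\<integral>\<^sup>+y. ennreal (std_normal_density y) * (ennreal (mehler \<rho> x y) * indicator A (x, y)) \<partial>lborel)"
      by (subst nn_integral_std_normal) auto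
    also have "\<dots> = ennreal c * (\<integral>\<^sup>+y. ennreal (std_normal_density (\<rho> * x + c * y)) *
        (ennreal (mehler \<rho> x (\<rho> * x + c * y)) * indicator A (x, \<rho> * x + c * y)) \<partial>lborel)"
      using c by (subst nn_integral_real_affine[where c = c and t = "\<rho> * x"]) simp_all
    also have "\<dots> = (\<integral>\<^sup>+y. ennreal c * (ennreal (std_normal_density (\<rho> * x + c * y)) *
        (ennreal (mehler \<rho> x (\<rho> * x + c * y)) * indicator A (x, \<rho> * x + c * y))) \<partial>lborel)"
      by (rule nn_integral_cmult[symmetric]) measurable
    also have "\<dots> = (\<integral>\<^sup>+y. ennreal (std_normal_density y) * indicator A (x, \<rho> * x + c * y) \<partial>lborel)"
    proof (rule nn_integral_cong)
      fix y
      have "ennreal (std_normal_density y) =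
        ennreal c * ennreal (std_normal_density (\<rho> * x + c * y)) * ennreal (mehler \<rho> x (\<rho> * x + c * y))"
        unfolding id[of y, symmetric] using c \<rho> mehler_nonneg[of \<rho>] by (simp add: ennreal_mult mult_ac)
      then show "ennreal c * (ennreal (std_normal_density (\<rho> * x + c * y)) *
        (ennreal (mehler \<rho> x (\<rho> * x + c * y)) * indicator A (x, \<rho> * x + c * y))) =
        ennreal (std_normal_density y) * indicator A (x, \<rho> * x + c * y)"
        by (simp only: mult.assoc)
    qed
    also have "\<dots> = (\<integral>\<^sup>+y. indicator A (x, \<rho> * x + c * y) \<partial>std_normal)"
      by (subst nn_integral_std_normal) auto
    finally show ?thesis by simp
  qed
  have "emeasure (bivariate_normal \<rho>) A = (\<integral>\<^sup>+w. indicator A w \<partial>bivariate_normal \<rho>)" by simp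
  also have "\<dots> = (\<integral>\<^sup>+x. \<integral>\<^sup>+y. ennreal (mehler \<rho> x y) * indicator A (x, y) \<partial>std_normal \<partial>std_normal)"
    by (subst nn_integral_bivariate_normal) (auto simp: inner c_def[symmetric])
  also have "\<dots> = (\<integral>\<^sup>+w. ennreal (mehler \<rho> (fst w) (snd w)) * indicator A w \<partial>(std_normal \<Otimes>\<^sub>M std_normal))"
    by (subst std_normal.nn_integral_fst[symmetric]) (auto simp: measurable_cong_sets[OF sets refl])
  also have "\<dots> = emeasure (density (std_normal \<Otimes>\<^sub>M std_normal) (\<lambda>w. ennreal (mehler \<rho> (fst w) (snd w)))) A"
    using A by (subst emeasure_density) (auto simp: sets)
  finally show "emeasure (bivariate_normal \<rho>) A = emeasure (density (std_normal \<Otimes>\<^sub>M std_normal) (\<lambda>w. ennreal (mehler \<rho> (fst w) (snd w)))) A" .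
qed

section \<open>Cycle integrals\<close>

text \<open>The exponent is 2 q where the truth is q + O(q^2). The loss is affordable because edges
  inside large fixed sets never reach this bound: the truncation handles them.\<close>

lemma one_over_one_minus_le_exp: "0 \<le> q \<Longrightarrow> q \<le> 1/2 \<Longrightarrow> 1 / (1 - q) \<le> exp (2 * (q::real))"
proof -
  assume q: "0 \<le> q" "q \<le> 1/2"
  have "(1 + 2 * q) * (1 - q) = 1 + q * (1 - 2 * q)" by (simp add: algebra_simps)
  also have "\<dots> \<ge> 1" using q by simp
  finally have "1 / (1 - q) \<le> 1 + 2 * q" using q by (simp add: field_simps)
  also have "\<dots> \<le> exp (2 * q)" by (rule exp_ge_add_one_self)
  finally show ?thesis .
qed

text \<open>An upper bound, up to a factor \<open>2\<close>, for the share of the edge \<open>x\<close> in the logarithm of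
  the cycle integral: orbits of length at least \<open>3\<close> are charged \<open>q\<^sub>0\<^sup>3\<close> per element.\<close>

definition cycle_cost :: "('a \<Rightarrow> 'a) \<Rightarrow> ('a \<Rightarrow> real) \<Rightarrow> real \<Rightarrow> 'a \<Rightarrow> real" where
  "cycle_cost \<sigma> q q0 x =
     (if \<sigma> x = x then q x else if \<sigma> (\<sigma> x) = x then q x * q (\<sigma> x) else q0^3)"

interpretation gauss: product_sigma_finite "\<lambda>_. std_normal" by unfold_locales

text \<open>The composition takes \<open>e\<close> out of its cycle and lets its predecessor
  \<open>f\<close> point to \<open>\<sigma> e\<close>, with the product of both correlations. A
  two-cycle becomes a fixed point of equal cost, a three-cycle becomes a two-cycle whose product of
  three correlations is at most \<open>q0^3\<close>, and points on longer cycles keep the charge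
  \<open>q0^3\<close>.\<close>

lemma cycle_cost_contract:
  assumes \<sigma>: "\<sigma> permutes D" and e: "e \<in> D" "\<sigma> e \<noteq> e"
    and q: "\<And>x. x \<in> D \<Longrightarrow> 0 \<le> q x \<and> q x \<le> q0" and q0: "q0 \<le> 1" and x: "x \<in> D" "x \<noteq> e"
    and f: "f = inv \<sigma> e"
  shows "cycle_cost (Transposition.transpose e (\<sigma> e) \<circ> \<sigma>) (q(f := q f * q e)) q0 x \<le> cycle_cost \<sigma> q q0 x"
proof -
  let ?\<tau> = "Transposition.transpose e (\<sigma> e) \<circ> \<sigma>" and ?q = "q(f := q f * q e)"
  have inj: "\<sigma> a = \<sigma> b \<longleftrightarrow> a = b" for a b using permutes_inj[OF \<sigma>] by (auto dest: injD)
  have \<sigma>f: "\<sigma> f = e" unfolding f using permutes_inverses(1)[OF \<sigma>] by simp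
  have fe: "f \<noteq> e" using \<sigma>f e by auto
  have D: "y \<in> D \<Longrightarrow> \<sigma> y \<in> D" for y using permutes_in_image[OF \<sigma>] by simp
  have fD: "f \<in> D" using \<sigma>f e permutes_in_image[OF \<sigma>] by metis
  have \<tau>f: "?\<tau> f = \<sigma> e" by (simp add: \<sigma>f)
  have \<tau>: "?\<tau> y = \<sigma> y" if "y \<noteq> e" "y \<noteq> f" for y
    using that \<sigma>f inj[of y f] inj[of y e] by (auto simp: transpose_def)
  have three: "a * b * c \<le> q0^3" if "0 \<le> a" "a \<le> q0" "0 \<le> b" "b \<le> q0" "0 \<le> c" "c \<le> q0" for a b c :: real
    using mult_mono[OF mult_mono[OF that(2,4)] that(6)] that by (simp add: power3_eq_cube)
  consider "x = f" "\<sigma> e = f" | "x = f" "\<sigma> e \<noteq> f" | "x \<noteq> f" "\<sigma> x = f" | "x \<noteq> f" "\<sigma> x \<noteq> f" by blast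
  then show ?thesis
  proof cases
    case 1
    then show ?thesis using fe by (simp add: cycle_cost_def \<sigma>f)
  next
    case 2
    have g: "?\<tau> (\<sigma> e) = \<sigma> (\<sigma> e)" using 2 e by (intro \<tau>) auto
    have "q f * q e * q (\<sigma> e) \<le> q0^3" using q fD e D by (intro three) auto
    then show ?thesis using 2 e fe g unfolding cycle_cost_def 2 \<tau>f \<sigma>f by auto
  next
    case 3
    have \<tau>x: "?\<tau> x = f" using \<tau>[of x] x 3 by simp
    have "q x * q f * q e \<le> q0^3" using q fD e D x by (intro three) auto
    then have "q x * (q f * q e) \<le> q0^3" by (simp add: mult.assoc)
    then show ?thesis using 3 x fe unfolding cycle_cost_def \<tau>x \<tau>f \<sigma>f 3 by auto
  next
    case 4
    have \<tau>x: "?\<tau> x = \<sigma> x" using \<tau>[of x] x 4 by simp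
    have "?\<tau> (\<sigma> x) = \<sigma> (\<sigma> x)" using 4 \<sigma>f inj[of x f] by (intro \<tau>) auto
    then show ?thesis using 4 unfolding cycle_cost_def \<tau>x by auto
  qed
qed

lemma cycle_cost_nonneg:
  assumes "\<sigma> permutes D" "\<And>x. x \<in> D \<Longrightarrow> 0 \<le> q x" "0 \<le> q0" "x \<in> D"
  shows "0 \<le> cycle_cost \<sigma> q q0 x"
  using assms permutes_in_image[OF assms(1)] by (auto simp: cycle_cost_def)

abbreviation std_normals :: "'a set \<Rightarrow> ('a \<Rightarrow> real) measure" where
  "std_normals E \<equiv> PiM E (\<lambda>_. std_normal)"

abbreviation std_normal_pairs :: "'a set \<Rightarrow> ('a \<Rightarrow> real \<times> real) measure" where
  "std_normal_pairs E \<equiv> PiM E (\<lambda>_. std_normal \<Otimes>\<^sub>M std_normal)"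

text \<open>Integrating out a vertex \<open>e\<close> that \<open>\<sigma>\<close> moves contracts its cycle by one element and multiplies
  the two adjacent correlations, so the cycle integrals are computed by repeated contraction.\<close>

lemma nn_integral_cycle_product_le:
  assumes "finite E" "G \<subseteq> E" "\<sigma> permutes (E - G)" "\<And>x. x \<in> E - G \<Longrightarrow> 0 \<le> q x \<and> q x \<le> q0"
    and q0: "0 \<le> q0" "q0 \<le> 1/2" and H[measurable]: "H \<in> borel_measurable borel"
  shows "(\<integral>\<^sup>+a. (\<Prod>x\<in>E. if x \<in> G then H (a x) else ennreal (mehler (q x) (a x) (a (\<sigma> x))))
            \<partial>std_normals E)
    \<le> (\<integral>\<^sup>+x. H x \<partial>std_normal) ^ card G * ennreal (exp (2 * (\<Sum>x\<in>E - G. cycle_cost \<sigma> q q0 x)))"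
  using assms(1-4)
proof (induction "card E" arbitrary: E \<sigma> q rule: less_induct)
  case less
  note fin = less.prems(1) and G = less.prems(2) and \<sigma> = less.prems(3) and q = less.prems(4)
  let ?g = "\<lambda>q \<sigma> a x. if x \<in> G then H (a x) else ennreal (mehler (q x) (a x) (a (\<sigma> x)))"
  show ?case
  proof (cases "\<forall>x\<in>E - G. \<sigma> x = x")
    \<comment> \<open>No vertex is moved: the integral factors over \<open>E\<close>, with a trace
      at each point outside \<open>G\<close>.\<close>
    case True
    have "(\<integral>\<^sup>+a. (\<Prod>x\<in>E. ?g q \<sigma> a x)
            \<partial>std_normals E) =
        (\<integral>\<^sup>+a. (\<Prod>x\<in>E. (\<lambda>y. if x \<in> G then H y else ennreal (mehler (q x) y y)) (a x)) \<partial>std_normals E)"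
      using True by (intro nn_integral_cong prod.cong) auto
    also have "\<dots> = (\<Prod>x\<in>E. \<integral>\<^sup>+y. (if x \<in> G then H y else ennreal (mehler (q x) y y)) \<partial>std_normal)"
      by (rule gauss.product_nn_integral_prod) (auto intro: fin)
    also have "\<dots> = (\<Prod>x\<in>E. if x \<in> G then \<integral>\<^sup>+y. H y \<partial>std_normal else ennreal (1 / (1 - q x)))"
    proof (intro prod.cong refl)
      fix x assume x: "x \<in> E"
      have "x \<notin> G \<Longrightarrow> 0 \<le> q x \<and> q x < 1" using q[of x] x q0 by auto
      then show "(\<integral>\<^sup>+y. (if x \<in> G then H y else ennreal (mehler (q x) y y)) \<partial>std_normal) =
          (if x \<in> G then \<integral>\<^sup>+y. H y \<partial>std_normal else ennreal (1 / (1 - q x)))"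
        using mehler_trace[of "q x"] by auto
    qed
    also have "\<dots> = (\<Prod>x\<in>G. \<integral>\<^sup>+y. H y \<partial>std_normal) * (\<Prod>x\<in>E - G. ennreal (1 / (1 - q x)))"
      by (subst prod.subset_diff[OF G fin]) (simp add: mult.commute)
    also have "(\<Prod>x\<in>E - G. ennreal (1 / (1 - q x))) \<le> (\<Prod>x\<in>E - G. ennreal (exp (2 * cycle_cost \<sigma> q q0 x)))"
    proof (rule prod_mono_ennreal)
      fix x assume x: "x \<in> E - G"
      have "q x \<le> 1/2" using q[OF x] q0 by linarith
      then show "ennreal (1 / (1 - q x)) \<le> ennreal (exp (2 * cycle_cost \<sigma> q q0 x))"
        using True x q[OF x] by (auto intro!: ennreal_leI one_over_one_minus_le_exp simp: cycle_cost_def)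
    qed
    also have "\<dots> = ennreal (exp (2 * (\<Sum>x\<in>E - G. cycle_cost \<sigma> q q0 x)))"
      using fin by (simp add: prod_ennreal exp_sum sum_distrib_left)
    finally show ?thesis by (simp add: mult_left_mono)
  next
    case False
    then obtain e where e: "e \<in> E - G" "\<sigma> e \<noteq> e" by blast
    define E' where "E' = E - {e}"
    define f where "f = inv \<sigma> e"
    define \<tau> where "\<tau> = Transposition.transpose e (\<sigma> e) \<circ> \<sigma>"
    \<comment> \<open>Contraction makes the correlations unequal, so the induction carries a
      function \<open>q\<close>; only the common bound \<open>q0\<close> survives.\<close>
    define q' where "q' = q(f := q f * q e)"
    have \<sigma>f: "\<sigma> f = e" unfolding f_def using permutes_inverses(1)[OF \<sigma>] by simp
    have fe: "f \<noteq> e" using \<sigma>f e by auto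
    have D: "\<sigma> y \<in> E - G \<longleftrightarrow> y \<in> E - G" for y using permutes_in_image[OF \<sigma>] by simp
    have fD: "f \<in> E - G" using \<sigma>f e D by metis
    have inj: "\<sigma> a = \<sigma> b \<longleftrightarrow> a = b" for a b using permutes_inj[OF \<sigma>] by (auto dest: injD)
    have E: "E = insert e E'" "e \<notin> E'" "finite E'" "G \<subseteq> E'" and E'G: "E' - G = (E - G) - {e}"
      using e fin G by (auto simp: E'_def)
    have "\<sigma> permutes insert e (E' - G)" using \<sigma> e unfolding E'G by (simp add: insert_absorb)
    then have \<tau>: "\<tau> permutes (E' - G)" unfolding \<tau>_def by (rule permutes_insert_lemma)
    have \<tau>f: "\<tau> f = \<sigma> e" by (simp add: \<tau>_def \<sigma>f)
    have \<tau>x: "\<tau> x = \<sigma> x" if "x \<noteq> e" "x \<noteq> f" for x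
      using that \<sigma>f inj[of x f] inj[of x e] by (auto simp: \<tau>_def transpose_def)
    have q': "0 \<le> q' x \<and> q' x \<le> q0" if "x \<in> E' - G" for x
    proof (cases "x = f")
      case True
      have "q f * q e \<le> q0 * 1" using q[OF fD] q[OF e(1)] q0 by (intro mult_mono) auto
      then show ?thesis using q[OF fD] q[OF e(1)] by (simp add: q'_def True)
    qed (use that q E'G in \<open>auto simp: q'_def\<close>)
    have meas[measurable]: "(\<lambda>a. a x) \<in> borel_measurable (std_normals E)" if "x \<in> E" for x
      using measurable_component_singleton[OF that, of "\<lambda>_. std_normal"] by (simp cong: measurable_cong_sets)
    have mF: "(\<lambda>a. \<Prod>x\<in>E. ?g q \<sigma> a x)
        \<in> borel_measurable (std_normals E)"
    proof (rule borel_measurable_prod_ennreal)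
      fix x assume x: "x \<in> E"
      have 1: "(\<lambda>a. H (a x)) \<in> borel_measurable (std_normals E)" using x by measurable
      have 2: "(\<lambda>a. ennreal (mehler (q x) (a x) (a (\<sigma> x)))) \<in> borel_measurable (std_normals E)"
        if "x \<notin> G" 
      proof -
        have "\<sigma> x \<in> E" using x that D by auto
        with x show ?thesis by measurable
      qed
      show "(\<lambda>a. ?g q \<sigma> a x)
        \<in> borel_measurable (std_normals E)"
        using 1 2 by (cases "x \<in> G") auto
    qed
    have "(\<integral>\<^sup>+a. (\<Prod>x\<in>E. ?g q \<sigma> a x)
            \<partial>std_normals E) =
       (\<integral>\<^sup>+a. \<integral>\<^sup>+y. (\<Prod>x\<in>E. ?g q \<sigma> (a(e := y)) x)
            \<partial>std_normal \<partial>std_normals E')"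
      using mF unfolding E(1) by (intro gauss.product_nn_integral_insert E)
    also have "\<dots> = (\<integral>\<^sup>+a. (\<Prod>x\<in>E'. ?g q' \<tau> a x)
            \<partial>std_normals E')"
    proof (rule nn_integral_cong)
      fix a :: "'a \<Rightarrow> real"
      define R where "R = (\<Prod>x\<in>E' - {f}. ?g q \<sigma> a x)"
      have fE': "f \<in> E'" "f \<notin> G" using fD fe by (auto simp: E'_def)
      \<comment> \<open>Only the factors at \<open>e\<close> and at its predecessor \<open>f\<close>
        involve \<open>y\<close>, so the integral over \<open>y\<close> is a Mehler
        convolution.\<close>
      have split: "(\<Prod>x\<in>E. ?g q \<sigma> (a(e := y)) x) =
          R * (ennreal (mehler (q f) (a f) y) * ennreal (mehler (q e) y (a (\<sigma> e))))" for y
      proof -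
        let ?f = "?g q \<sigma> (a(e := y))"
        have "(\<Prod>x\<in>E. ?f x) = ?f e * (?f f * (\<Prod>x\<in>E' - {f}. ?f x))"
          unfolding E(1) using E fE' by (simp add: prod.remove)
        also have "(\<Prod>x\<in>E' - {f}. ?f x) = R"
          unfolding R_def
        proof (intro prod.cong refl)
          fix x assume x: "x \<in> E' - {f}"
          have "\<sigma> x \<noteq> e" using x \<sigma>f inj[of x f] by auto
          then show "?f x = (?g q \<sigma> a x)"
            using x E(2) by auto
        qed
        finally show ?thesis using e fe fE' by (simp add: \<sigma>f mult_ac)
      qed
      have lt: "0 \<le> q f" "q f < 1" "0 \<le> q e" "q e < 1" using q[OF fD] q[OF e(1)] q0 by auto
      have "(\<integral>\<^sup>+y. (\<Prod>x\<in>E. ?g q \<sigma> (a(e := y)) x) \<partial>std_normal)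
          = R * ennreal (mehler (q f * q e) (a f) (a (\<sigma> e)))"
        unfolding split using lt by (subst nn_integral_cmult) (simp_all add: mehler_convolution)
      also have "\<dots> = (\<Prod>x\<in>E'. ?g q' \<tau> a x)"
      proof -
        have "R = (\<Prod>x\<in>E' - {f}. ?g q' \<tau> a x)"
          unfolding R_def by (intro prod.cong refl) (auto simp: q'_def E'_def \<tau>x)
        then show ?thesis
          using fE' E by (subst prod.remove[of _ f]) (auto simp: q'_def \<tau>f mult_ac)
      qed
      finally show "(\<integral>\<^sup>+y. (\<Prod>x\<in>E. ?g q \<sigma> (a(e := y)) x) \<partial>std_normal) =
         (\<Prod>x\<in>E'. ?g q' \<tau> a x)" .
    qed
    also have "\<dots> \<le> (\<integral>\<^sup>+x. H x \<partial>std_normal) ^ card G *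
        ennreal (exp (2 * (\<Sum>x\<in>E' - G. cycle_cost \<tau> q' q0 x)))"
    proof (intro less.hyps \<tau> q' E)
      show "card E' < card E" unfolding E'_def using fin e by (intro card_Diff1_less) auto
    qed
    also have "(\<Sum>x\<in>E' - G. cycle_cost \<tau> q' q0 x) \<le> (\<Sum>x\<in>E' - G. cycle_cost \<sigma> q q0 x)"
      unfolding \<tau>_def q'_def using \<sigma> e q q0
      by (intro sum_mono cycle_cost_contract[where D = "E - G"]) (auto simp: E'_def f_def)
    also have "\<dots> \<le> (\<Sum>x\<in>E - G. cycle_cost \<sigma> q q0 x)"
      using fin q0 q by (intro sum_mono2) (auto simp: E'_def intro!: cycle_cost_nonneg[OF \<sigma>])
    finally show ?thesis by (simp add: ennreal_leI mult_left_mono)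
  qed
qed

text \<open>When \<open>b\<close> is integrated out first, \<open>b (p e)\<close> meets exactly the
  kernels at \<open>a e\<close> and \<open>a (\<sigma> e)\<close>, where
  \<open>\<sigma> = inv p' \<circ> p\<close>. Off \<open>G\<close> the semigroup law joins them into
  a kernel of correlation \<rho>^2; on \<open>G\<close>, where the permutations agree, the tilted
  square appears. What remains is a cycle product for \<sigma>.\<close>

lemma nn_integral_two_permutations_le:
  assumes fin: "finite E" and p: "p permutes E" and p': "p' permutes E" and G: "G \<subseteq> E"
    and eq: "\<And>e. e \<in> G \<Longrightarrow> p e = p' e" and \<rho>: "0 \<le> \<rho>" "\<rho> < 1" "\<rho>\<^sup>2 \<le> 1/2"
  shows "(\<integral>\<^sup>+a. \<integral>\<^sup>+b. (\<Prod>e\<in>E. ennreal (mehler \<rho> (a e) (b (p e)))) * (\<Prod>e\<in>E. ennreal (mehler \<rho> (a e) (b (p' e))))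
        * (\<Prod>e\<in>G. ennreal (exp (- (\<rho> / (1 - \<rho>\<^sup>2) * (a e * b (p e))))))
      \<partial>std_normals E \<partial>std_normals E)
    \<le> ennreal (1 / sqrt (1 + \<rho>\<^sup>2 + \<rho>^4)) ^ card G *
       ennreal (exp (2 * (\<Sum>x\<in>E - G. cycle_cost (inv p' \<circ> p) (\<lambda>_. \<rho>\<^sup>2) (\<rho>\<^sup>2) x)))"
proof -
  let ?M = "std_normals E"
  define \<sigma> where "\<sigma> = inv p' \<circ> p"
  define H where "H x = (\<integral>\<^sup>+y. ennreal (tilted_mehler_square \<rho> x y) \<partial>std_normal)" for x
  have H[measurable]: "H \<in> borel_measurable borel"
    unfolding H_def using std_normal.borel_measurable_nn_integral_fst[of "\<lambda>(x,y). ennreal (tilted_mehler_square \<rho> x y)" borel] by simp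
  have fixG: "\<sigma> e = e" if "e \<in> G" for e
    unfolding \<sigma>_def using eq[OF that] permutes_inverses(2)[OF p'] by simp
  have \<sigma>E: "\<sigma> permutes E" unfolding \<sigma>_def by (intro permutes_compose permutes_inv p p')
  have \<sigma>: "\<sigma> permutes (E - G)"
    by (rule permutes_superset[OF \<sigma>E]) (auto simp: fixG)
  have inner: "(\<integral>\<^sup>+b. (\<Prod>e\<in>E. ennreal (mehler \<rho> (a e) (b (p e)))) * (\<Prod>e\<in>E. ennreal (mehler \<rho> (a e) (b (p' e))))
        * (\<Prod>e\<in>G. ennreal (exp (- (\<rho> / (1 - \<rho>\<^sup>2) * (a e * b (p e)))))) \<partial>?M) =
      (\<Prod>e\<in>E. if e \<in> G then H (a e) else ennreal (mehler (\<rho>\<^sup>2) (a e) (a (\<sigma> e))))" for a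
  proof -
    define w where "w e y = (if e \<in> G then ennreal (tilted_mehler_square \<rho> (a e) y)
        else ennreal (mehler \<rho> (a e) y) * ennreal (mehler \<rho> y (a (\<sigma> e))))" for e y
    have "(\<Prod>e\<in>E. ennreal (mehler \<rho> (a e) (b (p e)))) * (\<Prod>e\<in>E. ennreal (mehler \<rho> (a e) (b (p' e))))
        * (\<Prod>e\<in>G. ennreal (exp (- (\<rho> / (1 - \<rho>\<^sup>2) * (a e * b (p e)))))) = (\<Prod>e\<in>E. w (inv p e) (b e))" for b
    proof -
      have "(\<Prod>e\<in>E. ennreal (mehler \<rho> (a e) (b (p' e)))) = (\<Prod>e\<in>E. ennreal (mehler \<rho> (a (\<sigma> e)) (b (p e))))"
        by (subst prod.permute[OF \<sigma>E]) (simp add: o_def \<sigma>_def permutes_inverses(1)[OF p'])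
      moreover have "(\<Prod>e\<in>G. ennreal (exp (- (\<rho> / (1 - \<rho>\<^sup>2) * (a e * b (p e)))))) =
          (\<Prod>e\<in>E. if e \<in> G then ennreal (exp (- (\<rho> / (1 - \<rho>\<^sup>2) * (a e * b (p e))))) else 1)"
        using fin G by (simp add: prod.If_cases Int_absorb1)
      moreover have "(\<Prod>e\<in>E. w (inv p e) (b e)) = (\<Prod>e\<in>E. w e (b (p e)))"
        by (subst prod.permute[OF p]) (simp add: o_def permutes_inverses(2)[OF p])
      moreover have "ennreal (mehler \<rho> (a e) (b (p e))) * ennreal (mehler \<rho> (a (\<sigma> e)) (b (p e))) *
          (if e \<in> G then ennreal (exp (- (\<rho> / (1 - \<rho>\<^sup>2) * (a e * b (p e))))) else 1) = w e (b (p e))" for e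
        using \<rho> by (auto simp: w_def fixG tilted_mehler_square_def mehler_nonneg ennreal_mult mehler_commute)
      ultimately show ?thesis by (simp flip: prod.distrib)
    qed
    then have "(\<integral>\<^sup>+b. (\<Prod>e\<in>E. ennreal (mehler \<rho> (a e) (b (p e)))) * (\<Prod>e\<in>E. ennreal (mehler \<rho> (a e) (b (p' e))))
        * (\<Prod>e\<in>G. ennreal (exp (- (\<rho> / (1 - \<rho>\<^sup>2) * (a e * b (p e)))))) \<partial>?M) =
       (\<Prod>e\<in>E. \<integral>\<^sup>+y. w (inv p e) y \<partial>std_normal)"
      by (simp only:) (rule gauss.product_nn_integral_prod, auto simp: w_def fin)
    also have "\<dots> = (\<Prod>e\<in>E. \<integral>\<^sup>+y. w e y \<partial>std_normal)"
      by (subst prod.permute[OF p]) (simp add: o_def permutes_inverses(2)[OF p])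
    also have "\<dots> = (\<Prod>e\<in>E. if e \<in> G then H (a e) else ennreal (mehler (\<rho>\<^sup>2) (a e) (a (\<sigma> e))))"
      using \<rho> by (intro prod.cong refl) (auto simp: w_def H_def mehler_convolution power2_eq_square)
    finally show ?thesis .
  qed
  have "(\<integral>\<^sup>+a. (\<Prod>e\<in>E. if e \<in> G then H (a e) else ennreal (mehler (\<rho>\<^sup>2) (a e) (a (\<sigma> e)))) \<partial>?M)
     \<le> (\<integral>\<^sup>+x. H x \<partial>std_normal) ^ card G * ennreal (exp (2 * (\<Sum>x\<in>E - G. cycle_cost \<sigma> (\<lambda>_. \<rho>\<^sup>2) (\<rho>\<^sup>2) x)))"
    using \<rho> fin G \<sigma> by (intro nn_integral_cycle_product_le) auto
  also have "(\<integral>\<^sup>+x. H x \<partial>std_normal) = ennreal (1 / sqrt (1 + \<rho>\<^sup>2 + \<rho>^4))"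
    unfolding H_def using \<rho> by (intro nn_integral_tilted_mehler_square)
  finally show ?thesis unfolding inner \<sigma>_def .
qed

section \<open>The planted law as a density\<close>

lemma finite_edges: "finite (edges n)"
proof (rule finite_subset)
  show "edges n \<subseteq> {1..n} \<times> {1..n}" by (auto simp: edges_def)
qed auto

text \<open>Edges are ordered pairs, so the image is sorted; the identity outside
  \<open>edges n\<close> makes the action a permutation in the sense of
  \<open>permutes\<close>.\<close>

definition edge_act :: "nat \<Rightarrow> (nat \<Rightarrow> nat) \<Rightarrow> nat \<times> nat \<Rightarrow> nat \<times> nat" where
  "edge_act n \<pi> e = (if e \<in> edges n
     then (min (\<pi> (fst e)) (\<pi> (snd e)), max (\<pi> (fst e)) (\<pi> (snd e))) else e)"

lemma edge_act_in_edges: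
  assumes "\<pi> permutes {1..n}" "e \<in> edges n"
  shows "edge_act n \<pi> e \<in> edges n"
proof -
  obtain i j where e: "e = (i, j)" "1 \<le> i" "i < j" "j \<le> n" using assms(2) by (auto simp: edges_def)
  have "\<pi> i \<in> {1..n}" "\<pi> j \<in> {1..n}" using e permutes_in_image[OF assms(1)] by auto
  moreover have "\<pi> i \<noteq> \<pi> j" using e permutes_inj[OF assms(1)] by (auto dest: injD)
  ultimately show ?thesis using assms(2) e by (auto simp: edge_act_def edges_def min_def max_def)
qed

lemma edge_act_comp:
  assumes "\<pi> permutes {1..n}" "\<pi>' permutes {1..n}"
  shows "edge_act n (\<pi> \<circ> \<pi>') = edge_act n \<pi> \<circ> edge_act n \<pi>'"
proof
  fix e
  show "edge_act n (\<pi> \<circ> \<pi>') e = (edge_act n \<pi> \<circ> edge_act n \<pi>') e"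
  proof (cases "e \<in> edges n")
    case True
    then show ?thesis
      using edge_act_in_edges[OF assms(2) True] by (auto simp: edge_act_def min_def max_def)
  qed (simp add: edge_act_def)
qed

lemma edge_act_id: "edge_act n id = id"
  by (auto simp: edge_act_def edges_def fun_eq_iff)

lemma edge_act_inverse:
  assumes "\<pi> permutes {1..n}"
  shows "edge_act n (inv \<pi>) (edge_act n \<pi> e) = e" "edge_act n \<pi> (edge_act n (inv \<pi>) e) = e"
proof -
  have "edge_act n (inv \<pi>) \<circ> edge_act n \<pi> = id" "edge_act n \<pi> \<circ> edge_act n (inv \<pi>) = id"
    using edge_act_comp[OF permutes_inv[OF assms] assms] edge_act_comp[OF assms permutes_inv[OF assms]]
    by (simp_all add: edge_act_id permutes_inv_o[OF assms])
  then show "edge_act n (inv \<pi>) (edge_act n \<pi> e) = e" "edge_act n \<pi> (edge_act n (inv \<pi>) e) = e"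
    by (metis comp_apply id_apply)+
qed

lemma edge_act_permutes:
  assumes "\<pi> permutes {1..n}"
  shows "edge_act n \<pi> permutes edges n"
proof (rule bij_imp_permutes)
  show "bij_betw (edge_act n \<pi>) (edges n) (edges n)"
    by (rule bij_betw_byWitness[where f' = "edge_act n (inv \<pi>)"])
       (simp_all add: image_subset_iff edge_act_inverse[OF assms] edge_act_in_edges[OF assms]
         edge_act_in_edges[OF permutes_inv[OF assms]])
qed (simp add: edge_act_def)

lemma inv_edge_act:
  assumes "\<pi> permutes {1..n}"
  shows "inv (edge_act n \<pi>) = edge_act n (inv \<pi>)"
  by (rule inv_equality) (auto simp: edge_act_inverse[OF assms])

lemma sym_mat_cong: "(\<And>e. e \<in> edges n \<Longrightarrow> w e = w' e) \<Longrightarrow> sym_mat n w = sym_mat n w'"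
  by (auto simp: sym_mat_def edges_def fun_eq_iff restrict_def)

lemma sym_mat_edge: "(i, j) \<in> edges n \<Longrightarrow> sym_mat n w (i, j) = w (i, j)"
  by (auto simp: sym_mat_def edges_def)

lemma sym_mat_permuted_edge:
  assumes \<pi>: "\<pi> permutes {1..n}" and e: "(i, j) \<in> edges n"
  shows "sym_mat n w (\<pi> i, \<pi> j) = w (edge_act n \<pi> (i, j))"
proof -
  have "\<pi> i \<in> {1..n}" "\<pi> j \<in> {1..n}" using e permutes_in_image[OF \<pi>] by (auto simp: edges_def)
  moreover have "\<pi> i \<noteq> \<pi> j" using e permutes_inj[OF \<pi>] by (auto simp: edges_def dest: injD)
  ultimately show ?thesis using e by (auto simp: sym_mat_def edge_act_def min_def max_def)
qed

text \<open>Cancels the relabelling by \<open>inv \<pi>\<close> in \<open>planted_law_given\<close>: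
  edge weights already moved along \<pi> are carried back to their own places.\<close>

lemma sym_mat_relabel:
  assumes \<pi>: "\<pi> permutes {1..n}"
  shows "(\<lambda>(k, l)\<in>{1..n} \<times> {1..n}. sym_mat n (\<lambda>e. w (edge_act n \<pi> e)) (inv \<pi> k, inv \<pi> l)) = sym_mat n w"
proof
  fix kl :: "nat \<times> nat"
  obtain k l where kl: "kl = (k, l)" by (cases kl)
  have surj: "\<pi> (inv \<pi> m) = m" for m using permutes_inverses(1)[OF \<pi>] .
  have in1: "inv \<pi> m \<in> {1..n} \<longleftrightarrow> m \<in> {1..n}" for m using permutes_in_image[OF permutes_inv[OF \<pi>]] .
  have inj: "inv \<pi> k = inv \<pi> l \<Longrightarrow> k = l" by (metis surj)
  show "(\<lambda>(k, l)\<in>{1..n} \<times> {1..n}. sym_mat n (\<lambda>e. w (edge_act n \<pi> e)) (inv \<pi> k, inv \<pi> l)) kl = sym_mat n w kl"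
  proof (cases "k \<in> {1..n} \<and> l \<in> {1..n}")
    case True
    then have "inv \<pi> k \<in> {1..n}" "inv \<pi> l \<in> {1..n}" using in1 by auto
    then show ?thesis using True inj
      by (auto simp: kl sym_mat_def edge_act_def edges_def surj min_def max_def)
  qed (auto simp: kl sym_mat_def)
qed

definition aligned_sum :: "(nat \<Rightarrow> nat) \<Rightarrow> (nat \<times> nat) set \<Rightarrow> mat_fun \<times> mat_fun \<Rightarrow> real" where
  "aligned_sum \<pi> G x = (\<Sum>(i, j)\<in>G. fst x (i, j) * snd x (\<pi> i, \<pi> j))"

definition likelihood :: "nat \<Rightarrow> real \<Rightarrow> (nat \<Rightarrow> nat) \<Rightarrow> mat_fun \<times> mat_fun \<Rightarrow> real" where
  "likelihood n \<rho> \<pi> x = (\<Prod>(i, j)\<in>edges n. mehler \<rho> (fst x (i, j)) (snd x (\<pi> i, \<pi> j)))"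

lemma obs_entry_measurable:
  assumes "\<pi> permutes {1..n}" "(i, j) \<in> edges n"
  shows "(\<lambda>x. fst x (i, j)) \<in> borel_measurable (obs_space n)"
    and "(\<lambda>x. snd x (\<pi> i, \<pi> j)) \<in> borel_measurable (obs_space n)"
proof -
  have "(i, j) \<in> {1..n} \<times> {1..n}" using assms(2) by (auto simp: edges_def)
  moreover from this have "(\<pi> i, \<pi> j) \<in> {1..n} \<times> {1..n}" using permutes_in_image[OF assms(1)] by simp
  ultimately have "(\<lambda>x. x (i, j)) \<in> borel_measurable (mat_space n)" "(\<lambda>x. x (\<pi> i, \<pi> j)) \<in> borel_measurable (mat_space n)"
    unfolding mat_space_def by (auto intro: measurable_component_singleton)
  then show "(\<lambda>x. fst x (i, j)) \<in> borel_measurable (obs_space n)"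
     "(\<lambda>x. snd x (\<pi> i, \<pi> j)) \<in> borel_measurable (obs_space n)"
    unfolding obs_space_def by measurable
qed

lemma aligned_sum_measurable:
  assumes "\<pi> permutes {1..n}" "G \<subseteq> edges n"
  shows "aligned_sum \<pi> G \<in> borel_measurable (obs_space n)"
  unfolding aligned_sum_def
proof (rule borel_measurable_sum)
  fix e assume e: "e \<in> G"
  obtain i j where ij: "e = (i, j)" by (cases e)
  then have "(i, j) \<in> edges n" using e assms(2) by auto
  note [measurable] = obs_entry_measurable[OF assms(1) this]
  show "(\<lambda>x. case e of (i, j) \<Rightarrow> fst x (i, j) * snd x (\<pi> i, \<pi> j)) \<in> borel_measurable (obs_space n)"
    unfolding ij prod.case by measurable
qed

lemma likelihood_measurable:
  assumes "\<pi> permutes {1..n}"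
  shows "likelihood n \<rho> \<pi> \<in> borel_measurable (obs_space n)"
  unfolding likelihood_def
proof (rule borel_measurable_prod)
  fix e assume e: "e \<in> edges n"
  obtain i j where ij: "e = (i, j)" by (cases e)
  note [measurable] = obs_entry_measurable[OF assms e[unfolded ij]]
  show "(\<lambda>x. case e of (i, j) \<Rightarrow> mehler \<rho> (fst x (i, j)) (snd x (\<pi> i, \<pi> j))) \<in> borel_measurable (obs_space n)"
    unfolding ij prod.case by measurable
qed

lemma likelihood_nonneg: "0 \<le> \<rho> \<Longrightarrow> \<rho> \<le> 1 \<Longrightarrow> likelihood n \<rho> \<pi> x \<ge> 0"
  unfolding likelihood_def by (intro prod_nonneg) (simp add: split_beta mehler_nonneg)

lemma sets_std_normal_pair: "sets (std_normal \<Otimes>\<^sub>M std_normal) = sets (borel \<Otimes>\<^sub>M (borel :: real measure))"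
  by (intro sets_pair_measure_cong) auto

interpretation gauss2: product_sigma_finite "\<lambda>_. std_normal \<Otimes>\<^sub>M std_normal" by unfold_locales

lemma PiM_std_normal_measurable_component:
  "x \<in> E \<Longrightarrow> (\<lambda>a. a x) \<in> borel_measurable (std_normals E)"
  using measurable_component_singleton[of x E "\<lambda>_. std_normal"] by (simp cong: measurable_cong_sets)

text \<open>Regroups the i.i.d. pairs into two independent families, so that the variables of B
  alone can be integrated out or permuted. It is checked on boxes, whose indicators factor over
  \<open>E\<close>.\<close>

lemma PiM_std_normal_pair:
  assumes fin: "finite E"
  shows "distr (std_normals E \<Otimes>\<^sub>M std_normals E) (std_normal_pairs E)
      (\<lambda>(a, b). \<lambda>e\<in>E. (a e, b e)) = std_normal_pairs E"
proof (rule gauss2.PiM_eqI[OF fin])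
  let ?M = "std_normals E" and ?N = "std_normal_pairs E"
  let ?T = "(\<lambda>(a, b). \<lambda>e\<in>E. (a e, b e))"
  let ?D = "distr (?M \<Otimes>\<^sub>M ?M) ?N ?T"
  interpret P: sigma_finite_measure ?M by (rule gauss.sigma_finite[OF fin])
  fix A :: "'a \<Rightarrow> (real \<times> real) set" assume A: "\<And>e. e \<in> E \<Longrightarrow> A e \<in> sets (std_normal \<Otimes>\<^sub>M std_normal)"
  have Am: "A e \<in> sets (borel \<Otimes>\<^sub>M borel)" if "e \<in> E" for e using A[OF that] sets_std_normal_pair by simp
  have T: "?T \<in> measurable (?M \<Otimes>\<^sub>M ?M) ?N"
    by measurable
  have SA: "Pi\<^sub>E E A \<in> sets ?N" using fin A by (intro sets_PiM_I_finite) auto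
  have ind: "indicator (Pi\<^sub>E E A) (\<lambda>e\<in>E. (a e, b e)) = (\<Prod>e\<in>E. indicator (A e) (a e, b e) :: ennreal)" for a b
  proof (cases "\<forall>e\<in>E. (a e, b e) \<in> A e")
    case True then show ?thesis by (simp add: indicator_def PiE_iff)
  next
    case False
    then obtain e where e: "e \<in> E" "(a e, b e) \<notin> A e" by blast
    then have "(\<Prod>e\<in>E. indicator (A e) (a e, b e) :: ennreal) = 0"
      using fin by (intro prod_zero bexI[of _ e]) auto
    then show ?thesis using e by (auto simp: indicator_def PiE_iff)
  qed
  have m1: "(\<lambda>w. indicator (A e) (fst w e, snd w e) :: ennreal) \<in> borel_measurable (?M \<Otimes>\<^sub>M ?M)" if e: "e \<in> E" for e
  proof -
    note [measurable] = Am[OF e] PiM_std_normal_measurable_component[OF e]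
    show ?thesis by measurable
  qed
  have "emeasure (?D) (Pi\<^sub>E E A) =
     (\<integral>\<^sup>+w. indicator (Pi\<^sub>E E A) w \<partial>?D)"
    using SA by (subst nn_integral_indicator) auto
  also have "\<dots> = (\<integral>\<^sup>+w. indicator (Pi\<^sub>E E A) (?T w) \<partial>(?M \<Otimes>\<^sub>M ?M))"
    using SA by (intro nn_integral_distr[OF T]) auto
  also have "\<dots> = (\<integral>\<^sup>+w. (\<Prod>e\<in>E. indicator (A e) (fst w e, snd w e)) \<partial>(?M \<Otimes>\<^sub>M ?M))"
    by (intro nn_integral_cong) (auto simp: ind split: prod.splits)
  also have "\<dots> = (\<integral>\<^sup>+a. \<integral>\<^sup>+b. (\<Prod>e\<in>E. indicator (A e) (a e, b e)) \<partial>?M \<partial>?M)"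
    using m1 by (subst P.nn_integral_fst[symmetric]) auto
  also have "\<dots> = (\<integral>\<^sup>+a. (\<Prod>e\<in>E. (\<lambda>x. \<integral>\<^sup>+y. indicator (A e) (x, y) \<partial>std_normal) (a e)) \<partial>?M)"
  proof (intro nn_integral_cong)
    fix a
    show "(\<integral>\<^sup>+b. (\<Prod>e\<in>E. indicator (A e) (a e, b e)) \<partial>?M) = (\<Prod>e\<in>E. (\<lambda>x. \<integral>\<^sup>+y. indicator (A e) (x, y) \<partial>std_normal) (a e))"
      by (rule gauss.product_nn_integral_prod[OF fin, where f = "\<lambda>e y. indicator (A e) (a e, y)"])
         (use Am in measurable)
  qed
  also have "\<dots> = (\<Prod>e\<in>E. \<integral>\<^sup>+x. \<integral>\<^sup>+y. indicator (A e) (x, y) \<partial>std_normal \<partial>std_normal)"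
    using A by (intro gauss.product_nn_integral_prod[OF fin] std_normal.borel_measurable_nn_integral_fst) auto
  also have "\<dots> = (\<Prod>e\<in>E. emeasure (std_normal \<Otimes>\<^sub>M std_normal) (A e))"
    by (intro prod.cong refl std_normal.emeasure_pair_measure[symmetric] A)
  finally show "emeasure (?D) (Pi\<^sub>E E A) =
     (\<Prod>e\<in>E. emeasure (std_normal \<Otimes>\<^sub>M std_normal) (A e))" .
qed simp

lemma nn_integral_PiM_std_normal_pair:
  assumes fin: "finite E" and f: "f \<in> borel_measurable (std_normal_pairs E)"
  shows "(\<integral>\<^sup>+w. f w \<partial>std_normal_pairs E) =
    (\<integral>\<^sup>+a. \<integral>\<^sup>+b. f (\<lambda>e\<in>E. (a e, b e)) \<partial>std_normals E \<partial>std_normals E)"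
proof -
  let ?M = "std_normals E" and ?N = "std_normal_pairs E"
  let ?T = "(\<lambda>(a, b). \<lambda>e\<in>E. (a e, b e))"
  interpret P: sigma_finite_measure ?M by (rule gauss.sigma_finite[OF fin])
  have T: "?T \<in> measurable (?M \<Otimes>\<^sub>M ?M) ?N" by measurable
  have "(\<integral>\<^sup>+w. f w \<partial>?N) = (\<integral>\<^sup>+w. f (?T w) \<partial>(?M \<Otimes>\<^sub>M ?M))"
    by (subst PiM_std_normal_pair[OF fin, symmetric]) (rule nn_integral_distr[OF T], use f in simp)
  also have "\<dots> = (\<integral>\<^sup>+a. \<integral>\<^sup>+b. f (\<lambda>e\<in>E. (a e, b e)) \<partial>?M \<partial>?M)"
    using measurable_compose[OF T f] by (subst P.nn_integral_fst[symmetric]) (auto simp: split_beta)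
  finally show ?thesis .
qed

lemma PiM_bivariate_normal_density:
  assumes fin: "finite E" and \<rho>: "0 \<le> \<rho>" "\<rho> < 1"
  shows "PiM E (\<lambda>_. bivariate_normal \<rho>) =
    density (std_normal_pairs E) (\<lambda>w. \<Prod>e\<in>E. ennreal (mehler \<rho> (fst (w e)) (snd (w e))))"
proof -
  let ?K = "(\<lambda>w. \<Prod>e\<in>E. ennreal (mehler \<rho> (fst (w e)) (snd (w e))))"
  interpret B: prob_space "bivariate_normal \<rho>" by (rule prob_space_bivariate_normal)
  interpret PB: product_sigma_finite "\<lambda>_. bivariate_normal \<rho>" by unfold_locales
  let ?N = "std_normal_pairs E"
  have me: "(\<lambda>w. fst (w e)) \<in> borel_measurable ?N" "(\<lambda>w. snd (w e)) \<in> borel_measurable ?N" if "e \<in> E" for e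
  proof -
    have "(\<lambda>w. w e) \<in> measurable ?N (borel \<Otimes>\<^sub>M borel)"
      using measurable_component_singleton[OF that, of "\<lambda>_. std_normal \<Otimes>\<^sub>M std_normal"] sets_std_normal_pair
      by (simp cong: measurable_cong_sets)
    from measurable_compose[OF this measurable_fst] measurable_compose[OF this measurable_snd]
    show "(\<lambda>w. fst (w e)) \<in> borel_measurable ?N" "(\<lambda>w. snd (w e)) \<in> borel_measurable ?N" by auto
  qed
  have m: "?K \<in> borel_measurable ?N"
    using me by (intro borel_measurable_prod_ennreal measurable_compose[OF _ measurable_ennreal] mehler_measurable)
  have mk: "(\<lambda>w. ennreal (mehler \<rho> (fst w) (snd w))) \<in> borel_measurable (std_normal \<Otimes>\<^sub>M std_normal)"
    using sets_std_normal_pair by (simp cong: measurable_cong_sets)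
  show ?thesis
  proof (rule PB.PiM_eqI[OF fin, symmetric])
    show "sets (density ?N ?K) = sets (PiM E (\<lambda>_. bivariate_normal \<rho>))"
      by (simp only: sets_density) (intro sets_PiM_cong, auto simp: sets_std_normal_pair)
    fix A assume "\<And>e. e \<in> E \<Longrightarrow> A e \<in> sets (bivariate_normal \<rho>)"
    then have A: "A e \<in> sets (std_normal \<Otimes>\<^sub>M std_normal)" if "e \<in> E" for e
      using that sets_std_normal_pair by auto
    have SA: "Pi\<^sub>E E A \<in> sets ?N" using fin A by (intro sets_PiM_I_finite) auto
    have "emeasure (density ?N ?K) (Pi\<^sub>E E A) =
      (\<integral>\<^sup>+w. (\<Prod>e\<in>E. ennreal (mehler \<rho> (fst (w e)) (snd (w e)))) * indicator (Pi\<^sub>E E A) w \<partial>?N)"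
      using m SA by (intro emeasure_density) auto
    also have "\<dots> = (\<integral>\<^sup>+w. (\<Prod>e\<in>E. (\<lambda>z. ennreal (mehler \<rho> (fst z) (snd z)) * indicator (A e) z) (w e)) \<partial>?N)"
    proof (intro nn_integral_cong)
      fix w assume w: "w \<in> space ?N"
      have "indicator (Pi\<^sub>E E A) w = (\<Prod>e\<in>E. indicator (A e) (w e) :: ennreal)"
      proof (cases "\<forall>e\<in>E. w e \<in> A e")
        case True then show ?thesis using w by (auto simp: indicator_def PiE_iff space_PiM)
      next
        case False
        then obtain e where e: "e \<in> E" "w e \<notin> A e" by blast
        then have "(\<Prod>e\<in>E. indicator (A e) (w e) :: ennreal) = 0"
          using fin by (intro prod_zero bexI[of _ e]) auto
        then show ?thesis using e by (auto simp: indicator_def PiE_iff)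
      qed
      then show "(\<Prod>e\<in>E. ennreal (mehler \<rho> (fst (w e)) (snd (w e)))) * indicator (Pi\<^sub>E E A) w =
         (\<Prod>e\<in>E. (\<lambda>z. ennreal (mehler \<rho> (fst z) (snd z)) * indicator (A e) z) (w e))"
        by (simp add: prod.distrib)
    qed
    also have "\<dots> = (\<Prod>e\<in>E. \<integral>\<^sup>+z. ennreal (mehler \<rho> (fst z) (snd z)) * indicator (A e) z \<partial>(std_normal \<Otimes>\<^sub>M std_normal))"
      using mk A by (intro gauss2.product_nn_integral_prod[OF fin]) auto
    also have "\<dots> = (\<Prod>e\<in>E. emeasure (bivariate_normal \<rho>) (A e))"
      unfolding bivariate_normal_density[OF \<rho>] using mk A
      by (intro prod.cong refl emeasure_density[symmetric]) auto
    finally show "emeasure (density ?N ?K) (Pi\<^sub>E E A) =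
       (\<Prod>e\<in>E. emeasure (bivariate_normal \<rho>) (A e))" .
  qed
qed

lemma nn_integral_PiM_std_normal_permute:
  assumes p: "p permutes E" and f: "f \<in> borel_measurable (std_normals E)"
  shows "(\<integral>\<^sup>+b. f (\<lambda>e\<in>E. b (p e)) \<partial>std_normals E) = (\<integral>\<^sup>+b. f b \<partial>std_normals E)"
proof -
  have "distr (std_normals E) (std_normals E) (\<lambda>b. \<lambda>e\<in>E. b (p e)) = std_normals E"
    using permutes_in_image[OF p] permutes_inj_on[OF p]
    by (intro distr_PiM_reindex prob_space_std_normal) auto
  moreover have "(\<lambda>b. \<lambda>e\<in>E. b (p e)) \<in> measurable (std_normals E) (std_normals E)"
    using permutes_in_image[OF p] by (intro measurable_restrict measurable_component_singleton) auto
  ultimately show ?thesis using f by (metis nn_integral_distr)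
qed

lemma nn_integral_null_law:
  assumes f: "f \<in> borel_measurable (obs_space n)"
  shows "(\<integral>\<^sup>+x. f x \<partial>null_law n) = (\<integral>\<^sup>+a. \<integral>\<^sup>+b. f (sym_mat n a, sym_mat n b)
     \<partial>std_normals (edges n) \<partial>std_normals (edges n))"
proof -
  let ?N = "std_normal_pairs (edges n)"
  let ?T = "\<lambda>w. (sym_mat n (\<lambda>e. fst (w e)), sym_mat n (\<lambda>e. snd (w e)))"
  have T: "?T \<in> measurable ?N (obs_space n)"
    unfolding obs_space_def by (intro measurable_Pair sym_mat_measurable; measurable)
  have "(\<integral>\<^sup>+x. f x \<partial>null_law n) = (\<integral>\<^sup>+w. f (?T w) \<partial>?N)"
    unfolding null_law_def by (rule nn_integral_distr[OF T]) (use f in simp)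
  also have "\<dots> = (\<integral>\<^sup>+a. \<integral>\<^sup>+b. f (?T (\<lambda>e\<in>edges n. (a e, b e)))
     \<partial>std_normals (edges n) \<partial>std_normals (edges n))"
    by (rule nn_integral_PiM_std_normal_pair[OF finite_edges measurable_compose[OF T f]])
  finally have step: "(\<integral>\<^sup>+x. f x \<partial>null_law n) = (\<integral>\<^sup>+a. \<integral>\<^sup>+b. f (?T (\<lambda>e\<in>edges n. (a e, b e)))
     \<partial>std_normals (edges n) \<partial>std_normals (edges n))" .
  have eq: "?T (\<lambda>e\<in>edges n. (a e, b e)) = (sym_mat n a, sym_mat n b)" for a b
    by (auto intro!: sym_mat_cong)
  show ?thesis unfolding step eq ..
qed

lemma likelihood_sym_mat:
  assumes "\<pi> permutes {1..n}"
  shows "likelihood n \<rho> \<pi> (sym_mat n a, sym_mat n b) = (\<Prod>e\<in>edges n. mehler \<rho> (a e) (b (edge_act n \<pi> e)))"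
  unfolding likelihood_def using assms
  by (intro prod.cong refl) (clarsimp simp: sym_mat_edge sym_mat_permuted_edge)

lemma aligned_sum_sym_mat:
  assumes "\<pi> permutes {1..n}" "G \<subseteq> edges n"
  shows "aligned_sum \<pi> G (sym_mat n a, sym_mat n b) = (\<Sum>e\<in>G. a e * b (edge_act n \<pi> e))"
  unfolding aligned_sum_def using assms
  by (intro sum.cong refl) (clarsimp simp: subset_iff sym_mat_edge sym_mat_permuted_edge)

text \<open>The edge densities multiply, and the relabelling of B is absorbed by permuting the
  i.i.d. variables \<open>b\<close> along \<open>edge_act n \<pi>\<close>, which leaves their law
  unchanged.\<close>

lemma planted_law_given_density:
  assumes \<pi>: "\<pi> permutes {1..n}" and \<rho>: "0 \<le> \<rho>" "\<rho> < 1"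
  shows "planted_law_given n \<rho> \<pi> = density (null_law n) (\<lambda>x. ennreal (likelihood n \<rho> \<pi> x))"
proof (rule measure_eqI)
  show "sets (planted_law_given n \<rho> \<pi>) = sets (density (null_law n) (\<lambda>x. ennreal (likelihood n \<rho> \<pi> x)))"
    by (simp add: planted_law_given_def)
  fix X assume "X \<in> sets (planted_law_given n \<rho> \<pi>)"
  then have X: "X \<in> sets (obs_space n)" by (simp add: planted_law_given_def)
  let ?E = "edges n"
  let ?M = "std_normals ?E" and ?N = "std_normal_pairs ?E"
  define T where "T w = (sym_mat n (\<lambda>e. fst (w e)),
      \<lambda>(k, l) \<in> {1..n} \<times> {1..n}. sym_mat n (\<lambda>e. snd (w e)) (inv \<pi> k, inv \<pi> l))" for w :: "nat \<times> nat \<Rightarrow> real \<times> real"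
  define K where "K w = (\<Prod>e\<in>?E. ennreal (mehler \<rho> (fst (w e)) (snd (w e))))" for w :: "nat \<times> nat \<Rightarrow> real \<times> real"
  have T: "T \<in> measurable (PiM ?E (\<lambda>_. bivariate_normal \<rho>)) (obs_space n)"
    unfolding T_def by (rule planted_law_given_measurable)
  have setsN: "sets (PiM ?E (\<lambda>_. bivariate_normal \<rho>)) = sets ?N"
    using sets_std_normal_pair by (intro sets_PiM_cong) auto
  then have T': "T \<in> measurable ?N (obs_space n)" using T measurable_cong_sets[OF setsN refl] by blast
  have me: "(\<lambda>w. w e) \<in> measurable ?N (borel \<Otimes>\<^sub>M borel)" if "e \<in> ?E" for e
    using measurable_component_singleton[OF that, of "\<lambda>_. std_normal \<Otimes>\<^sub>M std_normal"] sets_std_normal_pair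
    by (simp cong: measurable_cong_sets)
  have K: "K \<in> borel_measurable ?N"
    unfolding K_def
    by (intro borel_measurable_prod_ennreal measurable_compose[OF _ measurable_ennreal] mehler_measurable
        measurable_compose[OF me measurable_fst] measurable_compose[OF me measurable_snd])
  have mX: "(\<lambda>x. indicator X x :: ennreal) \<in> borel_measurable (obs_space n)" using X by simp
  have mTX: "(\<lambda>w. indicator X (T w) :: ennreal) \<in> borel_measurable ?N" using measurable_compose[OF T' mX] .
  have mL: "(\<lambda>x. ennreal (likelihood n \<rho> \<pi> x)) \<in> borel_measurable (obs_space n)"
    using likelihood_measurable[OF \<pi>] by simp
  have "emeasure (planted_law_given n \<rho> \<pi>) X = (\<integral>\<^sup>+x. indicator X x \<partial>planted_law_given n \<rho> \<pi>)"
    using X by (simp add: planted_law_given_def)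
  also have "\<dots> = (\<integral>\<^sup>+w. indicator X (T w) \<partial>PiM ?E (\<lambda>_. bivariate_normal \<rho>))"
    unfolding planted_law_given_def T_def[symmetric] using T mX by (intro nn_integral_distr) auto
  also have "\<dots> = (\<integral>\<^sup>+w. K w * indicator X (T w) \<partial>?N)"
    unfolding PiM_bivariate_normal_density[OF finite_edges \<rho>] K_def[symmetric]
    using K mTX by (rule nn_integral_density)
  also have "\<dots> = (\<integral>\<^sup>+a. \<integral>\<^sup>+b. K (\<lambda>e\<in>?E. (a e, b e)) * indicator X (T (\<lambda>e\<in>?E. (a e, b e))) \<partial>?M \<partial>?M)"
    using K mTX by (intro nn_integral_PiM_std_normal_pair[OF finite_edges]) auto
  also have "\<dots> = (\<integral>\<^sup>+a. \<integral>\<^sup>+b. ennreal (likelihood n \<rho> \<pi> (sym_mat n a, sym_mat n b)) *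
      indicator X (sym_mat n a, sym_mat n b) \<partial>?M \<partial>?M)"
  proof (rule nn_integral_cong)
    fix a assume a: "a \<in> space ?M"
    let ?p = "edge_act n \<pi>"
    have pair: "(\<lambda>b. \<lambda>e\<in>?E. (a e, b e)) \<in> measurable ?M ?N"
    proof (rule measurable_restrict)
      fix e assume e: "e \<in> ?E"
      show "(\<lambda>b. (a e, b e)) \<in> measurable ?M (std_normal \<Otimes>\<^sub>M std_normal)"
        using measurable_component_singleton[OF e, of "\<lambda>_. std_normal"] by (intro measurable_Pair) auto
    qed
    have m: "(\<lambda>b. K (\<lambda>e\<in>?E. (a e, b e)) * indicator X (T (\<lambda>e\<in>?E. (a e, b e)))) \<in> borel_measurable ?M"
      using measurable_compose[OF pair K] measurable_compose[OF pair mTX] by simp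
    have Kp: "K (\<lambda>e\<in>?E. (a e, (\<lambda>e\<in>?E. b (?p e)) e)) = ennreal (likelihood n \<rho> \<pi> (sym_mat n a, sym_mat n b))" for b
      unfolding K_def likelihood_sym_mat[OF \<pi>] using \<rho>
      by (subst prod_ennreal[symmetric]) (auto intro: mehler_nonneg)
    have Tp: "T (\<lambda>e\<in>?E. (a e, (\<lambda>e\<in>?E. b (?p e)) e)) = (sym_mat n a, sym_mat n b)" for b
    proof -
      have "sym_mat n (\<lambda>e. fst ((\<lambda>e\<in>?E. (a e, (\<lambda>e\<in>?E. b (?p e)) e)) e)) = sym_mat n a"
        by (rule sym_mat_cong) simp
      moreover have "sym_mat n (\<lambda>e. snd ((\<lambda>e\<in>?E. (a e, (\<lambda>e\<in>?E. b (?p e)) e)) e)) = sym_mat n (\<lambda>e. b (?p e))"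
        by (rule sym_mat_cong) simp
      ultimately show ?thesis unfolding T_def by (simp only: sym_mat_relabel[OF \<pi>])
    qed
    show "(\<integral>\<^sup>+b. K (\<lambda>e\<in>?E. (a e, b e)) * indicator X (T (\<lambda>e\<in>?E. (a e, b e))) \<partial>?M) =
      (\<integral>\<^sup>+b. ennreal (likelihood n \<rho> \<pi> (sym_mat n a, sym_mat n b)) * indicator X (sym_mat n a, sym_mat n b) \<partial>?M)"
      by (subst nn_integral_PiM_std_normal_permute[OF edge_act_permutes[OF \<pi>] m, symmetric]) (simp only: Kp Tp)
  qed
  also have "\<dots> = (\<integral>\<^sup>+x. ennreal (likelihood n \<rho> \<pi> x) * indicator X x \<partial>null_law n)"
    using mL mX by (intro nn_integral_null_law[symmetric]) auto
  also have "\<dots> = emeasure (density (null_law n) (\<lambda>x. ennreal (likelihood n \<rho> \<pi> x))) X"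
    using mL X by (intro emeasure_density[symmetric]) (auto cong: measurable_cong_sets)
  finally show "emeasure (planted_law_given n \<rho> \<pi>) X = emeasure (density (null_law n) (\<lambda>x. ennreal (likelihood n \<rho> \<pi> x))) X" .
qed

text \<open>At correlation zero the tail bound for the planted law thereby also serves the null
  law.\<close>

lemma planted_law_given_0: "\<pi> permutes {1..n} \<Longrightarrow> planted_law_given n 0 \<pi> = null_law n"
  using planted_law_given_density[of \<pi> n 0] by (simp add: likelihood_def density_1)

text \<open>Exponential Markov inequality, with edges outside \<open>G\<close> integrating to 1. The
  sign of \<open>s\<close> selects the tail: positive for the upper one, negative for the lower
  one.\<close>

lemma aligned_sum_tail:
  assumes \<pi>: "\<pi> permutes {1..n}" and \<rho>: "0 \<le> \<rho>" "\<rho> \<le> 1" and G: "G \<subseteq> edges n"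
    and y: "y = 2 * s * \<rho> + s\<^sup>2 * (1 - \<rho>\<^sup>2)" "\<bar>y\<bar> \<le> 1/2"
  shows "emeasure (planted_law_given n \<rho> \<pi>) {x \<in> space (obs_space n). c \<le> s * aligned_sum \<pi> G x}
    \<le> ennreal (exp (card G * (y / 2 + y\<^sup>2) - c))"
proof -
  let ?E = "edges n"
  let ?P = "PiM ?E (\<lambda>_. bivariate_normal \<rho>)"
  interpret B: prob_space "bivariate_normal \<rho>" by (rule prob_space_bivariate_normal)
  interpret PB: product_sigma_finite "\<lambda>_. bivariate_normal \<rho>" by unfold_locales
  define T where "T w = (sym_mat n (\<lambda>e. fst (w e)),
      \<lambda>(k, l) \<in> {1..n} \<times> {1..n}. sym_mat n (\<lambda>e. snd (w e)) (inv \<pi> k, inv \<pi> l))" for w :: "nat \<times> nat \<Rightarrow> real \<times> real"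
  have T: "T \<in> measurable ?P (obs_space n)"
    unfolding T_def by (rule planted_law_given_measurable)
  let ?X = "{x \<in> space (obs_space n). c \<le> s * aligned_sum \<pi> G x}"
  have sum_m: "aligned_sum \<pi> G \<in> borel_measurable (obs_space n)"
    by (rule aligned_sum_measurable[OF \<pi> G])
  then have X: "?X \<in> sets (obs_space n)" by measurable
  have TG: "aligned_sum \<pi> G (T w) = (\<Sum>e\<in>G. fst (w e) * snd (w e))" for w
    unfolding aligned_sum_def
  proof (intro sum.cong refl, clarify)
    fix i j assume "(i, j) \<in> G"
    then have e: "(i, j) \<in> ?E" using G by auto
    then have "i \<in> {1..n}" "j \<in> {1..n}" by (auto simp: edges_def)
    then have "\<pi> i \<in> {1..n}" "\<pi> j \<in> {1..n}" using permutes_in_image[OF \<pi>] by auto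
    then show "fst (T w) (i, j) * snd (T w) (\<pi> i, \<pi> j) = fst (w (i, j)) * snd (w (i, j))"
      using e by (simp add: T_def sym_mat_edge permutes_inverses(2)[OF \<pi>])
  qed
  have finG: "finite G" using G finite_edges finite_subset by blast
  have m1: "(\<lambda>z. ennreal (exp (s * (fst z * snd z)))) \<in> borel_measurable (bivariate_normal \<rho>)"
    by measurable
  have "emeasure (planted_law_given n \<rho> \<pi>) ?X = (\<integral>\<^sup>+x. indicator ?X x \<partial>planted_law_given n \<rho> \<pi>)"
    using X by (simp add: planted_law_given_def)
  also have "\<dots> = (\<integral>\<^sup>+w. indicator ?X (T w) \<partial>?P)"
    unfolding planted_law_given_def T_def[symmetric] using T X by (intro nn_integral_distr) auto
  also have "\<dots> \<le> (\<integral>\<^sup>+w. ennreal (exp (- c)) * (\<Prod>e\<in>?E. (\<lambda>z. if e \<in> G then ennreal (exp (s * (fst z * snd z))) else 1) (w e)) \<partial>?P)"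
  proof (intro nn_integral_mono)
    fix w
    have "indicator ?X (T w) \<le> ennreal (exp (s * (\<Sum>e\<in>G. fst (w e) * snd (w e)) - c))"
      by (auto simp: indicator_def TG)
    also have "exp (s * (\<Sum>e\<in>G. fst (w e) * snd (w e)) - c) = exp (- c) * (\<Prod>e\<in>G. exp (s * (fst (w e) * snd (w e))))"
      using finG by (simp add: exp_diff exp_minus exp_sum[symmetric] sum_distrib_left field_simps)
    also have "ennreal \<dots> = ennreal (exp (- c)) * (\<Prod>e\<in>G. ennreal (exp (s * (fst (w e) * snd (w e)))))"
      by (simp add: ennreal_mult prod_nonneg prod_ennreal)
    also have "(\<Prod>e\<in>G. ennreal (exp (s * (fst (w e) * snd (w e))))) =
        (\<Prod>e\<in>?E. if e \<in> G then ennreal (exp (s * (fst (w e) * snd (w e)))) else 1)"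
      using G finite_edges by (simp add: prod.If_cases Int_absorb1)
    finally show "indicator ?X (T w) \<le> ennreal (exp (- c)) *
        (\<Prod>e\<in>?E. (\<lambda>z. if e \<in> G then ennreal (exp (s * (fst z * snd z))) else 1) (w e))" by simp
  qed
  also have "\<dots> = ennreal (exp (- c)) * (\<integral>\<^sup>+w. (\<Prod>e\<in>?E. (\<lambda>z. if e \<in> G then ennreal (exp (s * (fst z * snd z))) else 1) (w e)) \<partial>?P)"
  proof (rule nn_integral_cmult, rule borel_measurable_prod_ennreal)
    fix e assume e: "e \<in> ?E"
    show "(\<lambda>w. (\<lambda>z. if e \<in> G then ennreal (exp (s * (fst z * snd z))) else 1) (w e)) \<in> borel_measurable ?P"
      using measurable_compose[OF measurable_component_singleton[OF e] m1] by auto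
  qed
  also have "(\<integral>\<^sup>+w. (\<Prod>e\<in>?E. (\<lambda>z. if e \<in> G then ennreal (exp (s * (fst z * snd z))) else 1) (w e)) \<partial>?P) =
     (\<Prod>e\<in>?E. \<integral>\<^sup>+z. (if e \<in> G then ennreal (exp (s * (fst z * snd z))) else 1) \<partial>bivariate_normal \<rho>)"
    using m1 by (intro PB.product_nn_integral_prod finite_edges) auto
  also have "\<dots> = (\<Prod>e\<in>?E. if e \<in> G then \<integral>\<^sup>+z. ennreal (exp (s * (fst z * snd z))) \<partial>bivariate_normal \<rho> else 1)"
    using B.emeasure_space_1 by (intro prod.cong) auto
  also have "\<dots> = (\<integral>\<^sup>+z. ennreal (exp (s * (fst z * snd z))) \<partial>bivariate_normal \<rho>) ^ card G"
    using G finite_edges by (simp add: prod.If_cases Int_absorb1)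
  also have "(\<integral>\<^sup>+z. ennreal (exp (s * (fst z * snd z))) \<partial>bivariate_normal \<rho>) = ennreal (1 / sqrt (1 - y))"
  proof -
    have "2 * s * \<rho> + s\<^sup>2 * (1 - \<rho>\<^sup>2) < 1" using y by linarith
    from bivariate_normal_mgf[OF \<rho> this] show ?thesis by (simp only: y(1))
  qed
  also have "\<dots> \<le> ennreal (exp (y / 2 + y\<^sup>2))"
    using y by (intro ennreal_leI inverse_sqrt_le_exp)
  also have "ennreal (exp (- c)) * ennreal (exp (y / 2 + y\<^sup>2)) ^ card G = ennreal (exp (card G * (y / 2 + y\<^sup>2) - c))"
  proof -
    have "exp (- c) * exp (y / 2 + y\<^sup>2) ^ card G = exp (card G * (y / 2 + y\<^sup>2) - c)"
      by (simp only: exp_of_nat_mult[symmetric] exp_add[symmetric]) simp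
    then show ?thesis by (simp add: ennreal_power flip: ennreal_mult)
  qed
  finally show ?thesis by (simp add: mult_left_mono power_mono)
qed

text \<open>A Chernoff bound inside the second moment: with
  \<open>l = \<rho> / (1 - \<rho>^2)\<close>, the indicator is at most \<open>exp (l * t)\<close>
  times exp of \<open>- l\<close> times the aligned sum, and the latter splits into one tilt per
  edge of \<open>G\<close>. Taking \<open>G\<close> empty and \<open>t = 0\<close> recovers the
  plain second moment.\<close>

lemma truncated_likelihood_product_le:
  assumes \<pi>: "\<pi> permutes {1..n}" and \<pi>': "\<pi>' permutes {1..n}" and G: "G \<subseteq> edges n"
    and eq: "\<And>e. e \<in> G \<Longrightarrow> edge_act n \<pi> e = edge_act n \<pi>' e"
    and \<rho>: "0 \<le> \<rho>" "\<rho> < 1" "\<rho>\<^sup>2 \<le> 1/2"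
  shows "(\<integral>\<^sup>+x. ennreal (likelihood n \<rho> \<pi> x * likelihood n \<rho> \<pi>' x) *
       indicator {x. aligned_sum \<pi> G x \<le> t} x \<partial>null_law n)
    \<le> ennreal (exp (\<rho> / (1 - \<rho>\<^sup>2) * t) * (1 / sqrt (1 + \<rho>\<^sup>2 + \<rho>^4)) ^ card G *
       exp (2 * (\<Sum>e\<in>edges n - G. cycle_cost (edge_act n (inv \<pi>' \<circ> \<pi>)) (\<lambda>_. \<rho>\<^sup>2) (\<rho>\<^sup>2) e)))"
proof -
  let ?L = "\<lambda>x. ennreal (likelihood n \<rho> \<pi> x * likelihood n \<rho> \<pi>' x)" and ?I = "\<lambda>x. indicator {x. aligned_sum \<pi> G x \<le> t} x :: ennreal"
  let ?E = "edges n" and ?M = "std_normals (edges n)"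
  define l where "l = \<rho> / (1 - \<rho>\<^sup>2)"
  let ?e = "\<lambda>x. ennreal (exp (- (l * aligned_sum \<pi> G x)))"
  have l: "l \<ge> 0" using \<rho> by (simp add: l_def)
  have finG: "finite G" using G finite_edges finite_subset by blast
  have m: "(\<lambda>x. ?L x * ?e x)
      \<in> borel_measurable (obs_space n)"
    using likelihood_measurable[OF \<pi>] likelihood_measurable[OF \<pi>'] aligned_sum_measurable[OF \<pi> G] by measurable
  have "(\<integral>\<^sup>+x. ?L x *
       ?I x \<partial>null_law n) \<le>
     (\<integral>\<^sup>+x. ennreal (exp (l * t)) * (?L x *
        ?e x) \<partial>null_law n)"
  proof (rule nn_integral_mono)
    fix x
    have "?I x \<le> ennreal (exp (l * t - l * aligned_sum \<pi> G x))"
      using l by (auto simp: indicator_def mult_left_mono)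
    also have "\<dots> = ennreal (exp (l * t)) * ?e x"
      by (simp flip: ennreal_mult exp_add)
    finally have "?I x \<le> ennreal (exp (l * t)) * ?e x" .
    from mult_left_mono[OF this, of "?L x"]
    show "?L x * ?I x
      \<le> ennreal (exp (l * t)) * (?L x *
        ?e x)"
      by (simp add: mult_ac)
  qed
  also have "\<dots> = ennreal (exp (l * t)) * (\<integral>\<^sup>+x. ?L x *
        ?e x \<partial>null_law n)"
    using m by (intro nn_integral_cmult) (simp cong: measurable_cong_sets)
  also have "(\<integral>\<^sup>+x. ?L x *
        ?e x \<partial>null_law n) =
     (\<integral>\<^sup>+a. \<integral>\<^sup>+b. (\<Prod>e\<in>?E. ennreal (mehler \<rho> (a e) (b (edge_act n \<pi> e)))) *
        (\<Prod>e\<in>?E. ennreal (mehler \<rho> (a e) (b (edge_act n \<pi>' e))))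
        * (\<Prod>e\<in>G. ennreal (exp (- (\<rho> / (1 - \<rho>\<^sup>2) * (a e * b (edge_act n \<pi> e))))))
      \<partial>?M \<partial>?M)"
    using \<rho> finG
    by (subst nn_integral_null_law[OF m], intro nn_integral_cong)
       (simp add: likelihood_sym_mat[OF \<pi>] likelihood_sym_mat[OF \<pi>'] aligned_sum_sym_mat[OF \<pi> G] prod_ennreal
         mehler_nonneg ennreal_mult prod_nonneg l_def[symmetric] exp_sum sum_distrib_left flip: sum_negf)
  also have "\<dots> \<le> ennreal (1 / sqrt (1 + \<rho>\<^sup>2 + \<rho>^4)) ^ card G *
       ennreal (exp (2 * (\<Sum>x\<in>?E - G. cycle_cost (inv (edge_act n \<pi>') \<circ> edge_act n \<pi>) (\<lambda>_. \<rho>\<^sup>2) (\<rho>\<^sup>2) x)))"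
    using \<rho> G eq by (intro nn_integral_two_permutations_le finite_edges edge_act_permutes \<pi> \<pi>')
  also have "inv (edge_act n \<pi>') \<circ> edge_act n \<pi> = edge_act n (inv \<pi>' \<circ> \<pi>)"
    by (simp add: inv_edge_act[OF \<pi>'] edge_act_comp[OF permutes_inv[OF \<pi>'] \<pi>])
  finally show ?thesis
    unfolding l_def[symmetric] by (simp add: ennreal_mult ennreal_power mult_left_mono mult.assoc)
qed

section \<open>Total variation\<close>

text \<open>The Radon-Nikodym derivatives take values in \<open>ennreal\<close>. Their integrals
  equal 1, so they are finite almost everywhere and passing to real values does not change the
  measures.\<close>

lemma tv_dist_densities:
  assumes P: "prob_space P" and Q: "prob_space Q" and sets: "sets P = sets Q"
  obtains M :: "'a measure" and p q where "tv_dist P Q = 1 / 2 * (\<integral>x. \<bar>p x - q x\<bar> \<partial>M)"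
    "sets M = sets P" "integrable M p" "integrable M q" "\<And>x. p x \<ge> 0" "\<And>x. q x \<ge> 0"
    "\<And>X. X \<in> sets P \<Longrightarrow> (\<integral>x. indicator X x * p x \<partial>M) = measure P X"
    "\<And>X. X \<in> sets P \<Longrightarrow> (\<integral>x. indicator X x * q x \<partial>M) = measure Q X"
proof -
  define M where "M = measure_plus P Q"
  have setsM: "sets M = sets P" by (simp add: M_def)
  have dens: "density M (\<lambda>x. ennreal (enn2real (RN_deriv M N x))) = N"
    if N: "prob_space N" and dN: "density M (RN_deriv M N) = N" for N
  proof -
    have m[measurable]: "RN_deriv M N \<in> borel_measurable M" by simp
    have "(\<integral>\<^sup>+x. RN_deriv M N x \<partial>M) = emeasure (density M (RN_deriv M N)) (space M)"
      by (subst emeasure_density) (auto intro!: nn_integral_cong)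
    also have "\<dots> = emeasure N (space N)" using dN by (metis space_density)
    also have "\<dots> = 1" using N by (simp add: prob_space.emeasure_space_1)
    finally have "(\<integral>\<^sup>+x. RN_deriv M N x \<partial>M) \<noteq> \<infinity>" by simp
    then have "AE x in M. RN_deriv M N x \<noteq> \<infinity>" using m by (intro nn_integral_noteq_infinite)
    then have "density M (\<lambda>x. ennreal (enn2real (RN_deriv M N x))) = density M (RN_deriv M N)"
      by (intro density_cong) (auto elim!: eventually_mono simp: less_top)
    then show ?thesis using dN by simp
  qed
  define p where "p x = enn2real (RN_deriv M P x)" for x
  define q where "q x = enn2real (RN_deriv M Q x)" for x
  have p: "p \<in> borel_measurable M" "density M (\<lambda>x. ennreal (p x)) = P"
    unfolding p_def using dens[OF P] density_RN_deriv_measure_plus1[OF P Q sets] by (simp_all add: M_def)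
  have q: "q \<in> borel_measurable M" "density M (\<lambda>x. ennreal (q x)) = Q"
    unfolding q_def using dens[OF Q] density_RN_deriv_measure_plus2[OF P Q sets] by (simp_all add: M_def)
  have nonneg: "p x \<ge> 0" "q x \<ge> 0" for x by (simp_all add: p_def q_def)
  have int: "integrable M f \<and> (\<forall>X\<in>sets P. (\<integral>x. indicator X x * f x \<partial>M) = measure N X)"
    if f: "f \<in> borel_measurable M" "density M (\<lambda>x. ennreal (f x)) = N" "\<And>x. f x \<ge> 0" and N: "prob_space N" for f N
  proof
    interpret N: prob_space N by fact
    have sN: "sets N = sets P" unfolding f(2)[symmetric] using setsM by simp
    have "integrable N (\<lambda>_. 1 :: real)" by simp
    then have "integrable (density M (\<lambda>x. ennreal (f x))) (\<lambda>_. 1 :: real)" by (simp only: f(2))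
    then show "integrable M f" using f(1,3) by (subst (asm) integrable_density) auto
    show "\<forall>X\<in>sets P. (\<integral>x. indicator X x * f x \<partial>M) = measure N X"
    proof
      fix X assume X: "X \<in> sets P"
      have "measure N X = (\<integral>x. indicator X x \<partial>N)" using X sN sets.sets_into_space[of X N] by (simp add: Int_absorb2)
      also have "\<dots> = (\<integral>x. f x *\<^sub>R indicator X x \<partial>M)"
        using f X setsM by (subst f(2)[symmetric], subst integral_density) auto
      finally show "(\<integral>x. indicator X x * f x \<partial>M) = measure N X" by (simp add: mult.commute)
    qed
  qed
  have "tv_dist P Q = 1 / 2 * (\<integral>x. \<bar>p x - q x\<bar> \<partial>M)"
    by (simp add: tv_dist_def Let_def M_def p_def q_def)
  then show ?thesis
  proof (rule that)
    show "sets M = sets P" by (rule setsM)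
    show "0 \<le> p x" "0 \<le> q x" for x by (rule nonneg)+
    show "integrable M p" "integrable M q"
      using int[OF p nonneg(1) P] int[OF q nonneg(2) Q] by blast+
    show "(\<integral>x. indicator X x * p x \<partial>M) = measure P X" "(\<integral>x. indicator X x * q x \<partial>M) = measure Q X"
      if "X \<in> sets P" for X
      using int[OF p nonneg(1) P] int[OF q nonneg(2) Q] that by blast+
  qed
qed

text \<open>Equal total masses give P(X) - Q(X) as the integral of (1_X - 1/2)(p - q). The weight is
  1/2 in absolute value, whence the lower bound on the distance, and X = {q < p} attains equality,
  whence the upper one.\<close>

lemma
  assumes P: "prob_space P" and Q: "prob_space Q" and sets: "sets P = sets Q"
  shows tv_dist_ge: "\<And>X. X \<in> sets P \<Longrightarrow> measure P X - measure Q X \<le> tv_dist P Q"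
    and tv_dist_le: "\<And>c. (\<And>X. X \<in> sets P \<Longrightarrow> measure P X - measure Q X \<le> c) \<Longrightarrow> tv_dist P Q \<le> c"
    and tv_dist_le_1: "tv_dist P Q \<le> 1"
    and tv_dist_nonneg: "0 \<le> tv_dist P Q"
proof -
  obtain M :: "'a measure" and p q where tv: "tv_dist P Q = 1 / 2 * (\<integral>x. \<bar>p x - q x\<bar> \<partial>M)"
    and sM: "sets M = sets P" and int[simp]: "integrable M p" "integrable M q" and nonneg: "\<And>x. p x \<ge> 0" "\<And>x. q x \<ge> 0"
    and pX: "\<And>X. X \<in> sets P \<Longrightarrow> (\<integral>x. indicator X x * p x \<partial>M) = measure P X"
    and qX: "\<And>X. X \<in> sets P \<Longrightarrow> (\<integral>x. indicator X x * q x \<partial>M) = measure Q X"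
    by (rule tv_dist_densities[OF P Q sets], rule that)
  have sp: "space M = space P" "space Q = space P"
    using sets_eq_imp_space_eq[OF sM] sets_eq_imp_space_eq[OF sets] by simp_all
  have iX: "integrable M (\<lambda>x. indicator X x * p x)" "integrable M (\<lambda>x. indicator X x * q x)" if "X \<in> sets P" for X
    using that sM by (auto intro!: integrable_real_mult_indicator simp: mult.commute[of "indicator _ _"])
  have total: "(\<integral>x. p x \<partial>M) = 1" "(\<integral>x. q x \<partial>M) = 1"
  proof -
    have "(\<integral>x. p x \<partial>M) = (\<integral>x. indicator (space P) x * p x \<partial>M)"
      "(\<integral>x. q x \<partial>M) = (\<integral>x. indicator (space P) x * q x \<partial>M)"
      using sp by (auto intro!: Bochner_Integration.integral_cong)
    then show "(\<integral>x. p x \<partial>M) = 1" "(\<integral>x. q x \<partial>M) = 1"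
      using pX[OF sets.top] qX[OF sets.top] prob_space.prob_space[OF P] prob_space.prob_space[OF Q] sp by simp_all
  qed
  have X_eq: "(\<integral>x. (indicator X x - 1 / 2) * (p x - q x) \<partial>M) = measure P X - measure Q X" if X: "X \<in> sets P" for X
  proof -
    have "(\<integral>x. (indicator X x - 1 / 2) * (p x - q x) \<partial>M) =
      (\<integral>x. (indicator X x * p x - indicator X x * q x) - (p x / 2 - q x / 2) \<partial>M)"
      by (intro Bochner_Integration.integral_cong refl) (simp add: field_simps)
    also have "\<dots> = measure P X - measure Q X"
      using iX[OF X] pX[OF X] qX[OF X] total by simp
    finally show ?thesis .
  qed
  have iX': "integrable M (\<lambda>x. (indicator X x - 1 / 2) * (p x - q x))" if X: "X \<in> sets P" for X
  proof -
    have "integrable M (\<lambda>x. (indicator X x * p x - indicator X x * q x) - (p x / 2 - q x / 2))" using iX[OF X] by simp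
    moreover have "(\<lambda>x. (indicator X x - 1 / 2) * (p x - q x)) =
       (\<lambda>x. (indicator X x * p x - indicator X x * q x) - (p x / 2 - q x / 2))"
      by (simp add: fun_eq_iff field_simps)
    ultimately show ?thesis by simp
  qed
  show "measure P X - measure Q X \<le> tv_dist P Q" if X: "X \<in> sets P" for X
  proof -
    have "(\<integral>x. (indicator X x - 1 / 2) * (p x - q x) \<partial>M) \<le> (\<integral>x. \<bar>p x - q x\<bar> / 2 \<partial>M)"
    proof (rule integral_mono[OF iX'[OF X]])
      show "(indicator X x - 1 / 2) * (p x - q x) \<le> \<bar>p x - q x\<bar> / 2" for x
        by (cases "x \<in> X") (simp_all add: abs_if field_simps)
    qed simp
    then show ?thesis using X_eq[OF X] tv by simp
  qed
  show "tv_dist P Q \<le> c" if c: "\<And>X. X \<in> sets P \<Longrightarrow> measure P X - measure Q X \<le> c" for c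
  proof -
    define X where "X = {x \<in> space M. q x < p x}"
    note [measurable] = borel_measurable_integrable[OF int(1)] borel_measurable_integrable[OF int(2)]
    have "X \<in> sets M" unfolding X_def by measurable
    then have X: "X \<in> sets P" using sM by simp
    have "(\<integral>x. \<bar>p x - q x\<bar> / 2 \<partial>M) = (\<integral>x. (indicator X x - 1 / 2) * (p x - q x) \<partial>M)"
      by (intro Bochner_Integration.integral_cong) (auto simp: X_def indicator_def field_simps)
    then show ?thesis using X_eq[OF X] tv c[OF X] by simp
  qed
  show "tv_dist P Q \<le> 1"
  proof -
    have "(\<integral>x. \<bar>p x - q x\<bar> \<partial>M) \<le> (\<integral>x. p x + q x \<partial>M)"
      using nonneg by (intro integral_mono) (auto simp: abs_le_iff add_increasing add_increasing2)
    then show ?thesis using tv total by simp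
  qed
  show "0 \<le> tv_dist P Q" unfolding tv by simp
qed

text \<open>On any event \<open>f - 1\<close> is split as \<open>(f - g) + (g - 1)\<close>. The
  first part integrates to at most \<delta>; the second is controlled in L^2, since the integral of
  \<open>(g - 1)^2\<close> is at most \<open>(1 + \<eta>) - 2 * (1 - \<delta>) + 1 = \<eta> + 2 *
  \<delta>\<close>.\<close>

lemma tv_dist_le_truncated_second_moment:
  assumes P: "prob_space P" and Q: "prob_space Q" and f: "f \<in> borel_measurable Q" "\<And>x. 0 \<le> f x"
    and dens: "P = density Q (\<lambda>x. ennreal (f x))"
    and g: "g \<in> borel_measurable Q" "\<And>x. 0 \<le> g x" "\<And>x. g x \<le> f x"
    and first: "ennreal (1 - \<delta>) \<le> (\<integral>\<^sup>+x. ennreal (g x) \<partial>Q)"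
    and second: "(\<integral>\<^sup>+x. ennreal ((g x)\<^sup>2) \<partial>Q) \<le> ennreal (1 + \<eta>)"
    and v: "0 < \<eta> + 2 * \<delta>" "0 \<le> \<eta>"
  shows "tv_dist P Q \<le> \<delta> + sqrt (\<eta> + 2 * \<delta>)"
proof (rule tv_dist_le[OF P Q])
  interpret P: prob_space P by fact
  interpret Q: prob_space Q by fact
  show sets: "sets P = sets Q" by (simp add: dens)
  \<comment> \<open>A bound for the L^2 norm of \<open>g - 1\<close>, used as weight in 2 |g - 1|
    \<le> \<kappa> + (g - 1)^2 / \<kappa>; this choice reproduces the Cauchy-Schwarz bound.\<close>
  define \<kappa> where "\<kappa> = sqrt (\<eta> + 2 * \<delta>)"
  let ?q = "\<lambda>x. (\<kappa> + ((g x)\<^sup>2 - 2 * g x + 1) / \<kappa>) / 2"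
  have \<kappa>: "\<kappa> > 0" "\<kappa> * \<kappa> = \<eta> + 2 * \<delta>" using v by (auto simp: \<kappa>_def)
  have "integrable P (\<lambda>_. 1 :: real)" by simp
  then have fi: "integrable Q f" unfolding dens using f by (subst (asm) integrable_density) auto
  have gi: "integrable Q g" by (rule Bochner_Integration.integrable_bound[OF fi]) (use g f in auto)
  have g2i: "integrable Q (\<lambda>x. (g x)\<^sup>2)"
  proof (rule integrableI_bounded)
    show "(\<lambda>x. (g x)\<^sup>2) \<in> borel_measurable Q" using g by measurable
    show "(\<integral>\<^sup>+x. ennreal (norm ((g x)\<^sup>2)) \<partial>Q) < \<infinity>" using second by (simp add: le_less_trans)
  qed
  have g1: "1 - \<delta> \<le> (\<integral>x. g x \<partial>Q)"
    using first g by (subst (asm) nn_integral_eq_integral[OF gi]) (auto simp: ennreal_le_iff)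
  have g2: "(\<integral>x. (g x)\<^sup>2 \<partial>Q) \<le> 1 + \<eta>"
  proof -
    have "ennreal (\<integral>x. (g x)\<^sup>2 \<partial>Q) \<le> ennreal (1 + \<eta>)"
      using second by (subst nn_integral_eq_integral[OF g2i, symmetric]) auto
    then show ?thesis using v by (subst (asm) ennreal_le_iff) auto
  qed
  have mP: "measure P X = (\<integral>x. indicator X x * f x \<partial>Q)" if X: "X \<in> sets P" for X
  proof -
    have "measure P X = (\<integral>x. indicator X x \<partial>P)" using X sets.sets_into_space[OF X] by (simp add: Int_absorb2)
    also have "\<dots> = (\<integral>x. f x *\<^sub>R indicator X x \<partial>Q)"
      unfolding dens using f X sets by (subst integral_density) auto
    finally show ?thesis by (simp add: mult.commute)
  qed
  have ftot: "(\<integral>x. f x \<partial>Q) = 1"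
  proof -
    have "space P = space Q" using sets by (rule sets_eq_imp_space_eq)
    then have "(\<integral>x. f x \<partial>Q) = (\<integral>x. indicator (space P) x * f x \<partial>Q)"
      by (auto intro!: Bochner_Integration.integral_cong)
    then show ?thesis using mP[OF sets.top] P.prob_space by simp
  qed
  fix X assume X: "X \<in> sets P"
  then have XQ: "X \<in> sets Q" using sets by simp
  have "measure Q X = (\<integral>x. indicator X x \<partial>Q)" using XQ sets.sets_into_space[OF XQ] by (simp add: Int_absorb2)
  then have "measure P X - measure Q X = (\<integral>x. indicator X x * f x \<partial>Q) - (\<integral>x. indicator X x \<partial>Q)"
    using mP[OF X] by simp
  also have "\<dots> = (\<integral>x. indicator X x * f x - indicator X x \<partial>Q)"
    using fi XQ by (intro Bochner_Integration.integral_diff[symmetric])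
      (auto intro!: integrable_real_mult_indicator simp: mult.commute[of "indicator _ _"] less_top[symmetric])
  also have "\<dots> \<le> (\<integral>x. (f x - g x) + ?q x \<partial>Q)"
  proof (rule integral_mono)
    show "integrable Q (\<lambda>x. indicator X x * f x - indicator X x)"
      using fi XQ by (intro Bochner_Integration.integrable_diff)
      (auto intro!: integrable_real_mult_indicator simp: mult.commute[of "indicator _ _"] less_top[symmetric])
    show "integrable Q (\<lambda>x. (f x - g x) + ?q x)"
      using fi gi g2i by simp
    fix x
    have "0 \<le> (\<bar>g x - 1\<bar> - \<kappa>)\<^sup>2" by simp
    also have "(\<bar>g x - 1\<bar> - \<kappa>)\<^sup>2 = ((g x)\<^sup>2 - 2 * g x + 1) + \<kappa>\<^sup>2 - 2 * \<kappa> * \<bar>g x - 1\<bar>"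
      by (simp add: power2_diff power2_abs)
    finally have "2 * \<bar>g x - 1\<bar> \<le> \<kappa> + ((g x)\<^sup>2 - 2 * g x + 1) / \<kappa>"
      using \<kappa> by (simp add: field_simps power2_eq_square)
    then have *: "\<bar>g x - 1\<bar> \<le> ?q x" by simp
    show "indicator X x * f x - indicator X x \<le> (f x - g x) + ?q x"
    proof (cases "x \<in> X")
      case True
      then have "indicator X x * f x - indicator X x = (f x - g x) + (g x - 1)" by simp
      then show ?thesis using * by linarith
    next
      case False
      then have "indicator X x * f x - indicator X x = 0" by simp
      then show ?thesis using * g(3)[of x] by linarith
    qed
  qed
  also have "\<dots> = (1 - (\<integral>x. g x \<partial>Q)) + (\<kappa> + ((\<integral>x. (g x)\<^sup>2 \<partial>Q) - 2 * (\<integral>x. g x \<partial>Q) + 1) / \<kappa>) / 2"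
    using fi gi g2i ftot Q.prob_space by simp
  also have "\<dots> \<le> \<delta> + (\<kappa> + (\<eta> + 2 * \<delta>) / \<kappa>) / 2"
  proof -
    have "(\<kappa> + ((\<integral>x. (g x)\<^sup>2 \<partial>Q) - 2 * (\<integral>x. g x \<partial>Q) + 1) / \<kappa>) / 2 \<le> (\<kappa> + (\<eta> + 2 * \<delta>) / \<kappa>) / 2"
      using g1 g2 \<kappa> by (intro divide_right_mono add_left_mono) auto
    moreover have "1 - (\<integral>x. g x \<partial>Q) \<le> \<delta>" using g1 by simp
    ultimately show ?thesis by (rule add_mono[rotated])
  qed
  also have "\<dots> = \<delta> + sqrt (\<eta> + 2 * \<delta>)"
    unfolding \<kappa>(2)[symmetric] using \<kappa>(1) by simp
  finally show "measure P X - measure Q X \<le> \<delta> + sqrt (\<eta> + 2 * \<delta>)" .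
qed

section \<open>Weighted sums over permutations\<close>

text \<open>Points, not cycles, are collected: each two-cycle of \<sigma> counts twice.\<close>

definition two_cycle_points :: "('a \<Rightarrow> 'a) \<Rightarrow> 'a set \<Rightarrow> 'a set" where
  "two_cycle_points \<sigma> A = {a \<in> A. \<sigma> a \<noteq> a \<and> \<sigma> (\<sigma> a) = a}"

text \<open>The mean value bound for \<open>z ^ m - 1\<close>. The factor \<open>m\<close> will be
  spread as a sum over the two-cycle points.\<close>

lemma power_minus_1_le:
  fixes z :: real
  assumes "1 \<le> z"
  shows "z ^ m \<le> 1 + real m * ((z - 1) * z ^ (m - 1))"
proof (induction m)
  case (Suc m)
  have "z ^ Suc m = z * z ^ m" by simp
  also have "\<dots> \<le> z * (1 + real m * ((z - 1) * z ^ (m - 1)))"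
    using Suc assms by (intro mult_left_mono) auto
  also have "\<dots> = 1 + (z - 1) + real m * ((z - 1) * z ^ m)"
    by (cases m) (auto simp: algebra_simps)
  also have "\<dots> \<le> 1 + (z - 1) * z ^ m + real m * ((z - 1) * z ^ m)"
    using assms mult_left_mono[of 1 "z ^ m" "z - 1"] by simp
  finally show ?case by (simp add: algebra_simps)
qed simp

text \<open>Composing with the transposition removes the two-cycle formed by \<open>a\<close> and
  \<open>b\<close>. Two points disappear while the exponent on the left is already lowered by one,
  so a single factor \<open>z\<close> remains.\<close>

lemma sum_permutations_swapping:
  fixes z :: real
  assumes fin: "finite A" and ab: "a \<in> A" "b \<in> A" "a \<noteq> b"
  shows "(\<Sum>\<sigma> | \<sigma> permutes A \<and> \<sigma> a = b \<and> \<sigma> b = a. z ^ (card (two_cycle_points \<sigma> A) - 1)) =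
    (\<Sum>\<tau> | \<tau> permutes (A - {a, b}). z * z ^ card (two_cycle_points \<tau> (A - {a, b})))"
proof (rule sum.reindex_bij_witness[where
      i = "\<lambda>\<tau>. Transposition.transpose a b \<circ> \<tau>" and j = "\<lambda>\<sigma>. Transposition.transpose a b \<circ> \<sigma>"])
  let ?t = "Transposition.transpose a b"
  have t: "?t permutes A" using ab by (intro permutes_swap_id)
  fix \<sigma> assume \<sigma>: "\<sigma> \<in> {\<sigma>. \<sigma> permutes A \<and> \<sigma> a = b \<and> \<sigma> b = a}"
  have inj: "\<sigma> x = \<sigma> y \<longleftrightarrow> x = y" for x y using \<sigma> permutes_inj[of \<sigma> A] by (auto dest: injD)
  show "?t \<circ> (?t \<circ> \<sigma>) = \<sigma>" by (auto simp: fun_eq_iff)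
  have "(?t \<circ> \<sigma>) permutes A" using \<sigma> t by (auto intro: permutes_compose)
  then show \<tau>: "?t \<circ> \<sigma> \<in> {\<tau>. \<tau> permutes (A - {a, b})}"
    using \<sigma> by (auto intro!: permutes_superset[of _ A])
  have other: "(?t \<circ> \<sigma>) x = \<sigma> x" if "x \<noteq> a" "x \<noteq> b" for x
    using that \<sigma> inj[of x a] inj[of x b] by (auto simp: Transposition.transpose_def)
  have "two_cycle_points \<sigma> A = insert a (insert b (two_cycle_points (?t \<circ> \<sigma>) (A - {a, b})))"
    (is "?L = insert a (insert b ?R)")
  proof (rule set_eqI)
    fix x
    consider "x = a" | "x = b" | "x \<noteq> a" "x \<noteq> b" by blast
    then show "x \<in> ?L \<longleftrightarrow> x \<in> insert a (insert b ?R)"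
    proof cases
      case 3
      then have "\<sigma> x \<noteq> a" "\<sigma> x \<noteq> b" using \<sigma> inj[of x a] inj[of x b] by auto
      then show ?thesis using 3 other[of x] other[of "\<sigma> x"] by (auto simp: two_cycle_points_def)
    qed (use \<sigma> ab in \<open>auto simp: two_cycle_points_def\<close>)
  qed
  then have "card (two_cycle_points \<sigma> A) = Suc (Suc (card (two_cycle_points (?t \<circ> \<sigma>) (A - {a, b}))))"
    using fin ab by (simp add: two_cycle_points_def)
  then show "z * z ^ card (two_cycle_points (?t \<circ> \<sigma>) (A - {a, b})) = z ^ (card (two_cycle_points \<sigma> A) - 1)"
    by simp
next
  let ?t = "Transposition.transpose a b"
  have t: "?t permutes A" using ab by (intro permutes_swap_id)
  fix \<tau> assume "\<tau> \<in> {\<tau>. \<tau> permutes (A - {a, b})}"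
  then have \<tau>: "\<tau> permutes (A - {a, b})" by simp
  show "?t \<circ> (?t \<circ> \<tau>) = \<tau>" by (auto simp: fun_eq_iff)
  have "\<tau> permutes A" using \<tau> by (rule permutes_subset) auto
  moreover have "\<tau> a = a" "\<tau> b = b" using permutes_not_in[OF \<tau>] by auto
  ultimately show "?t \<circ> \<tau> \<in> {\<sigma>. \<sigma> permutes A \<and> \<sigma> a = b \<and> \<sigma> b = a}"
    using t by (auto intro: permutes_compose)
qed

text \<open>Linearise the weight, single out a two-cycle of \<open>a\<close> and \<open>b\<close>,
  delete it and apply the induction hypothesis to \<open>A - {a, b}\<close>; the at most |A| (|A| -
  1) ordered pairs complete (|A| - 2)! to |A|!. The assumption
  \<open>(z - 1) * z \<le> 1 / 2\<close> bounds the inductive factor by 2, which is what closes the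
  recursion with an unchanged constant.\<close>

lemma sum_two_cycle_weight_le:
  fixes z :: real
  assumes fin: "finite A" and z: "1 \<le> z" "(z - 1) * z \<le> 1 / 2"
  shows "(\<Sum>\<sigma> | \<sigma> permutes A. z ^ card (two_cycle_points \<sigma> A)) \<le> (1 + 2 * ((z - 1) * z)) * fact (card A)"
  using fin
proof (induction "card A" arbitrary: A rule: less_induct)
  case less
  note fin = less.prems
  let ?v = "\<lambda>\<sigma>. z ^ (card (two_cycle_points \<sigma> A) - 1)"
  define x where "x = (z - 1) * z"
  have x: "0 \<le> x" "x \<le> 1 / 2" using z by (auto simp: x_def)
  let ?S = "{\<sigma>. \<sigma> permutes A}"
  have finS: "finite ?S" using fin by (rule finite_permutations)
  define W where "W = (\<Sum>\<sigma>\<in>?S. \<Sum>a\<in>two_cycle_points \<sigma> A. ?v \<sigma>)"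
  have "(\<Sum>\<sigma>\<in>?S. z ^ card (two_cycle_points \<sigma> A)) \<le>
     (\<Sum>\<sigma>\<in>?S. 1 + real (card (two_cycle_points \<sigma> A)) * ((z - 1) * ?v \<sigma>))"
    using z by (intro sum_mono power_minus_1_le)
  also have "\<dots> = fact (card A) + (z - 1) * W"
    using card_permutations[OF refl fin] by (simp add: W_def sum.distrib sum_distrib_left mult_ac)
  finally have le: "(\<Sum>\<sigma>\<in>?S. z ^ card (two_cycle_points \<sigma> A)) \<le> fact (card A) + (z - 1) * W" .
  \<comment> \<open>Listing each two-cycle point \<open>a\<close> with its partner \<open>b\<close>
    allows the sum over \<sigma> to go innermost.\<close>
  have "W =
     (\<Sum>\<sigma>\<in>?S. \<Sum>a\<in>A. \<Sum>b\<in>A - {a}. if \<sigma> a = b \<and> \<sigma> b = a then ?v \<sigma> else 0)"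
    unfolding W_def
  proof (rule sum.cong[OF refl])
    fix \<sigma> assume "\<sigma> \<in> ?S"
    then have \<sigma>: "\<sigma> permutes A" by simp
    let ?w = "?v \<sigma>"
    have "(\<Sum>a\<in>A. \<Sum>b\<in>A - {a}. if \<sigma> a = b \<and> \<sigma> b = a then ?w else 0) =
       (\<Sum>a\<in>A. if \<sigma> a \<noteq> a \<and> \<sigma> (\<sigma> a) = a then ?w else 0)"
    proof (rule sum.cong[OF refl])
      fix a assume a: "a \<in> A"
      have "(\<Sum>b\<in>A - {a}. if \<sigma> a = b \<and> \<sigma> b = a then ?w else 0) =
         (\<Sum>b\<in>A - {a}. if \<sigma> a = b then (if \<sigma> (\<sigma> a) = a then ?w else 0) else 0)"
        by (intro sum.cong) auto
      also have "\<dots> = (if \<sigma> a \<in> A - {a} then (if \<sigma> (\<sigma> a) = a then ?w else 0) else 0)"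
        using fin by (intro sum.delta') auto
      finally show "(\<Sum>b\<in>A - {a}. if \<sigma> a = b \<and> \<sigma> b = a then ?w else 0) =
        (if \<sigma> a \<noteq> a \<and> \<sigma> (\<sigma> a) = a then ?w else 0)"
        using a permutes_in_image[OF \<sigma>] by auto
    qed
    also have "\<dots> = (\<Sum>a\<in>two_cycle_points \<sigma> A. ?w)"
      using fin unfolding two_cycle_points_def by (subst sum.inter_filter[symmetric]) auto
    finally show "(\<Sum>a\<in>two_cycle_points \<sigma> A. ?w) =
      (\<Sum>a\<in>A. \<Sum>b\<in>A - {a}. if \<sigma> a = b \<and> \<sigma> b = a then ?w else 0)" ..
  qed
  also have "\<dots> = (\<Sum>a\<in>A. \<Sum>b\<in>A - {a}. \<Sum>\<sigma>\<in>?S. if \<sigma> a = b \<and> \<sigma> b = a then ?v \<sigma> else 0)"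
    by (subst sum.swap, intro sum.cong refl, subst sum.swap, rule refl)
  also have "\<dots> \<le> (\<Sum>a\<in>A. \<Sum>b\<in>A - {a}. z * (2 * fact (card A - 2)))"
  proof (intro sum_mono)
    fix a b assume a: "a \<in> A" and b: "b \<in> A - {a}"
    have "(\<Sum>\<sigma>\<in>?S. if \<sigma> a = b \<and> \<sigma> b = a then ?v \<sigma> else 0) =
      (\<Sum>\<sigma> | \<sigma> permutes A \<and> \<sigma> a = b \<and> \<sigma> b = a. ?v \<sigma>)"
      using finS by (subst sum.inter_filter[symmetric]) (auto intro!: sum.cong)
    also have "\<dots> = z * (\<Sum>\<tau> | \<tau> permutes (A - {a, b}). z ^ card (two_cycle_points \<tau> (A - {a, b})))"
      using fin a b by (subst sum_permutations_swapping) (auto simp: sum_distrib_left)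
    also have "\<dots> \<le> z * ((1 + 2 * x) * fact (card (A - {a, b})))"
    proof (intro mult_left_mono)
      have "card (A - {a, b}) < card A" using fin a by (intro psubset_card_mono) auto
      then show "(\<Sum>\<tau> | \<tau> permutes (A - {a, b}). z ^ card (two_cycle_points \<tau> (A - {a, b})))
         \<le> (1 + 2 * x) * fact (card (A - {a, b}))"
        unfolding x_def using fin by (intro less.hyps) auto
    qed (use z in simp)
    also have "card (A - {a, b}) = card A - 2"
    proof -
      have "card {a, b} = 2" using b by (auto simp: card_insert_if)
      then show ?thesis using fin a b by (subst card_Diff_subset) auto
    qed
    also have "z * ((1 + 2 * x) * fact (card A - 2)) \<le> z * (2 * fact (card A - 2))"
      using x z by (intro mult_left_mono mult_right_mono) auto
    finally show "(\<Sum>\<sigma>\<in>?S. if \<sigma> a = b \<and> \<sigma> b = a then ?v \<sigma> else 0)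
      \<le> z * (2 * fact (card A - 2))" .
  qed
  also have "\<dots> = z * 2 * (real (card A) * real (card A - 1) * fact (card A - 2))"
    using fin by (simp add: card_Diff_singleton)
  also have "real (card A) * real (card A - 1) * fact (card A - 2) \<le> fact (card A)"
  proof (cases "card A \<ge> 2")
    case True
    then obtain m where "card A = Suc (Suc m)" by (metis add_2_eq_Suc le_Suc_ex)
    then show ?thesis by simp
  next
    case False
    then have "card A = 0 \<or> card A = 1" by linarith
    then show ?thesis by auto
  qed
  finally have "W \<le> z * 2 * fact (card A)" using z by (simp add: mult_left_mono)
  then have "(z - 1) * W \<le> (z - 1) * (z * 2 * fact (card A))" using z by (intro mult_left_mono) auto
  with le show ?case by (simp add: algebra_simps)
qed

text \<open>Group by the exact fixed set \<open>F\<close>, then forget that the rest must have no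
  fixed point and sum over all permutations of \<open>A - F\<close>. The weight 1 / k! arises as
  binomial coefficient times (n - k)!, divided by n!, with n = |A|.\<close>

lemma sum_permutations_by_fixed_points_le:
  fixes h :: "nat \<Rightarrow> real" and z :: real
  assumes fin: "finite A" and z: "1 \<le> z" "(z - 1) * z \<le> 1 / 2" and h: "\<And>k. 0 \<le> h k"
  shows "(\<Sum>\<sigma> | \<sigma> permutes A. h (card {a \<in> A. \<sigma> a = a}) * z ^ card (two_cycle_points \<sigma> A))
    \<le> 2 * fact (card A) * (\<Sum>k\<le>card A. h k / fact k)"
proof -
  let ?S = "{\<sigma>. \<sigma> permutes A}" and ?F = "\<lambda>\<sigma>. {a \<in> A. \<sigma> a = a}"
  have finS: "finite ?S" using fin by (rule finite_permutations)
  have "(\<Sum>\<sigma>\<in>?S. h (card (?F \<sigma>)) * z ^ card (two_cycle_points \<sigma> A)) =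
     (\<Sum>F\<in>Pow A. \<Sum>\<sigma>\<in>{\<sigma> \<in> ?S. ?F \<sigma> = F}. h (card (?F \<sigma>)) * z ^ card (two_cycle_points \<sigma> A))"
    using finS fin by (intro sum.group[symmetric]) auto
  also have "\<dots> \<le> (\<Sum>F\<in>Pow A. h (card F) * (2 * fact (card A - card F)))"
  proof (rule sum_mono)
    fix F assume "F \<in> Pow A"
    then have F: "F \<subseteq> A" by simp
    have "(\<Sum>\<sigma>\<in>{\<sigma> \<in> ?S. ?F \<sigma> = F}. h (card (?F \<sigma>)) * z ^ card (two_cycle_points \<sigma> A)) =
       (\<Sum>\<sigma>\<in>{\<sigma> \<in> ?S. ?F \<sigma> = F}. h (card F) * z ^ card (two_cycle_points \<sigma> (A - F)))"
    proof (rule sum.cong[OF refl])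
      fix \<sigma> assume "\<sigma> \<in> {\<sigma> \<in> ?S. ?F \<sigma> = F}"
      then have "?F \<sigma> = F" by simp
      moreover from this have "two_cycle_points \<sigma> A = two_cycle_points \<sigma> (A - F)"
        by (auto simp: two_cycle_points_def)
      ultimately show "h (card (?F \<sigma>)) * z ^ card (two_cycle_points \<sigma> A) = h (card F) * z ^ card (two_cycle_points \<sigma> (A - F))"
        by simp
    qed
    also have "\<dots> \<le> (\<Sum>\<sigma> | \<sigma> permutes (A - F). h (card F) * z ^ card (two_cycle_points \<sigma> (A - F)))"
    proof (rule sum_mono2)
      show "finite {\<sigma>. \<sigma> permutes (A - F)}" using fin by (intro finite_permutations) auto
      show "{\<sigma> \<in> ?S. ?F \<sigma> = F} \<subseteq> {\<sigma>. \<sigma> permutes (A - F)}"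
        by (auto intro!: permutes_superset[of _ A])
    qed (use h z in auto)
    also have "\<dots> \<le> h (card F) * ((1 + 2 * ((z - 1) * z)) * fact (card (A - F)))"
      unfolding sum_distrib_left[symmetric] using fin z h by (intro mult_left_mono sum_two_cycle_weight_le) auto
    also have "\<dots> \<le> h (card F) * (2 * fact (card (A - F)))"
      using z h by (intro mult_left_mono mult_right_mono) auto
    also have "card (A - F) = card A - card F" using fin F by (simp add: card_Diff_subset finite_subset)
    finally show "(\<Sum>\<sigma>\<in>{\<sigma> \<in> ?S. ?F \<sigma> = F}. h (card (?F \<sigma>)) * z ^ card (two_cycle_points \<sigma> A))
       \<le> h (card F) * (2 * fact (card A - card F))" .
  qed
  also have "\<dots> = (\<Sum>k\<le>card A. \<Sum>F\<in>{F \<in> Pow A. card F = k}. h (card F) * (2 * fact (card A - card F)))"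
    using fin by (intro sum.group[symmetric]) (auto intro: card_mono)
  also have "\<dots> = (\<Sum>k\<le>card A. 2 * fact (card A) * (h k / fact k))"
  proof (rule sum.cong[OF refl])
    fix k assume k: "k \<in> {..card A}"
    have "(\<Sum>F\<in>{F \<in> Pow A. card F = k}. h (card F) * (2 * fact (card A - card F))) =
       real (card {F. F \<subseteq> A \<and> card F = k}) * (h k * (2 * fact (card A - k)))"
      by simp
    also have "\<dots> = real (card A choose k) * (h k * (2 * fact (card A - k)))"
      using fin by (simp add: n_subsets)
    also have "real (card A choose k) = fact (card A) / (fact k * fact (card A - k))"
      using k by (intro binomial_fact) auto
    finally show "(\<Sum>F\<in>{F \<in> Pow A. card F = k}. h (card F) * (2 * fact (card A - card F))) =
      2 * fact (card A) * (h k / fact k)" by simp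
  qed
  finally show ?thesis by (simp add: sum_distrib_left)
qed

section \<open>Above the threshold\<close>

lemma card_ordered_pairs:
  fixes F :: "'a :: linorder set"
  assumes fin: "finite F"
  shows "2 * real (card {(i, j). i \<in> F \<and> j \<in> F \<and> i < j}) = real (card F) * (real (card F) - 1)"
proof -
  define U where "U = {(i, j). i \<in> F \<and> j \<in> F \<and> i < j}"
  have "U \<subseteq> F \<times> F" by (auto simp: U_def)
  then have finU: "finite U" using fin by (meson finite_SigmaI finite_subset)
  have eq: "F \<times> F = (U \<union> prod.swap ` U) \<union> (\<lambda>i. (i, i)) ` F"
    by (auto simp: U_def image_iff)
  have "card (F \<times> F) = card (U \<union> prod.swap ` U) + card ((\<lambda>i. (i, i)) ` F)"
    unfolding eq using finU fin by (intro card_Un_disjoint) (auto simp: U_def)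
  also have "card (U \<union> prod.swap ` U) = card U + card (prod.swap ` U)"
    using finU by (intro card_Un_disjoint) (auto simp: U_def)
  also have "card (prod.swap ` U) = card U" by (intro card_image) auto
  also have "card ((\<lambda>i. (i, i)) ` F) = card F" by (intro card_image) (auto simp: inj_on_def)
  finally have "card F * card F = card U + card U + card F" by (simp add: card_cartesian_product)
  then have "real (card F) * real (card F) = 2 * real (card U) + real (card F)"
    by (simp flip: of_nat_mult of_nat_add)
  then show ?thesis unfolding U_def by (simp add: algebra_simps)
qed

lemma card_edges: "2 * real (card (edges n)) = real n * (real n - 1)"
proof -
  have "edges n = {(i, j). i \<in> {1..n} \<and> j \<in> {1..n} \<and> i < j}" by (auto simp: edges_def)
  then show ?thesis using card_ordered_pairs[of "{1..n}"] by simp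
qed

lemma measure_planted_law:
  assumes X: "X \<in> sets (obs_space n)"
  shows "measure (planted_law n \<rho>) X =
    (\<Sum>\<pi> | \<pi> permutes {1..n}. measure (planted_law_given n \<rho> \<pi>) X) / fact n"
proof -
  interpret P: prob_space "planted_law n \<rho>" by (rule prob_space_planted_law)
  have eq: "emeasure (planted_law_given n \<rho> \<pi>) X = ennreal (measure (planted_law_given n \<rho> \<pi>) X)" for \<pi>
  proof -
    interpret R: prob_space "planted_law_given n \<rho> \<pi>" by (rule prob_space_planted_law_given)
    show ?thesis by (rule R.emeasure_eq_measure)
  qed
  have f: "(fact n :: ennreal) = ennreal (fact n)"
    by (metis ennreal_of_nat_eq_real_of_nat of_nat_fact)
  have "ennreal (measure (planted_law n \<rho>) X) =
     ennreal (\<Sum>\<pi> | \<pi> permutes {1..n}. measure (planted_law_given n \<rho> \<pi>) X) / ennreal (fact n)"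
    using emeasure_planted_law[OF X, of \<rho>] unfolding P.emeasure_eq_measure eq f by (simp add: sum_ennreal)
  also have "\<dots> = ennreal ((\<Sum>\<pi> | \<pi> permutes {1..n}. measure (planted_law_given n \<rho> \<pi>) X) / fact n)"
    by (intro divide_ennreal sum_nonneg) auto
  finally show ?thesis by (subst (asm) ennreal_inj) (auto intro!: divide_nonneg_nonneg sum_nonneg)
qed

lemma measure_planted_law_ge:
  assumes X: "X \<in> sets (obs_space n)" and c: "\<And>\<pi>. \<pi> permutes {1..n} \<Longrightarrow> c \<le> measure (planted_law_given n \<rho> \<pi>) X"
  shows "c \<le> measure (planted_law n \<rho>) X"
proof -
  have "(\<Sum>\<pi> | \<pi> permutes {1..n}. c) \<le> (\<Sum>\<pi> | \<pi> permutes {1..n}. measure (planted_law_given n \<rho> \<pi>) X)"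
    using c by (intro sum_mono) auto
  moreover have "card {\<pi>. \<pi> permutes {1..n}} = fact n" by (rule card_permutations) auto
  ultimately have "c * fact n \<le> (\<Sum>\<pi> | \<pi> permutes {1..n}. measure (planted_law_given n \<rho> \<pi>) X)"
    by (simp only: sum_constant of_nat_fact mult.commute[of c])
  then show ?thesis unfolding measure_planted_law[OF X] by (subst pos_le_divide_eq) auto
qed

text \<open>The induction step amounts to (n + 1) ln(1 + 1/n) \<ge> 1. The term - n is the entire
  margin of the union bound at the threshold, so the cruder n ln n would not do.\<close>

lemma ln_fact_le:
  assumes "1 \<le> n"
  shows "ln (fact n) \<le> (real n + 1) * ln (real n) + 1 - real n"
  using assms
proof (induction n rule: dec_induct)
  case (step n)
  have n: "real n > 0" using step by simp
  have "(real n + 1) * (1 - 1 / (1 + 1 / real n)) = 1" using n by (simp add: field_simps)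
  moreover have "ln (1 + 1 / real n) \<ge> 1 - 1 / (1 + 1 / real n)"
  proof -
    have pos: "1 + 1 / real n > 0" using n by (intro add_pos_pos) auto
    then have "ln (1 / (1 + 1 / real n)) = - ln (1 + 1 / real n)" by (simp add: ln_div)
    then show ?thesis using ln_le_minus_one[of "1 / (1 + 1 / real n)"] pos by simp
  qed
  ultimately have "(real n + 1) * ln (1 + 1 / real n) \<ge> 1"
    using mult_left_mono[of "1 - 1 / (1 + 1 / real n)" "ln (1 + 1 / real n)" "real n + 1"] by simp
  moreover have "1 + 1 / real n = (real n + 1) / real n" using n by (simp add: field_simps)
  ultimately have 1: "(real n + 1) * (ln (real n + 1) - ln (real n)) \<ge> 1" using n by (simp add: ln_div)
  have "ln (fact (Suc n)) = ln (real n + 1) + ln (fact n)" by (simp add: ln_mult add.commute)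
  also have "\<dots> \<le> ln (real n + 1) + ((real n + 1) * ln (real n) + 1 - real n)" using step by simp
  also have "\<dots> \<le> (real (Suc n) + 1) * ln (real (Suc n)) + 1 - real (Suc n)"
    using 1 by (simp add: algebra_simps)
  finally show ?case .
qed simp

text \<open>The test is built from \<open>t\<close>, the correlation at the threshold itself, so the
  bound under the null law is free of \<rho>. In the second exponential the n ln n terms cancel and
  - n must beat the rest.\<close>

lemma tv_dist_ge_above_threshold:
  fixes n :: nat and \<rho> :: real
  defines "t \<equiv> sqrt (4 * ln (real n) / (real n - 1))"
  assumes \<rho>: "0 \<le> \<rho>" "\<rho> \<le> 1" and thr: "4 * ln (real n) / (real n - 1) \<le> \<rho>\<^sup>2"
    and n: "6 \<le> n" and t: "t\<^sup>2 \<le> 1 / 2"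
  shows "1 - exp (5 - real n powr (1 / 4))
     - exp ((real n + 1) * ln (real n) + 1 - real n - real n * ln (real n)
         + 8 * real n * (ln (real n))\<^sup>2 / (real n - 1) + t * real n powr (5 / 4))
    \<le> tv_dist (planted_law n \<rho>) (null_law n)"
proof -
  let ?R = "planted_law_given n \<rho>"
  let ?q = "exp ((real n + 1) * ln (real n) + 1 - real n - real n * ln (real n)
         + 8 * real n * (ln (real n))\<^sup>2 / (real n - 1) + t * real n powr (5 / 4))"
  let ?P = "planted_law n \<rho>" and ?Q = "null_law n" and ?S = "{\<pi>. \<pi> permutes {1..n}}"
  interpret P: prob_space ?P by (rule prob_space_planted_law)
  interpret Q: prob_space ?Q by (rule prob_space_null_law)
  define N where "N = real (card (edges n))"
  have N: "2 * N = real n * (real n - 1)" unfolding N_def by (rule card_edges)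
  have n1: "real n - 1 > 0" "real n > 0" "ln (real n) \<ge> 0" using n by auto
  have t0: "0 \<le> t" and t2: "t\<^sup>2 = 4 * ln (real n) / (real n - 1)" using n1 by (auto simp: t_def)
  have t\<rho>: "t \<le> \<rho>" using thr \<rho> unfolding t_def by (metis real_sqrt_le_mono real_sqrt_abs abs_of_nonneg)
  have finS: "finite ?S" by (simp add: finite_permutations)
  \<comment> \<open>The shift n^(5/4) exceeds the fluctuations of the sum, which are of order n,
    while t n^(5/4) = o(n) stays within the margin - n.\<close>
  define \<tau> where "\<tau> = t * N - real n powr (5 / 4)"
  let ?b = "exp (N * (t\<^sup>2 / 2 + (t\<^sup>2)\<^sup>2) - t * \<tau>)"
  define A where "A \<pi> = {x \<in> space (obs_space n). \<tau> \<le> aligned_sum \<pi> (edges n) x}" for \<pi>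
  have A: "A \<pi> \<in> sets (obs_space n)" if "\<pi> \<in> ?S" for \<pi>
    using aligned_sum_measurable[of \<pi> n "edges n"] that unfolding A_def by auto
  define X where "X = (\<Union>\<pi>\<in>?S. A \<pi>)"
  have X: "X \<in> sets (obs_space n)" unfolding X_def using A finS by (intro sets.finite_UN) auto
  have tN: "t\<^sup>2 * N = 2 * real n * ln (real n)"
  proof -
    have "t\<^sup>2 * (2 * N) = 4 * real n * ln (real n)" unfolding N t2 using n1 by (simp add: field_simps)
    then show ?thesis by (simp add: mult_ac)
  qed
  \<comment> \<open>The tail bound at correlation 0 with \<open>s = t\<close>, to leading order the
    best choice for reaching the level t N.\<close>
  have Q_le: "measure ?Q (A \<pi>) \<le> ?b" if \<pi>: "\<pi> \<in> ?S" for \<pi>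
  proof -
    have "emeasure ?Q (A \<pi>) \<le> emeasure ?Q {x \<in> space (obs_space n). t * \<tau> \<le> t * aligned_sum \<pi> (edges n) x}"
      using aligned_sum_measurable[of \<pi> n "edges n"] \<pi> t0
      by (intro emeasure_mono) (auto simp: A_def intro: mult_left_mono)
    also have "\<dots> \<le> ennreal (?b)"
      using aligned_sum_tail[of \<pi> n 0 "edges n" "t\<^sup>2" t "t * \<tau>"] \<pi> t by (simp add: planted_law_given_0 N_def)
    finally show ?thesis unfolding Q.emeasure_eq_measure by simp
  qed
  have "measure ?Q X \<le> (\<Sum>\<pi>\<in>?S. measure ?Q (A \<pi>))"
    unfolding X_def using A finS by (intro Q.finite_measure_subadditive_finite) auto
  also have "\<dots> \<le> (\<Sum>\<pi>\<in>?S. ?b)"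
    using Q_le by (intro sum_mono) auto
  also have "\<dots> = fact n * ?b"
    using card_permutations[of "{1..n}" n] by simp
  also have "\<dots> = exp (ln (fact n) + (N * (t\<^sup>2 / 2 + (t\<^sup>2)\<^sup>2) - t * \<tau>))"
    by (simp only: exp_add) simp
  also have "\<dots> \<le> ?q"
  proof -
    have "N * (t\<^sup>2 / 2 + (t\<^sup>2)\<^sup>2) - t * \<tau> = - (t\<^sup>2 * N) / 2 + (t\<^sup>2 * N) * t\<^sup>2 + t * real n powr (5 / 4)"
      unfolding \<tau>_def by (simp add: algebra_simps power2_eq_square)
    also have "\<dots> = - real n * ln (real n) + 8 * real n * (ln (real n))\<^sup>2 / (real n - 1) + t * real n powr (5 / 4)"
      unfolding tN unfolding t2 by (simp add: power2_eq_square)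
    finally show ?thesis using ln_fact_le[of n] n by simp
  qed
  finally have QX: "measure ?Q X \<le> ?q" .
  have PX: "1 - exp (5 - real n powr (1 / 4)) \<le> measure ?P X"
  proof (rule measure_planted_law_ge[OF X])
    fix \<pi> assume \<pi>: "\<pi> permutes {1..n}"
    interpret R: prob_space "?R \<pi>" by (rule prob_space_planted_law_given)
    have sR: "sets (?R \<pi>) = sets (obs_space n)" "space (?R \<pi>) = space (obs_space n)"
      by (simp_all add: planted_law_given_def)
    \<comment> \<open>With |s| = 1 / n the shift yields n^(1/4) in the exponent, while the
      second-order terms, of order N / n^2, total at most 9/2 + 1/4 < 5.\<close>
    define s where "s = - 1 / real n"
    define y where "y = 2 * s * \<rho> + s\<^sup>2 * (1 - \<rho>\<^sup>2)"
    have r2: "0 \<le> \<rho>\<^sup>2" "\<rho>\<^sup>2 \<le> 1" using \<rho> by (auto simp: power_le_one)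
    have s: "\<bar>s\<bar> = 1 / real n" "s\<^sup>2 = 1 / (real n)\<^sup>2" "s\<^sup>2 \<le> 1 / real n"
      using n1 n by (auto simp: s_def power_divide power2_eq_square field_simps)
    have yb: "\<bar>y\<bar> \<le> 3 / real n"
    proof -
      have "\<bar>y\<bar> \<le> \<bar>2 * s * \<rho>\<bar> + \<bar>s\<^sup>2 * (1 - \<rho>\<^sup>2)\<bar>" unfolding y_def by (rule abs_triangle_ineq)
      also have "\<bar>2 * s * \<rho>\<bar> = 2 * (1 / real n) * \<rho>" using \<rho> s by (simp add: abs_mult)
      also have "\<dots> \<le> 2 * (1 / real n) * 1" using \<rho> n1 by (intro mult_left_mono) auto
      also have "\<bar>s\<^sup>2 * (1 - \<rho>\<^sup>2)\<bar> \<le> s\<^sup>2 * 1" unfolding abs_mult using r2 by (intro mult_mono) auto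
      finally show ?thesis using s by simp
    qed
    have "3 / real n \<le> 1 / 2" using n by (simp add: field_simps)
    with yb have y12: "\<bar>y\<bar> \<le> 1 / 2" by linarith
    have "measure (?R \<pi>) (space (?R \<pi>) - X) \<le> exp (5 - real n powr (1 / 4))"
    proof -
      have "emeasure (?R \<pi>) (space (?R \<pi>) - X) \<le>
        emeasure (?R \<pi>) {x \<in> space (obs_space n). s * \<tau> \<le> s * aligned_sum \<pi> (edges n) x}"
      proof (rule emeasure_mono)
        show "space (?R \<pi>) - X \<subseteq> {x \<in> space (obs_space n). s * \<tau> \<le> s * aligned_sum \<pi> (edges n) x}"
        proof
          fix x assume x: "x \<in> space (?R \<pi>) - X"
          then have "aligned_sum \<pi> (edges n) x \<le> \<tau>" using \<pi> by (auto simp: X_def A_def sR)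
          then have "s * \<tau> \<le> s * aligned_sum \<pi> (edges n) x" by (rule mult_left_mono_neg) (simp add: s_def)
          then show "x \<in> {x \<in> space (obs_space n). s * \<tau> \<le> s * aligned_sum \<pi> (edges n) x}" using x sR by simp
        qed
        show "{x \<in> space (obs_space n). s * \<tau> \<le> s * aligned_sum \<pi> (edges n) x} \<in> sets (?R \<pi>)"
          unfolding sR using aligned_sum_measurable[OF \<pi>, of "edges n"] by auto
      qed
      also have "\<dots> \<le> ennreal (exp (N * (y / 2 + y\<^sup>2) - s * \<tau>))"
        unfolding N_def by (rule aligned_sum_tail[OF \<pi> \<rho> subset_refl y_def y12])
      also have "N * (y / 2 + y\<^sup>2) - s * \<tau> \<le> 5 - real n powr (1 / 4)"
      proof -
        have N0: "N \<ge> 0" by (simp add: N_def)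
        have Nn: "2 * N \<le> (real n)\<^sup>2" unfolding N using n1 by (simp add: power2_eq_square)
        have a: "N * y\<^sup>2 \<le> 9 / 2"
        proof -
          have "y\<^sup>2 \<le> (3 / real n)\<^sup>2" using yb by (metis abs_ge_zero power2_abs power_mono)
          then have "2 * N * y\<^sup>2 \<le> (real n)\<^sup>2 * (3 / real n)\<^sup>2" using Nn N0 by (intro mult_mono) auto
          also have "\<dots> = 9" using n1 by (simp add: power_divide)
          finally show ?thesis by simp
        qed
        have b: "N * (s\<^sup>2 * (1 - \<rho>\<^sup>2)) \<le> 1 / 2"
        proof -
          have "2 * N * (s\<^sup>2 * (1 - \<rho>\<^sup>2)) \<le> (real n)\<^sup>2 * (s\<^sup>2 * 1)"
            using Nn N0 r2 by (intro mult_mono) auto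
          also have "\<dots> = 1" using n1 s by simp
          finally show ?thesis by simp
        qed
        \<comment> \<open>As \<open>s\<close> is negative, a correlation above \<open>t\<close> only
          helps.\<close>
        have c: "N * (s * \<rho>) \<le> N * (s * t)"
          using t\<rho> N0 n1 by (intro mult_left_mono mult_left_mono_neg) (auto simp: s_def)
        have d: "s * real n powr (5 / 4) = - (real n powr (1 / 4))"
        proof -
          have "real n powr (1 / 4 + 1) = real n powr (1 / 4) * real n powr 1" by (rule powr_add)
          then have "real n powr (5 / 4) = real n powr (1 / 4) * real n" using n1 by simp
          then show ?thesis using n1 by (simp add: s_def)
        qed
        have "N * (y / 2) = N * (s * \<rho>) + N * (s\<^sup>2 * (1 - \<rho>\<^sup>2)) / 2"
          unfolding y_def by (simp add: add_divide_distrib distrib_left)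
        then have "N * (y / 2 + y\<^sup>2) - s * \<tau> = N * (s * \<rho>) + N * (s\<^sup>2 * (1 - \<rho>\<^sup>2)) / 2 + N * y\<^sup>2 - N * (s * t) + s * real n powr (5 / 4)"
          unfolding \<tau>_def distrib_left right_diff_distrib by simp
        then show ?thesis using a b c d by linarith
      qed
      finally show ?thesis unfolding R.emeasure_eq_measure by (simp add: ennreal_le_iff)
    qed
    then show "1 - exp (5 - real n powr (1 / 4)) \<le> measure (?R \<pi>) X"
      using R.prob_compl[of X] X sR by simp
  qed
  have "measure ?P X - measure ?Q X \<le> tv_dist ?P ?Q"
    using X by (intro tv_dist_ge prob_space_planted_law prob_space_null_law) auto
  then show ?thesis using PX QX by linarith
qed

lemma tv_dist_above_threshold:
  fixes \<rho> :: "nat \<Rightarrow> real"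
  assumes \<rho>: "\<And>n. 0 \<le> \<rho> n \<and> \<rho> n \<le> 1"
    and thr: "\<forall>\<^sub>F n in sequentially. (\<rho> n)\<^sup>2 \<ge> 4 * ln (real n) / (real n - 1)"
  shows "(\<lambda>n. tv_dist (planted_law n (\<rho> n)) (null_law n)) \<longlonglongrightarrow> 1"
proof (rule tendsto_sandwich)
  let ?t = "\<lambda>n. sqrt (4 * ln (real n) / (real n - 1))"
  let ?lower = "\<lambda>n::nat. 1 - exp (5 - real n powr (1 / 4))
     - exp ((real n + 1) * ln (real n) + 1 - real n - real n * ln (real n)
         + 8 * real n * (ln (real n))\<^sup>2 / (real n - 1) + ?t n * real n powr (5 / 4))"
  have "\<forall>\<^sub>F n in sequentially. (?t n)\<^sup>2 \<le> 1 / 2" by real_asymp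
  then show "\<forall>\<^sub>F n in sequentially. ?lower n \<le> tv_dist (planted_law n (\<rho> n)) (null_law n)"
    using thr eventually_ge_at_top[of 6]
  proof eventually_elim
    case (elim n)
    then show ?case using \<rho>[of n] by (intro tv_dist_ge_above_threshold) auto
  qed
  show "?lower \<longlonglongrightarrow> 1" by real_asymp
  show "\<forall>\<^sub>F n in sequentially. tv_dist (planted_law n (\<rho> n)) (null_law n) \<le> 1"
    by (intro always_eventually allI tv_dist_le_1 prob_space_planted_law prob_space_null_law) simp
qed simp

section \<open>Below the threshold\<close>

definition inner_edges :: "nat \<Rightarrow> nat set \<Rightarrow> (nat \<times> nat) set" where
  "inner_edges n F = {(i, j). (i, j) \<in> edges n \<and> i \<in> F \<and> j \<in> F}"

lemma inner_edges_subset: "inner_edges n F \<subseteq> edges n"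
  by (auto simp: inner_edges_def)

lemma card_inner_edges:
  assumes "F \<subseteq> {1..n}"
  shows "2 * real (card (inner_edges n F)) = real (card F) * (real (card F) - 1)"
proof -
  have "inner_edges n F = {(i, j). i \<in> F \<and> j \<in> F \<and> i < j}"
    using assms by (auto simp: inner_edges_def edges_def)
  moreover have "finite F" using assms finite_subset by blast
  ultimately show ?thesis using card_ordered_pairs[of F] by simp
qed

lemma card_inner_edges_le:
  assumes "F \<subseteq> {1..n}"
  shows "2 * real (card (inner_edges n F)) \<le> (real (card F))\<^sup>2"
  unfolding card_inner_edges[OF assms] by (simp add: power2_eq_square algebra_simps)

lemma card_edges_between_le:
  assumes "finite A" "S \<subseteq> {(i, j). i \<in> A \<and> j = f i}"
  shows "card S \<le> card A"
proof -
  have "S \<subseteq> (\<lambda>i. (i, f i)) ` A" using assms(2) by auto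
  then show ?thesis using assms(1) by (meson surj_card_le)
qed

lemma edge_act_fixed:
  assumes "e \<in> edges n" "edge_act n \<sigma> e = e"
  shows "(\<sigma> (fst e) = fst e \<and> \<sigma> (snd e) = snd e) \<or> (\<sigma> (fst e) = snd e \<and> \<sigma> (snd e) = fst e)"
  using assms by (cases e) (auto simp: edge_act_def edges_def min_def max_def split: if_splits)

text \<open>An edge is fixed when its ends are both fixed (about k^2 / 2 edges) or swapped (at most
  m edges). Orbits of length at most two are counted likewise through the square of \<sigma>, and
  \<open>k + m \<le> n\<close> makes that count linear in \<open>k + m + 1\<close>; all other edges
  are charged r^3. Only the k^2 term is not linear, and the flag \<open>b\<close> tells whether it
  is paid here or its edges are left to the truncation.\<close>

lemma sum_cycle_cost_le:
  fixes r :: real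
  assumes \<sigma>: "\<sigma> permutes {1..n}" and r: "0 \<le> r"
    and G: "G = (if b then {} else inner_edges n {i \<in> {1..n}. \<sigma> i = i})"
  defines "k \<equiv> card {i \<in> {1..n}. \<sigma> i = i}" and "m \<equiv> card (two_cycle_points \<sigma> {1..n})"
  shows "2 * (\<Sum>e\<in>edges n - G. cycle_cost (edge_act n \<sigma>) (\<lambda>_. r) r e)
    \<le> (if b then r * (real k)\<^sup>2 else 0)
      + (2 * r + 2 * r\<^sup>2 * real n + 2 * r^3 * (real n)\<^sup>2) * real (k + m + 1)"
proof -
  let ?E = "edges n" and ?a = "edge_act n \<sigma>" and ?Fix = "{i \<in> {1..n}. \<sigma> i = i}" and ?I = "two_cycle_points \<sigma> {1..n}"
  have finE: "finite ?E" by (rule finite_edges)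
  have finI: "finite ?I" by (simp add: two_cycle_points_def)
  have \<sigma>\<sigma>: "(\<sigma> \<circ> \<sigma>) permutes {1..n}" using \<sigma> by (intro permutes_compose)
  define B1 where "B1 = {e \<in> ?E - G. ?a e = e}"
  define B2 where "B2 = {e \<in> ?E. ?a (?a e) = e}"
  have "(\<Sum>e\<in>?E - G. cycle_cost ?a (\<lambda>_. r) r e) \<le>
      (\<Sum>e\<in>?E - G. (if ?a e = e then r else 0) + ((if ?a (?a e) = e then r\<^sup>2 else 0) + r^3))"
    using r by (intro sum_mono) (auto simp: cycle_cost_def power2_eq_square)
  also have "\<dots> = (\<Sum>e\<in>?E - G. if ?a e = e then r else 0) + (\<Sum>e\<in>?E - G. (if ?a (?a e) = e then r\<^sup>2 else 0) + r^3)"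
    by (rule sum.distrib)
  also have "(\<Sum>e\<in>?E - G. if ?a e = e then r else 0) = real (card B1) * r"
    using finE by (simp add: B1_def sum.inter_filter[symmetric])
  also have "(\<Sum>e\<in>?E - G. (if ?a (?a e) = e then r\<^sup>2 else 0) + r^3) \<le> (\<Sum>e\<in>?E. (if ?a (?a e) = e then r\<^sup>2 else 0) + r^3)"
    using finE r by (intro sum_mono2) auto
  also have "\<dots> = real (card B2) * r\<^sup>2 + real (card ?E) * r^3"
    using finE by (simp add: B2_def sum.distrib sum.inter_filter[symmetric])
  finally have total: "(\<Sum>e\<in>?E - G. cycle_cost ?a (\<lambda>_. r) r e) \<le>
      real (card B1) * r + (real (card B2) * r\<^sup>2 + real (card ?E) * r^3)" by simp
  define S1 where "S1 = {(i, j). (i, j) \<in> ?E \<and> \<sigma> i = j \<and> \<sigma> j = i}"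
  have "S1 \<subseteq> {(i, j). i \<in> ?I \<and> j = \<sigma> i}" by (auto simp: S1_def edges_def two_cycle_points_def)
  then have S1: "card S1 \<le> m" unfolding m_def by (rule card_edges_between_le[OF finI])
  have B1_sub: "B1 \<subseteq> (inner_edges n ?Fix - G) \<union> S1"
  proof
    fix e assume "e \<in> B1"
    then have e: "e \<in> ?E" "e \<notin> G" "?a e = e" by (auto simp: B1_def)
    from edge_act_fixed[OF e(1,3)] show "e \<in> (inner_edges n ?Fix - G) \<union> S1"
      using e(1,2) by (cases e) (auto simp: inner_edges_def S1_def edges_def)
  qed
  have fin1: "finite (inner_edges n ?Fix - G)" "finite S1"
    using finite_subset[OF inner_edges_subset finE] finE by (auto simp: S1_def intro: finite_subset[of _ ?E])
  have "card B1 \<le> card (inner_edges n ?Fix - G) + card S1"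
    using card_mono[OF _ B1_sub] fin1 card_Un_le le_trans by blast
  moreover have "2 * real (card (inner_edges n ?Fix - G)) \<le> (if b then (real k)\<^sup>2 else 0)"
  proof -
    have "2 * real (card (inner_edges n ?Fix)) \<le> (real k)\<^sup>2" unfolding k_def by (rule card_inner_edges_le) auto
    then show ?thesis using G by simp
  qed
  ultimately have B1: "2 * real (card B1) \<le> (if b then (real k)\<^sup>2 else 0) + 2 * real m" using S1 by linarith
  \<comment> \<open>Edges on orbits of length at most two are the fixed edges of
    \<open>\<sigma> \<circ> \<sigma>\<close>, so the description of fixed edges applies
    again.\<close>
  let ?Fix2 = "{i \<in> {1..n}. (\<sigma> \<circ> \<sigma>) i = i}"
  have "?Fix2 = ?Fix \<union> ?I" by (auto simp: two_cycle_points_def)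
  moreover have "?Fix \<inter> ?I = {}" by (auto simp: two_cycle_points_def)
  ultimately have km: "card ?Fix2 = k + m" unfolding k_def m_def using finI by (simp add: card_Un_disjoint)
  have kmn: "k + m \<le> n" 
  proof -
    have "card ?Fix2 \<le> card {1..n}" by (rule card_mono) auto
    then show ?thesis unfolding km by simp
  qed
  define S2 where "S2 = {(i, j). (i, j) \<in> ?E \<and> (\<sigma> \<circ> \<sigma>) i = j \<and> (\<sigma> \<circ> \<sigma>) j = i}"
  have "S2 \<subseteq> {(i, j). i \<in> {1..n} \<and> j = (\<sigma> \<circ> \<sigma>) i}" by (auto simp: S2_def edges_def)
  then have S2: "card S2 \<le> n" using card_edges_between_le[of "{1..n}" S2] by simp
  have B2_sub: "B2 \<subseteq> inner_edges n ?Fix2 \<union> S2"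
  proof
    fix e assume "e \<in> B2"
    then have e: "e \<in> ?E" "edge_act n (\<sigma> \<circ> \<sigma>) e = e" by (auto simp: B2_def edge_act_comp[OF \<sigma> \<sigma>])
    from edge_act_fixed[OF e] show "e \<in> inner_edges n ?Fix2 \<union> S2"
      using e(1) by (cases e) (auto simp: inner_edges_def S2_def edges_def)
  qed
  have fin2: "finite (inner_edges n ?Fix2)" "finite S2"
    using finite_subset[OF inner_edges_subset finE] finE by (auto simp: S2_def intro: finite_subset[of _ ?E])
  have "card B2 \<le> card (inner_edges n ?Fix2) + card S2"
    using card_mono[OF _ B2_sub] fin2 card_Un_le le_trans by blast
  moreover have "2 * real (card (inner_edges n ?Fix2)) \<le> real (k + m) * real n"
  proof -
    have "2 * real (card (inner_edges n ?Fix2)) \<le> (real (k + m))\<^sup>2"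
      unfolding km[symmetric] by (rule card_inner_edges_le) auto
    also have "\<dots> \<le> real (k + m) * real n"
      unfolding power2_eq_square using kmn by (intro mult_left_mono) (simp_all flip: of_nat_add)
    finally show ?thesis .
  qed
  ultimately have "real (card B2) \<le> real (k + m) * real n + real n" using S2 by linarith
  then have B2: "real (card B2) \<le> real n * real (k + m + 1)" by (simp add: algebra_simps)
  have "2 * real (card ?E) \<le> (real n)\<^sup>2" unfolding card_edges by (simp add: power2_eq_square algebra_simps)
  moreover have "real (card ?E) \<le> 2 * real (card ?E)" by simp
  ultimately have E: "real (card ?E) \<le> (real n)\<^sup>2" by linarith
  define K where "K = real (k + m + 1)"
  have K: "1 \<le> K" "real m \<le> K" by (auto simp: K_def)
  have 1: "(2 * real (card B1)) * r \<le> (if b then r * (real k)\<^sup>2 else 0) + 2 * (real m * r)"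
    using mult_right_mono[OF B1 r] by (cases b) (simp_all add: algebra_simps)
  have 2: "real m * r \<le> K * r" using K(2) r by (rule mult_right_mono)
  have 3: "real (card B2) * r\<^sup>2 \<le> real n * K * r\<^sup>2" using B2 unfolding K_def by (rule mult_right_mono) simp
  have "real (card ?E) * r^3 \<le> (real n)\<^sup>2 * r^3" using E by (rule mult_right_mono) (use r in simp)
  also have "\<dots> \<le> (real n)\<^sup>2 * r^3 * K" using K(1) r mult_left_mono[of 1 K "(real n)\<^sup>2 * r^3"] by simp
  finally have 4: "real (card ?E) * r^3 \<le> (real n)\<^sup>2 * r^3 * K" .
  have "(2 * r + 2 * r\<^sup>2 * real n + 2 * r^3 * (real n)\<^sup>2) * K =
      2 * (K * r) + 2 * (real n * K * r\<^sup>2) + 2 * ((real n)\<^sup>2 * r^3 * K)"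
    by (simp add: algebra_simps)
  then show ?thesis unfolding K_def[symmetric] using total 1 2 3 4 by linarith
qed

text \<open>The planted mean over M edges plus a slack. At \<open>s = 1 / sqrt n\<close> the slack
  puts 5 n into the Chernoff exponent, enough for 2^n vertex sets; in the second moment it is
  multiplied by about \<rho>, giving at most order n sqrt(ln n), which is o(n ln n).\<close>

definition truncation_level :: "nat \<Rightarrow> real \<Rightarrow> real \<Rightarrow> real" where
  "truncation_level n \<rho> M = \<rho> * M + 5 * (real n * sqrt (real n))"

text \<open>The truncation event: on every vertex subset the aligned sum stays close to its mean under
  the planted law. It has high planted probability, and it caps the likelihood on the large
  fixed sets that make the plain second moment explode.\<close>

definition typical_event :: "nat \<Rightarrow> real \<Rightarrow> (nat \<Rightarrow> nat) \<Rightarrow> (mat_fun \<times> mat_fun) set" where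
  "typical_event n \<rho> \<pi> = {x \<in> space (obs_space n). \<forall>F\<in>Pow {1..n}.
     aligned_sum \<pi> (inner_edges n F) x \<le> truncation_level n \<rho> (real (card (inner_edges n F)))}"

lemma typical_event_sets:
  assumes "\<pi> permutes {1..n}"
  shows "typical_event n \<rho> \<pi> \<in> sets (obs_space n)"
proof -
  have [measurable]: "aligned_sum \<pi> (inner_edges n F) \<in> borel_measurable (obs_space n)" for F
    by (rule aligned_sum_measurable[OF assms inner_edges_subset])
  show ?thesis unfolding typical_event_def
    by (intro sets.sets_Collect_finite_All) auto
qed

text \<open>Chernoff bound at \<open>s = 1 / sqrt n\<close> for each vertex set: of the 5 n from the
  slack, second-order terms take at most 2 n and the union over 2^n \<le> exp(n) sets takes another
  n.\<close>

lemma typical_event_probability: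
  assumes \<pi>: "\<pi> permutes {1..n}" and \<rho>: "0 \<le> \<rho>" "\<rho> \<le> 1 / 2" and n: "9 \<le> n"
  shows "1 - exp (- 2 * real n) \<le> measure (planted_law_given n \<rho> \<pi>) (typical_event n \<rho> \<pi>)"
proof -
  let ?R = "planted_law_given n \<rho> \<pi>" and ?T = "typical_event n \<rho> \<pi>"
  interpret R: prob_space ?R by (rule prob_space_planted_law_given)
  have sR: "sets ?R = sets (obs_space n)" "space ?R = space (obs_space n)"
    by (simp_all add: planted_law_given_def)
  define s where "s = 1 / sqrt (real n)"
  define y where "y = 2 * s * \<rho> + s\<^sup>2 * (1 - \<rho>\<^sup>2)"
  have sq: "3 \<le> sqrt (real n)" using n by (intro real_le_rsqrt) auto
  have s: "0 < s" "s \<le> 1 / 3" "s\<^sup>2 = 1 / real n" "s * (real n * sqrt (real n)) = real n"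
  proof -
    show "0 < s" using n by (simp add: s_def)
    show "s \<le> 1 / 3" unfolding s_def using sq n by (intro divide_left_mono) auto
    show "s\<^sup>2 = 1 / real n" by (simp add: s_def power_divide)
    have "s * sqrt (real n) = 1" using n by (simp add: s_def)
    then show "s * (real n * sqrt (real n)) = real n" by (metis mult.left_commute mult.right_neutral)
  qed
  have r2: "0 \<le> \<rho>\<^sup>2" "\<rho>\<^sup>2 \<le> 1" using \<rho> by (auto simp: power_le_one)
  have s2: "s\<^sup>2 * (1 - \<rho>\<^sup>2) \<le> s\<^sup>2" using mult_left_mono[of "1 - \<rho>\<^sup>2" 1 "s\<^sup>2"] r2 by simp
  have y0: "0 \<le> y" unfolding y_def using s \<rho> r2 by simp
  have "2 * s * \<rho> \<le> s" using mult_left_mono[of "2 * \<rho>" 1 s] \<rho> s by (simp add: mult_ac)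
  moreover have "s\<^sup>2 \<le> s / 3" using mult_left_mono[of s "1 / 3" s] s(1,2) by (simp add: power2_eq_square)
  ultimately have y_le: "y \<le> 4 / 3 * s" using s2 unfolding y_def by linarith
  then have y12: "\<bar>y\<bar> \<le> 1 / 2" using y0 s by linarith
  have "y\<^sup>2 \<le> (4 / 3 * s)\<^sup>2" using y_le y0 by (rule power_mono)
  also have "\<dots> = 16 / 9 * s\<^sup>2" by (simp add: power_mult_distrib power2_eq_square)
  finally have yy: "y\<^sup>2 \<le> 2 * s\<^sup>2" using zero_le_power2[of s] by linarith
  define C where "C F = {x \<in> space (obs_space n). s * truncation_level n \<rho> (real (card (inner_edges n F)))
      \<le> s * aligned_sum \<pi> (inner_edges n F) x}" for F
  have Csets: "C F \<in> sets ?R" for F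
    unfolding C_def sR using aligned_sum_measurable[OF \<pi> inner_edges_subset[of n F]] by auto
  have C_le: "measure ?R (C F) \<le> exp (- 3 * real n)" if F: "F \<in> Pow {1..n}" for F
  proof -
    define M where "M = real (card (inner_edges n F))"
    have M: "0 \<le> M" "2 * M \<le> (real n)\<^sup>2"
    proof -
      have "card F \<le> n" using F card_mono[of "{1..n}" F] by auto
      then have "(real (card F))\<^sup>2 \<le> (real n)\<^sup>2" by (intro power_mono) auto
      moreover have "2 * M \<le> (real (card F))\<^sup>2" unfolding M_def using F by (intro card_inner_edges_le) auto
      ultimately show "2 * M \<le> (real n)\<^sup>2" by linarith
    qed (simp add: M_def)
    have le: "emeasure ?R (C F) \<le> ennreal (exp (M * (y / 2 + y\<^sup>2) - s * truncation_level n \<rho> M))"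
      unfolding C_def M_def using \<rho> by (intro aligned_sum_tail[OF \<pi> _ _ inner_edges_subset y_def y12]) auto
    have expo: "M * (y / 2 + y\<^sup>2) - s * truncation_level n \<rho> M = M * (s\<^sup>2 * (1 - \<rho>\<^sup>2) / 2 + y\<^sup>2) - 5 * real n"
    proof -
      have "s * truncation_level n \<rho> M = M * (s * \<rho>) + 5 * (s * (real n * sqrt (real n)))"
        by (simp add: truncation_level_def algebra_simps)
      also have "\<dots> = M * (s * \<rho>) + 5 * real n" unfolding s(4) ..
      finally have tl: "s * truncation_level n \<rho> M = M * (s * \<rho>) + 5 * real n" .
      have "M * (y / 2) = M * (s * \<rho>) + M * (s\<^sup>2 * (1 - \<rho>\<^sup>2) / 2)"
        unfolding y_def by (simp add: add_divide_distrib distrib_left)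
      then show ?thesis unfolding tl distrib_left by linarith
    qed
    have "M * (s\<^sup>2 * (1 - \<rho>\<^sup>2) / 2 + y\<^sup>2) \<le> M * (4 * s\<^sup>2)"
    proof (rule mult_left_mono[OF _ M(1)])
      show "s\<^sup>2 * (1 - \<rho>\<^sup>2) / 2 + y\<^sup>2 \<le> 4 * s\<^sup>2" using s2 yy zero_le_power2[of s] by linarith
    qed
    also have "M * (4 * s\<^sup>2) = 2 * M * 2 * s\<^sup>2" by simp
    also have "\<dots> \<le> (real n)\<^sup>2 * 2 * s\<^sup>2" using M by (intro mult_right_mono) auto
    also have "\<dots> = 2 * real n" using n unfolding s(3) by (simp add: power2_eq_square)
    finally have "M * (y / 2 + y\<^sup>2) - s * truncation_level n \<rho> M \<le> - 3 * real n" unfolding expo by linarith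
    then have "emeasure ?R (C F) \<le> ennreal (exp (- 3 * real n))"
      by (intro order_trans[OF le] ennreal_leI) simp
    then show ?thesis unfolding R.emeasure_eq_measure by simp
  qed
  have "measure ?R (space ?R - ?T) \<le> measure ?R (\<Union>F\<in>Pow {1..n}. C F)"
  proof (rule R.finite_measure_mono)
    show "space ?R - ?T \<subseteq> (\<Union>F\<in>Pow {1..n}. C F)"
    proof
      fix x assume "x \<in> space ?R - ?T"
      then obtain F where F: "x \<in> space (obs_space n)" "F \<in> Pow {1..n}"
        "truncation_level n \<rho> (real (card (inner_edges n F))) \<le> aligned_sum \<pi> (inner_edges n F) x"
        unfolding typical_event_def sR by auto
      then have "x \<in> C F" unfolding C_def using s(1) by (simp add: mult_left_mono)
      then show "x \<in> (\<Union>F\<in>Pow {1..n}. C F)" using F(2) by blast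
    qed
  qed (use Csets in auto)
  also have "\<dots> \<le> (\<Sum>F\<in>Pow {1..n}. measure ?R (C F))"
    using Csets by (intro R.finite_measure_subadditive_finite) auto
  also have "\<dots> \<le> (\<Sum>F\<in>Pow {1..n}. exp (- 3 * real n))" using C_le by (intro sum_mono) auto
  also have "\<dots> = 2 ^ n * exp (- 3 * real n)" by (simp add: card_Pow)
  also have "\<dots> \<le> exp (real n) * exp (- 3 * real n)"
  proof (intro mult_right_mono)
    have "(2::real) ^ n \<le> exp 1 ^ n" using exp_ge_add_one_self[of 1] by (intro power_mono) auto
    then show "2 ^ n \<le> exp (real n)" by (simp flip: exp_of_nat_mult)
  qed simp
  also have "\<dots> = exp (- 2 * real n)" by (simp flip: exp_add)
  finally show ?thesis using R.prob_compl[of ?T] typical_event_sets[OF \<pi>] sR by simp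
qed

definition truncated_likelihood :: "nat \<Rightarrow> real \<Rightarrow> (nat \<Rightarrow> nat) \<Rightarrow> mat_fun \<times> mat_fun \<Rightarrow> real" where
  "truncated_likelihood n \<rho> \<pi> x = likelihood n \<rho> \<pi> x * indicator (typical_event n \<rho> \<pi>) x"

text \<open>The contribution of the fixed points of \<open>\<sigma>\<close> to the second moment; only beyond \<open>n / 8\<close> of
  them is the truncation used.\<close>

definition fixed_point_factor :: "nat \<Rightarrow> real \<Rightarrow> nat \<Rightarrow> real" where
  "fixed_point_factor n \<rho> k = (if 8 * k \<le> n then exp (\<rho>\<^sup>2 * (real k)\<^sup>2)
     else let M = real k * (real k - 1) / 2 in
       exp (\<rho> / (1 - \<rho>\<^sup>2) * truncation_level n \<rho> M) * (1 / sqrt (1 + \<rho>\<^sup>2 + \<rho>^4)) powr M)"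

lemma fixed_point_factor_nonneg: "0 \<le> fixed_point_factor n \<rho> k"
  by (simp add: fixed_point_factor_def Let_def)

text \<open>The error per point in \<open>sum_cycle_cost_le\<close>. For \<open>r\<close> of order
  ln n / n it is of order (ln n)^3 / n, hence vanishes.\<close>

definition orbit_rate :: "nat \<Rightarrow> real \<Rightarrow> real" where
  "orbit_rate n r = 2 * r + 2 * r\<^sup>2 * real n + 2 * r^3 * (real n)\<^sup>2"

text \<open>The permutations agree on the fixed points of \<sigma>, so the edges inside that set may
  serve as \<open>G\<close>. Only the truncation attached to \<pi> is exploited; the indicator
  attached to \<pi>' is bounded by 1.\<close>

lemma truncated_likelihood_pair_le:
  assumes \<pi>: "\<pi> permutes {1..n}" and \<pi>': "\<pi>' permutes {1..n}" and \<rho>: "0 \<le> \<rho>" "\<rho> \<le> 1 / 2"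
  defines "\<sigma> \<equiv> inv \<pi>' \<circ> \<pi>"
  shows "(\<integral>\<^sup>+x. ennreal (truncated_likelihood n \<rho> \<pi> x * truncated_likelihood n \<rho> \<pi>' x) \<partial>null_law n)
    \<le> ennreal (fixed_point_factor n \<rho> (card {i \<in> {1..n}. \<sigma> i = i}) * exp (orbit_rate n (\<rho>\<^sup>2) *
        real (card {i \<in> {1..n}. \<sigma> i = i} + card (two_cycle_points \<sigma> {1..n}) + 1)))"
proof -
  let ?Fix = "{i \<in> {1..n}. \<sigma> i = i}"
  define k where "k = card ?Fix"
  define m where "m = card (two_cycle_points \<sigma> {1..n})"
  \<comment> \<open>With few fixed points an empty \<open>G\<close> and \<open>t = 0\<close> make
    the constraint trivial, as the empty sum is 0.\<close>
  define G where "G = (if 8 * k \<le> n then {} else inner_edges n ?Fix)"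
  define t where "t = (if 8 * k \<le> n then 0 else truncation_level n \<rho> (real (card (inner_edges n ?Fix))))"
  have \<sigma>: "\<sigma> permutes {1..n}" unfolding \<sigma>_def by (intro permutes_compose permutes_inv \<pi> \<pi>')
  have GE: "G \<subseteq> edges n" by (auto simp: G_def inner_edges_def)
  have eq: "\<pi> i = \<pi>' i" if "\<sigma> i = i" for i
    using that permutes_inverses(1)[OF \<pi>', of "\<pi> i"] by (simp add: \<sigma>_def)
  have fixG: "edge_act n \<pi> e = edge_act n \<pi>' e" if "e \<in> G" for e
    using that by (cases e) (auto simp: G_def inner_edges_def edge_act_def eq split: if_splits)
  have r: "0 \<le> \<rho>\<^sup>2" "\<rho>\<^sup>2 \<le> 1 / 2"
    using \<rho> power_mono[of \<rho> "1 / 2" 2] by (auto simp: power2_eq_square)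
  have bound: "truncated_likelihood n \<rho> \<pi> x * truncated_likelihood n \<rho> \<pi>' x \<le>
     likelihood n \<rho> \<pi> x * likelihood n \<rho> \<pi>' x * indicator {x. aligned_sum \<pi> G x \<le> t} x" for x
  proof (cases "x \<in> typical_event n \<rho> \<pi>")
    case True
    then have "aligned_sum \<pi> G x \<le> t" by (auto simp: typical_event_def G_def t_def aligned_sum_def)
    moreover have "likelihood n \<rho> \<pi>' x * indicator (typical_event n \<rho> \<pi>') x \<le> likelihood n \<rho> \<pi>' x"
      using likelihood_nonneg[of \<rho> n \<pi>' x] \<rho> by (auto simp: indicator_def)
    ultimately show ?thesis
      using True likelihood_nonneg[of \<rho> n \<pi> x] \<rho> by (simp add: truncated_likelihood_def mult_left_mono)
  next
    case False
    then show ?thesis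
      using likelihood_nonneg[of \<rho> n \<pi> x] likelihood_nonneg[of \<rho> n \<pi>' x] \<rho> by (simp add: truncated_likelihood_def)
  qed
  have "(\<integral>\<^sup>+x. ennreal (truncated_likelihood n \<rho> \<pi> x * truncated_likelihood n \<rho> \<pi>' x) \<partial>null_law n) \<le>
    (\<integral>\<^sup>+x. ennreal (likelihood n \<rho> \<pi> x * likelihood n \<rho> \<pi>' x) *
       indicator {x. aligned_sum \<pi> G x \<le> t} x \<partial>null_law n)"
  proof (rule nn_integral_mono)
    fix x
    show "ennreal (truncated_likelihood n \<rho> \<pi> x * truncated_likelihood n \<rho> \<pi>' x) \<le>
      ennreal (likelihood n \<rho> \<pi> x * likelihood n \<rho> \<pi>' x) * indicator {x. aligned_sum \<pi> G x \<le> t} x"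
      using ennreal_leI[OF bound[of x]] by (auto simp: indicator_def)
  qed
  also have "\<dots> \<le> ennreal (exp (\<rho> / (1 - \<rho>\<^sup>2) * t) * (1 / sqrt (1 + \<rho>\<^sup>2 + \<rho>^4)) ^ card G *
       exp (2 * (\<Sum>e\<in>edges n - G. cycle_cost (edge_act n \<sigma>) (\<lambda>_. \<rho>\<^sup>2) (\<rho>\<^sup>2) e)))"
    unfolding \<sigma>_def using \<rho> r fixG by (intro truncated_likelihood_product_le \<pi> \<pi>' GE) auto
  also have "\<dots> \<le> ennreal (fixed_point_factor n \<rho> k * exp (orbit_rate n (\<rho>\<^sup>2) * real (k + m + 1)))"
  proof (rule ennreal_leI)
    have cost: "2 * (\<Sum>e\<in>edges n - G. cycle_cost (edge_act n \<sigma>) (\<lambda>_. \<rho>\<^sup>2) (\<rho>\<^sup>2) e)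
      \<le> (if 8 * k \<le> n then \<rho>\<^sup>2 * (real k)\<^sup>2 else 0) + orbit_rate n (\<rho>\<^sup>2) * real (k + m + 1)"
      unfolding orbit_rate_def k_def m_def using r by (intro sum_cycle_cost_le[OF \<sigma>]) (auto simp: G_def k_def)
    show "exp (\<rho> / (1 - \<rho>\<^sup>2) * t) * (1 / sqrt (1 + \<rho>\<^sup>2 + \<rho>^4)) ^ card G *
       exp (2 * (\<Sum>e\<in>edges n - G. cycle_cost (edge_act n \<sigma>) (\<lambda>_. \<rho>\<^sup>2) (\<rho>\<^sup>2) e))
       \<le> fixed_point_factor n \<rho> k * exp (orbit_rate n (\<rho>\<^sup>2) * real (k + m + 1))"
    proof (cases "8 * k \<le> n")
      case True
      have "exp (2 * (\<Sum>e\<in>edges n - G. cycle_cost (edge_act n \<sigma>) (\<lambda>_. \<rho>\<^sup>2) (\<rho>\<^sup>2) e)) \<le>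
        exp (\<rho>\<^sup>2 * (real k)\<^sup>2 + orbit_rate n (\<rho>\<^sup>2) * real (k + m + 1))"
        using cost True by (simp add: G_def)
      then show ?thesis using True by (simp add: G_def t_def fixed_point_factor_def exp_add)
    next
      case False
      have M: "real (card (inner_edges n ?Fix)) = real k * (real k - 1) / 2"
      proof -
        have "2 * real (card (inner_edges n ?Fix)) = real k * (real k - 1)"
          unfolding k_def by (rule card_inner_edges) auto
        then show ?thesis by simp
      qed
      have pos: "0 < 1 / sqrt (1 + \<rho>\<^sup>2 + \<rho>^4)" using r by (simp add: add_pos_nonneg)
      have pw: "(1 / sqrt (1 + \<rho>\<^sup>2 + \<rho>^4)) ^ card G = (1 / sqrt (1 + \<rho>\<^sup>2 + \<rho>^4)) powr (real k * (real k - 1) / 2)"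
        using False pos unfolding G_def M[symmetric] by (simp add: powr_realpow)
      have tM: "t = truncation_level n \<rho> (real k * (real k - 1) / 2)"
        using False by (simp only: t_def M if_False)
      have "2 * (\<Sum>e\<in>edges n - G. cycle_cost (edge_act n \<sigma>) (\<lambda>_. \<rho>\<^sup>2) (\<rho>\<^sup>2) e)
        \<le> orbit_rate n (\<rho>\<^sup>2) * real (k + m + 1)"
        using cost False by simp
      then show ?thesis
        unfolding pw tM fixed_point_factor_def Let_def using False by (simp add: mult_left_mono)
    qed
  qed
  finally show ?thesis unfolding k_def m_def .
qed

section \<open>Fixed-point contributions against 1 / k!\<close>

lemma fact_ge_entropy: "real k * ln (real k) - real k \<le> ln (fact k)"
proof (induction k)
  case (Suc k)
  show ?case
  proof (cases "k = 0")
    case False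
    then have k: "real k > 0" by simp
    have "ln (1 + 1 / real k) \<le> 1 / real k" using k by (intro ln_add_one_self_le_self) auto
    moreover have "1 + 1 / real k = (real k + 1) / real k" using k by (simp add: field_simps)
    ultimately have "ln (real k + 1) - ln (real k) \<le> 1 / real k" using k by (simp add: ln_div)
    then have "real k * (ln (real k + 1) - ln (real k)) \<le> 1" using k by (simp add: field_simps)
    moreover have "ln (fact (Suc k)) = ln (real k + 1) + ln (fact k)" by (simp add: ln_mult add.commute)
    ultimately show ?thesis using Suc by (simp add: algebra_simps)
  qed simp
qed simp

lemma one_over_fact_le: "1 / (fact k :: real) \<le> exp (real k - real k * ln (real k))"
proof -
  have "1 / (fact k :: real) = exp (- ln (fact k))" by (simp add: exp_minus inverse_eq_divide)
  also have "\<dots> \<le> exp (real k - real k * ln (real k))" using fact_ge_entropy[of k] by simp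
  finally show ?thesis .
qed

text \<open>A majorant free of n, so that the sum over k is bounded uniformly. The term
  \<open>- k ln k / 2\<close> is the half of 1 / k! that the fixed points leave over.\<close>

definition small_k_bound :: "nat \<Rightarrow> real" where
  "small_k_bound k = (real k + 1)\<^sup>2 * exp (6 * real k + 1 - real k * ln (real k) / 2)"

lemma summable_small_k_bound: "summable small_k_bound"
proof (rule summable_comparison_test_ev)
  have "\<forall>\<^sub>F k in sequentially. (real k + 1)\<^sup>2 * exp (6 * real k + 1 - real k * ln (real k) / 2) \<le> exp (- real k)"
    by real_asymp
  then show "\<forall>\<^sub>F k in sequentially. norm (small_k_bound k) \<le> exp (- 1) ^ k"
    by eventually_elim (simp add: small_k_bound_def flip: exp_of_nat_mult)
  show "summable (\<lambda>k. exp (- 1 :: real) ^ k)" by (rule summable_geometric) simp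
qed

text \<open>Split ln n as ln k + ln(n / k), with ln(n / k) \<le> n / k. The second part costs only 4
  k, and in the first the coefficient 4 k / n is at most 1/2: this is where the cutoff at n / 8
  comes from.\<close>

lemma small_fixed_set_exponent_le:
  assumes k: "1 \<le> k" "8 * k \<le> n" and r: "r \<le> 4 * ln (real n) / real n"
  shows "r * (real k)\<^sup>2 \<le> real k * ln (real k) / 2 + 4 * real k"
proof -
  have pos: "real k \<ge> 1" "real n \<ge> 8" "8 * real k \<le> real n" using k by linarith+
  have "ln (real n) = ln (real k) + ln (real n / real k)" using pos by (simp add: ln_div)
  also have "ln (real n / real k) \<le> real n / real k"
    using ln_le_minus_one[of "real n / real k"] pos by simp
  finally have ln_n: "ln (real n) \<le> ln (real k) + real n / real k" by simp
  have "r * (real k)\<^sup>2 \<le> 4 * ln (real n) / real n * (real k)\<^sup>2" using r by (intro mult_right_mono) auto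
  also have "\<dots> = 4 * (real k)\<^sup>2 / real n * ln (real n)" by simp
  also have "\<dots> \<le> 4 * (real k)\<^sup>2 / real n * (ln (real k) + real n / real k)"
    using ln_n by (intro mult_left_mono) auto
  also have "\<dots> = 4 * real k / real n * (real k * ln (real k)) + 4 * real k"
    using pos by (simp add: field_simps power2_eq_square)
  also have "4 * real k / real n * (real k * ln (real k)) \<le> 1 / 2 * (real k * ln (real k))"
    using pos by (intro mult_right_mono) (auto simp: field_simps)
  finally show ?thesis by simp
qed

text \<open>Subtracting 1 is essential: \<open>exp u - 1 \<le> u * exp u\<close> produces a factor
  proportional to \<theta>, which tends to 0, while \<open>exp u\<close> is outweighed by the
  factorial.\<close>

lemma small_fixed_set_term_le:
  assumes k: "8 * k \<le> n" and \<rho>: "\<rho>\<^sup>2 \<le> 4 * ln (real n) / real n"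
    and \<theta>: "\<rho>\<^sup>2 \<le> \<theta>" "\<theta> \<le> 1"
  shows "(fixed_point_factor n \<rho> k * exp (\<theta> * (real k + 1)) - 1) / fact k \<le> 2 * \<theta> * small_k_bound k"
proof -
  let ?u = "(2 * \<theta> * (real k + 1)\<^sup>2) * exp (real k * ln (real k) / 2 + 5 * real k + 1)"
  define u where "u = \<rho>\<^sup>2 * (real k)\<^sup>2 + \<theta> * (real k + 1)"
  have \<theta>0: "0 \<le> \<theta>" using \<theta>(1) zero_le_power2 order_trans by blast
  have "\<rho>\<^sup>2 * (real k)\<^sup>2 \<le> \<theta> * (real k + 1)\<^sup>2" using \<theta> \<theta>0 by (intro mult_mono power_mono) auto
  moreover have "\<theta> * (real k + 1) \<le> \<theta> * (real k + 1)\<^sup>2"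
    using \<theta>0 by (intro mult_left_mono) (auto simp: power2_eq_square)
  ultimately have u_le: "u \<le> 2 * \<theta> * (real k + 1)\<^sup>2" unfolding u_def by simp
  have u0: "0 \<le> u" using \<theta>0 by (simp add: u_def)
  \<comment> \<open>\<open>u_le\<close> supplies the vanishing prefactor, \<open>u_le2\<close> the
    growth rate inside the exponential.\<close>
  have u_le2: "u \<le> real k * ln (real k) / 2 + 5 * real k + 1"
  proof -
    have "\<rho>\<^sup>2 * (real k)\<^sup>2 \<le> real k * ln (real k) / 2 + 4 * real k"
      using small_fixed_set_exponent_le[of k n "\<rho>\<^sup>2"] k \<rho> by (cases "k = 0") auto
    moreover have "\<theta> * (real k + 1) \<le> 1 * (real k + 1)" using \<theta> by (intro mult_right_mono) auto
    ultimately have "u \<le> (real k * ln (real k) / 2 + 4 * real k) + 1 * (real k + 1)"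
      unfolding u_def by (rule add_mono)
    then show ?thesis by simp
  qed
  have "1 - exp (- u) \<le> u" using exp_ge_add_one_self[of "- u"] by simp
  then have "exp u * (1 - exp (- u)) \<le> exp u * u" by (intro mult_left_mono) auto
  moreover have "exp u * exp (- u) = 1" by (simp flip: exp_add)
  ultimately have "exp u - 1 \<le> u * exp u" by (simp add: right_diff_distrib mult.commute)
  also have "u * exp u \<le> ?u"
    using u_le u_le2 u0 \<theta>0 by (intro mult_mono) auto
  finally have "(exp u - 1) / fact k \<le> ?u / fact k"
    by (intro divide_right_mono) auto
  also have "\<dots> = ?u * (1 / fact k)" by simp
  also have "\<dots> \<le> ?u * exp (real k - real k * ln (real k))"
    using \<theta>0 by (intro mult_left_mono one_over_fact_le) auto
  also have "\<dots> = 2 * \<theta> * ((real k + 1)\<^sup>2 * exp ((real k * ln (real k) / 2 + 5 * real k + 1) + (real k - real k * ln (real k))))"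
    by (simp only: exp_add mult.assoc)
  also have "(real k * ln (real k) / 2 + 5 * real k + 1) + (real k - real k * ln (real k)) = 6 * real k + 1 - real k * ln (real k) / 2"
    by simp
  finally show ?thesis
    using k unfolding small_k_bound_def u_def by (simp add: fixed_point_factor_def exp_add)
qed

text \<open>Dominated by the negative n ln n term, whose \<epsilon> / 32 is \<epsilon> / 4 times the
  1/8 of the cutoff. The term 4 n comes from the factorial, the squared logarithm from second-order
  terms in \<rho>^2, and the last term, of order n sqrt(ln n), from the truncation slack.\<close>

definition large_set_exponent :: "real \<Rightarrow> nat \<Rightarrow> real" where
  "large_set_exponent \<epsilon> n = 4 * real n - \<epsilon> / 32 * (real n * ln (real n)) + 2 * (4 * ln (real n))\<^sup>2
     + 10 * sqrt (4 * ln (real n) / real n) * (real n * sqrt (real n))"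

text \<open>Undoing the tilt costs about \<rho>^2 M and the tilted integral returns \<rho>^2 M / 2;
  the corrections are multiples of M \<rho>^4, hence O((ln n)^2). The remaining exponent, about (1 -
  \<epsilon> / 4) k ln n, is set against k ln k, and k > n / 8 makes ln k comparable with ln
  n.\<close>

lemma large_fixed_set_term_le:
  assumes k: "n < 8 * k" "k \<le> n" and \<epsilon>: "0 < \<epsilon>" "\<epsilon> \<le> 1" and \<rho>: "0 \<le> \<rho>" "\<rho> \<le> 1 / 2"
    and thr: "\<rho>\<^sup>2 \<le> (4 - \<epsilon>) * ln (real n) / real n"
  shows "fixed_point_factor n \<rho> k / fact k \<le>
    exp (large_set_exponent \<epsilon> n)"
proof -
  let ?s = "sqrt (4 * ln (real n) / real n)"
  define r where "r = \<rho>\<^sup>2"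
  define M where "M = real k * (real k - 1) / 2"
  define l where "l = \<rho> / (1 - \<rho>\<^sup>2)"
  let ?f = "exp (l * truncation_level n \<rho> M) * exp (- (M / 2) * ln (1 + r + r\<^sup>2))"
  let ?s10 = "10 * ?s * (real n * sqrt (real n))"
  have pos: "1 \<le> real k" "1 \<le> real n" "real k \<le> real n" "real n < 8 * real k" proof -
    have "1 \<le> k" "1 \<le> n" using k by auto
    then show "1 \<le> real k" "1 \<le> real n" by simp_all
    show "real k \<le> real n" using k by simp
    have "real n < real (8 * k)" using k(1) by (simp only: of_nat_less_iff)
    then show "real n < 8 * real k" by simp
  qed
  have r: "0 \<le> r" "r \<le> 1 / 4"
    using \<rho> power_mono[of \<rho> "1 / 2" 2] by (auto simp: r_def power2_eq_square)
  have lnn: "0 \<le> ln (real n)" using pos by simp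
  have r4: "r \<le> 4 * ln (real n) / real n"
  proof -
    have "(4 - \<epsilon>) * ln (real n) / real n \<le> 4 * ln (real n) / real n"
      using \<epsilon> lnn by (intro divide_right_mono mult_right_mono) auto
    then show ?thesis using thr by (simp add: r_def)
  qed
  have M: "0 \<le> M" "2 * M \<le> (real k)\<^sup>2" "M \<le> (real n)\<^sup>2 / 2"
  proof -
    show "0 \<le> M" using pos by (simp add: M_def)
    show 2: "2 * M \<le> (real k)\<^sup>2" by (simp add: M_def power2_eq_square algebra_simps)
    have "(real k)\<^sup>2 \<le> (real n)\<^sup>2" using pos by (intro power_mono) auto
    with 2 show "M \<le> (real n)\<^sup>2 / 2" by linarith
  qed
  have inv: "1 / (1 - r) \<le> 1 + 2 * r"
  proof -
    have "(1 + 2 * r) * (1 - r) = 1 + r * (1 - 2 * r)" by (simp add: algebra_simps)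
    also have "\<dots> \<ge> 1" using r by simp
    finally show ?thesis using r by (simp add: field_simps)
  qed
  have l1: "l * \<rho> \<le> r + 2 * r\<^sup>2"
  proof -
    have "l * \<rho> = r * (1 / (1 - r))" by (simp add: l_def r_def power2_eq_square)
    also have "\<dots> \<le> r * (1 + 2 * r)" using inv r by (intro mult_left_mono) auto
    finally show ?thesis by (simp add: algebra_simps power2_eq_square)
  qed
  have l2: "l \<le> 2 * ?s"
  proof -
    have "l = \<rho> * (1 / (1 - r))" by (simp add: l_def r_def)
    also have "\<dots> \<le> \<rho> * 2" using inv r \<rho> by (intro mult_left_mono) auto
    also have "\<rho> \<le> ?s" using r4 \<rho> by (intro real_le_rsqrt) (simp add: r_def)
    finally show ?thesis by simp
  qed
  have lnq: "ln (1 + r + r\<^sup>2) \<ge> r - 4 * r\<^sup>2"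
  proof -
    have r2: "r\<^sup>2 \<le> r" "0 \<le> r\<^sup>2" using r by (auto simp: power2_eq_square mult_left_le)
    have "ln (1 + (r + r\<^sup>2)) \<ge> (r + r\<^sup>2) - (r + r\<^sup>2)\<^sup>2"
    proof (rule ln_one_plus_pos_lower_bound)
      show "0 \<le> r + r\<^sup>2" "r + r\<^sup>2 \<le> 1" using r r2 by linarith+
    qed
    moreover have "(r + r\<^sup>2)\<^sup>2 \<le> (2 * r)\<^sup>2"
    proof (rule power_mono)
      show "r + r\<^sup>2 \<le> 2 * r" "0 \<le> r + r\<^sup>2" using r r2 by linarith+
    qed
    moreover have "(2 * r)\<^sup>2 = 4 * r\<^sup>2" by (simp add: power2_eq_square)
    ultimately have "ln (1 + (r + r\<^sup>2)) \<ge> r - 4 * r\<^sup>2" using r2 by linarith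
    then show ?thesis by (simp only: add.assoc)
  qed
  have pos_q: "0 < 1 + r + r\<^sup>2" using r by (simp add: add_pos_nonneg)
  have pw: "(1 / sqrt (1 + \<rho>\<^sup>2 + \<rho>^4)) powr M = exp (- (M / 2) * ln (1 + r + r\<^sup>2))"
  proof -
    have "\<rho>^4 = r\<^sup>2" by (simp add: r_def flip: power_mult)
    then have q: "1 + \<rho>\<^sup>2 + \<rho>^4 = 1 + r + r\<^sup>2" by (simp only: r_def)
    show ?thesis unfolding q using pos_q by (simp add: powr_def ln_div ln_sqrt)
  qed
  have e1: "l * truncation_level n \<rho> M \<le> M * (r + 2 * r\<^sup>2) + ?s10"
  proof -
    have "l * truncation_level n \<rho> M = M * (l * \<rho>) + 5 * (l * (real n * sqrt (real n)))"
      by (simp add: truncation_level_def algebra_simps)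
    also have "\<dots> \<le> M * (r + 2 * r\<^sup>2) + 5 * (2 * ?s * (real n * sqrt (real n)))"
      using l1 l2 M by (intro add_mono mult_left_mono mult_right_mono) auto
    finally show ?thesis by simp
  qed
  have e2: "- (M / 2) * ln (1 + r + r\<^sup>2) \<le> - (M / 2) * (r - 4 * r\<^sup>2)"
    using lnq M by (intro mult_left_mono_neg) auto
  \<comment> \<open>The two leading terms M r and - M r / 2 leave half: this is the gain of the
    truncation.\<close>
  have e3: "M * (r + 2 * r\<^sup>2) + - (M / 2) * (r - 4 * r\<^sup>2) = (2 * M) * r / 4 + 4 * (M * r\<^sup>2)"
    by (simp add: algebra_simps)
  have e4: "M * r\<^sup>2 \<le> (4 * ln (real n))\<^sup>2 / 2"
  proof -
    have "M * r\<^sup>2 \<le> (real n)\<^sup>2 / 2 * (4 * ln (real n) / real n)\<^sup>2"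
      using M r r4 by (intro mult_mono power_mono) auto
    also have "\<dots> = (4 * ln (real n))\<^sup>2 / 2" using pos by (simp add: power_divide)
    finally show ?thesis .
  qed
  have e5: "(2 * M) * r / 4 \<le> (1 - \<epsilon> / 4) * (real k * ln (real n))"
  proof -
    have "(2 * M) * r \<le> (real k)\<^sup>2 * ((4 - \<epsilon>) * ln (real n) / real n)"
      using M r thr by (intro mult_mono) (auto simp: r_def)
    also have "\<dots> = (4 - \<epsilon>) * (real k * ln (real n)) * (real k / real n)"
      by (simp add: power2_eq_square)
    also have "\<dots> \<le> (4 - \<epsilon>) * (real k * ln (real n)) * 1"
      using pos \<epsilon> lnn by (intro mult_left_mono) auto
    finally show ?thesis by (simp add: algebra_simps)
  qed
  \<comment> \<open>From n < 8 k and ln 8 \<le> 3, replacing ln k by ln n costs at most 3 k \<le> 3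
    n.\<close>
  have e6: "real k - real k * ln (real k) \<le> real k - real k * ln (real n) + 3 * real n"
  proof -
    have "ln (real n) \<le> ln (8 * real k)" using pos by (subst ln_le_cancel_iff) auto
    also have "\<dots> = ln 8 + ln (real k)" using pos by (simp add: ln_mult)
    also have "ln (8::real) \<le> 3"
    proof -
      have "(2::real) \<le> exp 1" using exp_ge_add_one_self[of 1] by simp
      then have "(2::real) ^ 3 \<le> exp 1 ^ 3" by (intro power_mono) auto
      then have "(8::real) \<le> exp 3" by (simp flip: exp_of_nat_mult)
      then have "ln 8 \<le> ln (exp (3::real))" by (subst ln_le_cancel_iff) auto
      then show ?thesis by simp
    qed
    finally have "real k * ln (real n) \<le> real k * (3 + ln (real k))" using pos by (intro mult_left_mono) auto
    then show ?thesis using pos by (simp add: algebra_simps)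
  qed
  have e7: "\<epsilon> / 32 * (real n * ln (real n)) \<le> \<epsilon> / 4 * (real k * ln (real n))"
  proof -
    have "\<epsilon> / 32 * (real n * ln (real n)) \<le> \<epsilon> / 32 * ((8 * real k) * ln (real n))"
      using pos lnn \<epsilon> by (intro mult_left_mono mult_right_mono) auto
    then show ?thesis by simp
  qed
  have "fixed_point_factor n \<rho> k / fact k = ?f * (1 / fact k)"
    using k unfolding pw[symmetric] by (simp add: fixed_point_factor_def l_def M_def Let_def)
  also have "\<dots> \<le> ?f * exp (real k - real k * ln (real k))"
    by (intro mult_left_mono one_over_fact_le) auto
  also have "\<dots> = exp (l * truncation_level n \<rho> M + - (M / 2) * ln (1 + r + r\<^sup>2) + (real k - real k * ln (real k)))"
    by (simp only: exp_add)
  also have "\<dots> \<le> exp (large_set_exponent \<epsilon> n)"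
  proof -
    have "(1 - \<epsilon> / 4) * (real k * ln (real n)) = real k * ln (real n) - \<epsilon> / 4 * (real k * ln (real n))"
      by (simp add: left_diff_distrib)
    then have "l * truncation_level n \<rho> M + - (M / 2) * ln (1 + r + r\<^sup>2) + (real k - real k * ln (real k)) \<le>
      large_set_exponent \<epsilon> n"
      unfolding large_set_exponent_def using e1 e2 e3 e4 e5 e6 e7 pos(3) by linarith
    then show ?thesis by simp
  qed
  finally show ?thesis .
qed

section \<open>The averaged likelihood ratio and its truncated moments\<close>

lemma planted_law_density:
  assumes \<rho>: "0 \<le> \<rho>" "\<rho> < 1"
  shows "planted_law n \<rho> = density (null_law n)
    (\<lambda>x. ennreal ((\<Sum>\<pi> | \<pi> permutes {1..n}. likelihood n \<rho> \<pi> x) / fact n))"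
proof (rule measure_eqI)
  let ?S = "{\<pi>. \<pi> permutes {1..n}}"
  let ?f = "\<lambda>x. ennreal ((\<Sum>\<pi>\<in>?S. likelihood n \<rho> \<pi> x) / fact n)"
  show "sets (planted_law n \<rho>) = sets (density (null_law n)
    ?f)" by simp
  fix X assume "X \<in> sets (planted_law n \<rho>)"
  then have X: "X \<in> sets (obs_space n)" by simp
  let ?LX = "\<lambda>\<pi> x. ennreal (likelihood n \<rho> \<pi> x) * indicator X x"
  have L: "likelihood n \<rho> \<pi> \<in> borel_measurable (null_law n)" if "\<pi> \<in> ?S" for \<pi>
    using likelihood_measurable[of \<pi> n \<rho>] that by (simp cong: measurable_cong_sets)
  have LX: "(\<lambda>x. ?LX \<pi> x) \<in> borel_measurable (null_law n)" if "\<pi> \<in> ?S" for \<pi>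
  proof -
    have [measurable]: "X \<in> sets (null_law n)" using X by simp
    note [measurable] = L[OF that]
    show ?thesis by measurable
  qed
  have f: "inverse (fact n :: ennreal) = ennreal (1 / fact n)"
    by (metis ennreal_of_nat_eq_real_of_nat of_nat_fact inverse_ennreal fact_gt_zero inverse_eq_divide)
  have "emeasure (planted_law n \<rho>) X = (\<Sum>\<pi>\<in>?S. emeasure (planted_law_given n \<rho> \<pi>) X) / fact n"
    by (rule emeasure_planted_law[OF X])
  also have "(\<Sum>\<pi>\<in>?S. emeasure (planted_law_given n \<rho> \<pi>) X) =
     (\<Sum>\<pi>\<in>?S. \<integral>\<^sup>+x. ?LX \<pi> x \<partial>null_law n)"
  proof (rule sum.cong[OF refl])
    fix \<pi> assume \<pi>: "\<pi> \<in> ?S"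
    show "emeasure (planted_law_given n \<rho> \<pi>) X = (\<integral>\<^sup>+x. ?LX \<pi> x \<partial>null_law n)"
      using \<pi> X L[OF \<pi>] by (simp add: planted_law_given_density[OF _ \<rho>] emeasure_density)
  qed
  also have "\<dots> = (\<integral>\<^sup>+x. (\<Sum>\<pi>\<in>?S. ?LX \<pi> x) \<partial>null_law n)"
    using LX by (intro nn_integral_sum[symmetric]) auto
  also have "\<dots> / fact n = (\<integral>\<^sup>+x. (\<Sum>\<pi>\<in>?S. ?LX \<pi> x) / fact n \<partial>null_law n)"
    using LX by (intro nn_integral_divide[symmetric]) auto
  also have "\<dots> = (\<integral>\<^sup>+x. ?f x * indicator X x \<partial>null_law n)"
  proof (rule nn_integral_cong)
    fix x
    have "(\<Sum>\<pi>\<in>?S. ?LX \<pi> x) =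
       ennreal (\<Sum>\<pi>\<in>?S. likelihood n \<rho> \<pi> x) * indicator X x"
      using \<rho> by (simp add: sum_distrib_right[symmetric] sum_ennreal likelihood_nonneg)
    then show "(\<Sum>\<pi>\<in>?S. ?LX \<pi> x) / fact n =
      ?f x * indicator X x"
      using \<rho> by (simp add: divide_ennreal_def f ennreal_mult'[symmetric] sum_nonneg likelihood_nonneg mult_ac
          flip: ennreal_mult)
  qed
  also have "\<dots> = emeasure (density (null_law n)
    ?f) X"
    using L X by (intro emeasure_density[symmetric]) auto
  finally show "emeasure (planted_law n \<rho>) X = emeasure (density (null_law n)
    ?f) X" .
qed

definition truncated_average :: "nat \<Rightarrow> real \<Rightarrow> mat_fun \<times> mat_fun \<Rightarrow> real" where
  "truncated_average n \<rho> x = (\<Sum>\<pi> | \<pi> permutes {1..n}. truncated_likelihood n \<rho> \<pi> x) / fact n"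

lemma truncated_likelihood_measurable:
  assumes "\<pi> permutes {1..n}"
  shows "truncated_likelihood n \<rho> \<pi> \<in> borel_measurable (null_law n)"
proof -
  have "truncated_likelihood n \<rho> \<pi> \<in> borel_measurable (obs_space n)"
    unfolding truncated_likelihood_def
    using likelihood_measurable[OF assms] typical_event_sets[OF assms] by measurable
  then show ?thesis by (simp cong: measurable_cong_sets)
qed

lemma truncated_likelihood_nonneg: "0 \<le> \<rho> \<Longrightarrow> \<rho> \<le> 1 \<Longrightarrow> 0 \<le> truncated_likelihood n \<rho> \<pi> x"
  by (simp add: truncated_likelihood_def likelihood_nonneg)

text \<open>Under the null law each truncated likelihood integrates to the planted probability of
  its typical event.\<close>

lemma truncated_average_first_moment:
  assumes \<rho>: "0 \<le> \<rho>" "\<rho> \<le> 1 / 2" and n: "9 \<le> n"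
  shows "ennreal (1 - exp (- 2 * real n)) \<le> (\<integral>\<^sup>+x. ennreal (truncated_average n \<rho> x) \<partial>null_law n)"
proof -
  let ?S = "{\<pi>. \<pi> permutes {1..n}}"
  let ?c = "1 - exp (- 2 * real n)"
  have card: "card ?S = fact n" by (rule card_permutations) auto
  have each: "ennreal ?c \<le> (\<integral>\<^sup>+x. ennreal (truncated_likelihood n \<rho> \<pi> x) \<partial>null_law n)" if "\<pi> \<in> ?S" for \<pi>
  proof -
    have \<pi>: "\<pi> permutes {1..n}" using that by simp
    interpret R: prob_space "planted_law_given n \<rho> \<pi>" by (rule prob_space_planted_law_given)
    have "ennreal ?c \<le> emeasure (planted_law_given n \<rho> \<pi>) (typical_event n \<rho> \<pi>)"
      unfolding R.emeasure_eq_measure by (intro ennreal_leI typical_event_probability \<pi> \<rho> n)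
    also have "\<dots> = (\<integral>\<^sup>+x. ennreal (likelihood n \<rho> \<pi> x) * indicator (typical_event n \<rho> \<pi>) x \<partial>null_law n)"
      using planted_law_given_density[OF \<pi>, of \<rho>] \<rho> likelihood_measurable[OF \<pi>, of \<rho>] typical_event_sets[OF \<pi>, of \<rho>]
      by (simp add: emeasure_density cong: measurable_cong_sets)
    also have "\<dots> = (\<integral>\<^sup>+x. ennreal (truncated_likelihood n \<rho> \<pi> x) \<partial>null_law n)"
      by (intro nn_integral_cong) (auto simp: truncated_likelihood_def indicator_def)
    finally show ?thesis .
  qed
  have c0: "0 \<le> ?c" by simp
  have "ennreal ?c = ennreal (1 / fact n * (fact n * ?c))" by simp
  also have "\<dots> = ennreal (1 / fact n) * ennreal (fact n * ?c)" using c0 by (intro ennreal_mult) auto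
  also have "ennreal (fact n * ?c) = (\<Sum>\<pi>\<in>?S. ennreal ?c)"
    using c0 card by (subst sum_ennreal) auto
  also have "ennreal (1 / fact n) * (\<Sum>\<pi>\<in>?S. ennreal ?c) \<le> ennreal (1 / fact n) * (\<Sum>\<pi>\<in>?S. \<integral>\<^sup>+x. ennreal (truncated_likelihood n \<rho> \<pi> x) \<partial>null_law n)"
    using each by (intro mult_left_mono sum_mono) auto
  also have "\<dots> = ennreal (1 / fact n) * (\<integral>\<^sup>+x. (\<Sum>\<pi>\<in>?S. ennreal (truncated_likelihood n \<rho> \<pi> x)) \<partial>null_law n)"
    using truncated_likelihood_measurable by (subst nn_integral_sum) auto
  also have "\<dots> = (\<integral>\<^sup>+x. ennreal (1 / fact n) * (\<Sum>\<pi>\<in>?S. ennreal (truncated_likelihood n \<rho> \<pi> x)) \<partial>null_law n)"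
    using truncated_likelihood_measurable by (intro nn_integral_cmult[symmetric]) auto
  also have "\<dots> = (\<integral>\<^sup>+x. ennreal (truncated_average n \<rho> x) \<partial>null_law n)"
    using \<rho> by (intro nn_integral_cong)
      (simp add: truncated_average_def sum_ennreal truncated_likelihood_nonneg sum_nonneg flip: ennreal_mult)
  finally show ?thesis .
qed

text \<open>The pair bound depends only on \<open>inv \<pi>' \<circ> \<pi>\<close>, and for fixed
  \<pi> this runs through every permutation once as \<pi>' does. The double average is thus a single
  average over \<sigma> of a weight in its fixed points and two-cycle points.\<close>

lemma truncated_average_second_moment:
  fixes n :: nat and \<rho> :: real
  assumes \<rho>: "0 \<le> \<rho>" "\<rho> \<le> 1 / 2"
  defines "\<theta> \<equiv> orbit_rate n (\<rho>\<^sup>2)"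
  assumes \<theta>: "(exp \<theta> - 1) * exp \<theta> \<le> 1 / 2"
  shows "(\<integral>\<^sup>+x. ennreal ((truncated_average n \<rho> x)\<^sup>2) \<partial>null_law n) \<le>
    ennreal (1 + (2 * (\<Sum>k\<le>n. max 0 (fixed_point_factor n \<rho> k * exp (\<theta> * (real k + 1)) - 1) / fact k)
       + 2 * ((exp \<theta> - 1) * exp \<theta>)))"
proof -
  let ?S = "{\<pi>. \<pi> permutes {1..n}}"
  have finS: "finite ?S" by (simp add: finite_permutations)
  have card: "card ?S = fact n" by (rule card_permutations) auto
  let ?T = "truncated_likelihood n \<rho>"
  let ?TT = "\<lambda>\<pi> \<pi>' x. ennreal (?T \<pi> x * ?T \<pi>' x)"
  have T0: "0 \<le> ?T \<pi> x" for \<pi> x using \<rho> by (intro truncated_likelihood_nonneg) auto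
  define k m where "k \<sigma> = card {i \<in> {1..n}. \<sigma> i = i}" and "m \<sigma> = card (two_cycle_points \<sigma> {1..n})" for \<sigma> :: "nat \<Rightarrow> nat"
  define h where "h j = fixed_point_factor n \<rho> j * exp (\<theta> * (real j + 1))" for j
  define z where "z = exp \<theta>"
  have \<theta>0: "0 \<le> \<theta>" by (simp add: \<theta>_def orbit_rate_def)
  have z: "1 \<le> z" "(z - 1) * z \<le> 1 / 2" using \<theta> \<theta>0 by (auto simp: z_def)
  define B where "B \<sigma> = h (k \<sigma>) * z ^ m \<sigma>" for \<sigma>
  have h0: "0 \<le> h j" for j by (simp add: h_def fixed_point_factor_nonneg)
  have B0: "0 \<le> B \<sigma>" for \<sigma> using h0 z by (simp add: B_def)
  have pair: "(\<integral>\<^sup>+x. ?TT \<pi> \<pi>' x \<partial>null_law n) \<le> ennreal (B (inv \<pi>' \<circ> \<pi>))"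
    if "\<pi> \<in> ?S" "\<pi>' \<in> ?S" for \<pi> \<pi>'
  proof -
    have "exp (\<theta> * real (k \<sigma> + m \<sigma> + 1)) = exp (\<theta> * (real (k \<sigma>) + 1)) * z ^ m \<sigma>" for \<sigma>
      unfolding z_def exp_of_nat_mult[symmetric] exp_add[symmetric] by (simp add: algebra_simps)
    then have "B \<sigma> = fixed_point_factor n \<rho> (k \<sigma>) * exp (\<theta> * real (k \<sigma> + m \<sigma> + 1))" for \<sigma>
      by (simp add: B_def h_def)
    then show ?thesis
      using truncated_likelihood_pair_le[of \<pi> n \<pi>' \<rho>] that \<rho> by (simp add: \<theta>_def k_def m_def)
  qed
  have reindex: "(\<Sum>\<pi>'\<in>?S. B (inv \<pi>' \<circ> \<pi>)) = (\<Sum>\<sigma>\<in>?S. B \<sigma>)" if "\<pi> \<in> ?S" for \<pi>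
  proof (rule sum.reindex_bij_witness[where i = "\<lambda>\<sigma>. \<pi> \<circ> inv \<sigma>" and j = "\<lambda>\<pi>'. inv \<pi>' \<circ> \<pi>"])
    have \<pi>: "\<pi> permutes {1..n}" using that by simp
    fix \<pi>' assume "\<pi>' \<in> ?S"
    then have \<pi>': "\<pi>' permutes {1..n}" by simp
    show "inv \<pi>' \<circ> \<pi> \<in> ?S" using \<pi> \<pi>' by (auto intro: permutes_compose permutes_inv)
    have "inv (inv \<pi>' \<circ> \<pi>) = inv \<pi> \<circ> \<pi>'"
      using o_inv_distrib[OF permutes_bij[OF permutes_inv[OF \<pi>']] permutes_bij[OF \<pi>]] permutes_inv_inv[OF \<pi>'] by simp
    then show "\<pi> \<circ> inv (inv \<pi>' \<circ> \<pi>) = \<pi>'"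
      using permutes_inverses(1)[OF \<pi>] by (simp add: fun_eq_iff)
  next
    have \<pi>: "\<pi> permutes {1..n}" using that by simp
    fix \<sigma> assume "\<sigma> \<in> ?S"
    then have \<sigma>: "\<sigma> permutes {1..n}" by simp
    show "\<pi> \<circ> inv \<sigma> \<in> ?S" using \<pi> \<sigma> by (auto intro: permutes_compose permutes_inv)
    have "inv (\<pi> \<circ> inv \<sigma>) = \<sigma> \<circ> inv \<pi>"
      using o_inv_distrib[OF permutes_bij[OF \<pi>] permutes_bij[OF permutes_inv[OF \<sigma>]]] permutes_inv_inv[OF \<sigma>] by simp
    then show "inv (\<pi> \<circ> inv \<sigma>) \<circ> \<pi> = \<sigma>"
      using permutes_inverses(2)[OF \<pi>] by (simp add: fun_eq_iff)
  qed auto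
  have TT: "(\<lambda>x. ?TT \<pi> \<pi>' x) \<in> borel_measurable (null_law n)" if "\<pi> \<in> ?S" "\<pi>' \<in> ?S" for \<pi> \<pi>'
    using that truncated_likelihood_measurable by auto
  have sq: "ennreal ((truncated_average n \<rho> x)\<^sup>2) =
    ennreal (1 / (fact n)\<^sup>2) * (\<Sum>\<pi>\<in>?S. \<Sum>\<pi>'\<in>?S. ?TT \<pi> \<pi>' x)" for x
  proof -
    have "(truncated_average n \<rho> x)\<^sup>2 = 1 / (fact n)\<^sup>2 * (\<Sum>\<pi>\<in>?S. \<Sum>\<pi>'\<in>?S. ?T \<pi> x * ?T \<pi>' x)"
      unfolding truncated_average_def power_divide power2_eq_square by (simp add: sum_product)
    moreover have "(\<Sum>\<pi>\<in>?S. \<Sum>\<pi>'\<in>?S. ?TT \<pi> \<pi>' x) = ennreal (\<Sum>\<pi>\<in>?S. \<Sum>\<pi>'\<in>?S. ?T \<pi> x * ?T \<pi>' x)"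
      using T0 by (simp add: sum_ennreal sum_nonneg)
    ultimately show ?thesis using T0 by (simp only:) (intro ennreal_mult sum_nonneg mult_nonneg_nonneg, auto)
  qed
  have "(\<integral>\<^sup>+x. ennreal ((truncated_average n \<rho> x)\<^sup>2) \<partial>null_law n) =
    ennreal (1 / (fact n)\<^sup>2) * (\<Sum>\<pi>\<in>?S. \<Sum>\<pi>'\<in>?S. \<integral>\<^sup>+x. ?TT \<pi> \<pi>' x \<partial>null_law n)"
  proof -
    have "(\<integral>\<^sup>+x. ennreal ((truncated_average n \<rho> x)\<^sup>2) \<partial>null_law n) =
      ennreal (1 / (fact n)\<^sup>2) * (\<integral>\<^sup>+x. (\<Sum>\<pi>\<in>?S. \<Sum>\<pi>'\<in>?S. ?TT \<pi> \<pi>' x) \<partial>null_law n)"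
      unfolding sq using TT by (intro nn_integral_cmult borel_measurable_sum) auto
    also have "(\<integral>\<^sup>+x. (\<Sum>\<pi>\<in>?S. \<Sum>\<pi>'\<in>?S. ?TT \<pi> \<pi>' x) \<partial>null_law n) =
      (\<Sum>\<pi>\<in>?S. \<integral>\<^sup>+x. (\<Sum>\<pi>'\<in>?S. ?TT \<pi> \<pi>' x) \<partial>null_law n)"
      using TT by (intro nn_integral_sum borel_measurable_sum) auto
    also have "\<dots> = (\<Sum>\<pi>\<in>?S. \<Sum>\<pi>'\<in>?S. \<integral>\<^sup>+x. ?TT \<pi> \<pi>' x \<partial>null_law n)"
    proof (rule sum.cong[OF refl])
      fix \<pi> assume \<pi>: "\<pi> \<in> ?S"
      show "(\<integral>\<^sup>+x. (\<Sum>\<pi>'\<in>?S. ?TT \<pi> \<pi>' x) \<partial>null_law n) =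
        (\<Sum>\<pi>'\<in>?S. \<integral>\<^sup>+x. ?TT \<pi> \<pi>' x \<partial>null_law n)"
        by (rule nn_integral_sum) (rule TT[OF \<pi>])
    qed
    finally show ?thesis .
  qed
  also have "\<dots> \<le> ennreal (1 / (fact n)\<^sup>2) * (\<Sum>\<pi>\<in>?S. \<Sum>\<pi>'\<in>?S. ennreal (B (inv \<pi>' \<circ> \<pi>)))"
    by (intro mult_left_mono sum_mono pair) auto
  also have "\<dots> = ennreal (1 / (fact n)\<^sup>2 * (\<Sum>\<pi>\<in>?S. \<Sum>\<pi>'\<in>?S. B (inv \<pi>' \<circ> \<pi>)))"
    using B0 by (subst ennreal_mult) (auto intro!: sum_nonneg simp: sum_ennreal sum_nonneg)
  also have "(\<Sum>\<pi>\<in>?S. \<Sum>\<pi>'\<in>?S. B (inv \<pi>' \<circ> \<pi>)) = (\<Sum>\<pi>\<in>?S. \<Sum>\<sigma>\<in>?S. B \<sigma>)"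
    by (rule sum.cong[OF refl]) (rule reindex)
  also have "\<dots> = fact n * (\<Sum>\<sigma>\<in>?S. B \<sigma>)" using card by simp
  also have "1 / (fact n)\<^sup>2 * (fact n * (\<Sum>\<sigma>\<in>?S. B \<sigma>)) = (\<Sum>\<sigma>\<in>?S. B \<sigma>) / fact n"
    by (simp add: power2_eq_square)
  also have "ennreal ((\<Sum>\<sigma>\<in>?S. B \<sigma>) / fact n) \<le>
    ennreal (1 + (2 * (\<Sum>k\<le>n. max 0 (h k - 1) / fact k) + 2 * ((z - 1) * z)))"
  proof (rule ennreal_leI)
    \<comment> \<open>Splitting h as (h - 1) + 1 isolates the leading 1 of the second moment;
      \<open>max 0\<close> keeps the weight nonnegative, as the summation over fixed points
      demands.\<close>
    have "(\<Sum>\<sigma>\<in>?S. B \<sigma>) \<le> (\<Sum>\<sigma>\<in>?S. max 0 (h (k \<sigma>) - 1) * z ^ m \<sigma> + z ^ m \<sigma>)"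
    proof (rule sum_mono)
      fix \<sigma>
      have "h (k \<sigma>) * z ^ m \<sigma> \<le> (max 0 (h (k \<sigma>) - 1) + 1) * z ^ m \<sigma>" using z by (intro mult_right_mono) auto
      then show "B \<sigma> \<le> max 0 (h (k \<sigma>) - 1) * z ^ m \<sigma> + z ^ m \<sigma>" by (simp add: B_def algebra_simps)
    qed
    also have "\<dots> = (\<Sum>\<sigma>\<in>?S. max 0 (h (k \<sigma>) - 1) * z ^ m \<sigma>) + (\<Sum>\<sigma>\<in>?S. z ^ m \<sigma>)" by (rule sum.distrib)
    also have "(\<Sum>\<sigma>\<in>?S. max 0 (h (k \<sigma>) - 1) * z ^ m \<sigma>) \<le> 2 * fact (card {1..n}) * (\<Sum>k\<le>card {1..n}. max 0 (h k - 1) / fact k)"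
      unfolding k_def m_def using z
      by (intro sum_permutations_by_fixed_points_le[where h = "\<lambda>j. max 0 (h j - 1)"]) auto
    also have "(\<Sum>\<sigma>\<in>?S. z ^ m \<sigma>) \<le> (1 + 2 * ((z - 1) * z)) * fact (card {1..n})"
      unfolding m_def using z by (intro sum_two_cycle_weight_le) auto
    finally have "(\<Sum>\<sigma>\<in>?S. B \<sigma>) \<le> (1 + (2 * (\<Sum>k\<le>n. max 0 (h k - 1) / fact k) + 2 * ((z - 1) * z))) * fact n"
      by (simp add: algebra_simps)
    then show "(\<Sum>\<sigma>\<in>?S. B \<sigma>) / fact n \<le> 1 + (2 * (\<Sum>k\<le>n. max 0 (h k - 1) / fact k) + 2 * ((z - 1) * z))"
      by (subst pos_divide_le_eq) auto
  qed
  finally show ?thesis unfolding h_def z_def .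
qed

text \<open>Uses the largest \<rho>^2 in question, 4 ln n / n, so the bound depends on \<epsilon>
  and n only. Its three parts stem from few fixed points, from at most n + 1 large values of k, and
  from two-cycles.\<close>

definition second_moment_excess :: "real \<Rightarrow> nat \<Rightarrow> real" where
  "second_moment_excess \<epsilon> n = (let \<Theta> = orbit_rate n (4 * ln (real n) / real n) in
     2 * (2 * \<Theta> * (\<Sum>k. small_k_bound k) + (real n + 1) *
       (exp (large_set_exponent \<epsilon> n) * exp (\<Theta> * (real n + 1))))
     + 2 * ((exp \<Theta> - 1) * exp \<Theta>))"

lemma second_moment_excess_tendsto:
  assumes "0 < \<epsilon>"
  shows "second_moment_excess \<epsilon> \<longlonglongrightarrow> 0"
proof -
  let ?\<Theta> = "\<lambda>n. orbit_rate n (4 * ln (real n) / real n)"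
  let ?e = "\<lambda>n. exp (large_set_exponent \<epsilon> n) * exp (?\<Theta> n * (real n + 1))"
  have \<Theta>: "?\<Theta> \<longlonglongrightarrow> 0" unfolding orbit_rate_def by real_asymp
  have e: "(\<lambda>n. (real n + 1) * ?e n) \<longlonglongrightarrow> 0"
    unfolding orbit_rate_def large_set_exponent_def using assms by real_asymp
  have "second_moment_excess \<epsilon> = (\<lambda>n. 2 * (2 * ?\<Theta> n * (\<Sum>k. small_k_bound k) + (real n + 1) * ?e n)
     + 2 * ((exp (?\<Theta> n) - 1) * exp (?\<Theta> n)))"
    by (simp add: second_moment_excess_def Let_def fun_eq_iff)
  moreover have "(\<lambda>n. 2 * (2 * ?\<Theta> n * (\<Sum>k. small_k_bound k) + (real n + 1) * ?e n)
     + 2 * ((exp (?\<Theta> n) - 1) * exp (?\<Theta> n))) \<longlonglongrightarrow>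
      2 * (2 * 0 * (\<Sum>k. small_k_bound k) + 0) + 2 * ((exp 0 - 1) * exp 0)"
    by (intro tendsto_intros \<Theta> e)
  ultimately show ?thesis by simp
qed

lemma orbit_rate_mono: "0 \<le> r \<Longrightarrow> r \<le> s \<Longrightarrow> orbit_rate n r \<le> orbit_rate n s"
  unfolding orbit_rate_def by (intro add_mono mult_mono power_mono) auto

lemma second_moment_sum_le:
  fixes n :: nat and \<rho> :: real
  assumes \<rho>: "0 \<le> \<rho>" "\<rho> \<le> 1 / 2" and \<epsilon>: "0 < \<epsilon>" "\<epsilon> \<le> 1" and n: "1 \<le> n"
    and thr: "\<rho>\<^sup>2 \<le> (4 - \<epsilon>) * ln (real n) / real n"
    and small: "orbit_rate n (4 * ln (real n) / real n) \<le> 1"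
  defines "\<theta> \<equiv> orbit_rate n (\<rho>\<^sup>2)"
  shows "2 * (\<Sum>k\<le>n. max 0 (fixed_point_factor n \<rho> k * exp (\<theta> * (real k + 1)) - 1) / fact k)
       + 2 * ((exp \<theta> - 1) * exp \<theta>) \<le> second_moment_excess \<epsilon> n"
proof -
  let ?h = "\<lambda>k. fixed_point_factor n \<rho> k * exp (\<theta> * (real k + 1))"
  define \<Theta> where "\<Theta> = orbit_rate n (4 * ln (real n) / real n)"
  define \<Psi> where "\<Psi> = exp (large_set_exponent \<epsilon> n) * exp (\<Theta> * (real n + 1))"
  have lnn: "0 \<le> ln (real n)" using n by simp
  have r4: "\<rho>\<^sup>2 \<le> 4 * ln (real n) / real n"
  proof -
    have "(4 - \<epsilon>) * ln (real n) / real n \<le> 4 * ln (real n) / real n"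
      using \<epsilon> lnn by (intro divide_right_mono mult_right_mono) auto
    then show ?thesis using thr by simp
  qed
  have \<theta>\<Theta>: "\<theta> \<le> \<Theta>" unfolding \<theta>_def \<Theta>_def using r4 by (intro orbit_rate_mono) auto
  have \<theta>0: "0 \<le> \<theta>" by (simp add: \<theta>_def orbit_rate_def)
  have \<theta>1: "\<theta> \<le> 1" using \<theta>\<Theta> small by (simp add: \<Theta>_def)
  have r\<theta>: "\<rho>\<^sup>2 \<le> \<theta>"
  proof -
    have "0 \<le> 2 * (\<rho>\<^sup>2)\<^sup>2 * real n" "0 \<le> 2 * (\<rho>\<^sup>2)^3 * (real n)\<^sup>2" by simp_all
    then show ?thesis unfolding \<theta>_def orbit_rate_def using zero_le_power2[of \<rho>] by linarith
  qed
  have sb0: "0 \<le> small_k_bound k" for k by (simp add: small_k_bound_def)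
  have \<Psi>0: "0 \<le> \<Psi>" by (simp add: \<Psi>_def)
  \<comment> \<open>Both regimes are charged to every k, which avoids splitting the sum.\<close>
  have each: "max 0 (?h k - 1) / fact k \<le> 2 * \<theta> * small_k_bound k + \<Psi>"
    if k: "k \<le> n" for k
  proof (cases "8 * k \<le> n")
    case True
    have "(?h k - 1) / fact k \<le> 2 * \<theta> * small_k_bound k"
      by (rule small_fixed_set_term_le[OF True r4 r\<theta> \<theta>1])
    moreover have "0 \<le> 2 * \<theta> * small_k_bound k" using \<theta>0 sb0 by simp
    ultimately have "max 0 (?h k - 1) / fact k \<le> 2 * \<theta> * small_k_bound k"
      by (simp add: max_def)
    then show ?thesis using \<Psi>0 by simp
  next
    case False
    have "max 0 (?h k - 1) / fact k \<le>
       ?h k / fact k"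
      using fixed_point_factor_nonneg[of n \<rho> k] by (intro divide_right_mono) auto
    also have "\<dots> = fixed_point_factor n \<rho> k / fact k * exp (\<theta> * (real k + 1))" by simp
    also have "\<dots> \<le> \<Psi>"
      unfolding \<Psi>_def
    proof (rule mult_mono)
      show "fixed_point_factor n \<rho> k / fact k \<le> exp (large_set_exponent \<epsilon> n)"
        using False by (intro large_fixed_set_term_le k \<epsilon> \<rho> thr) auto
      show "exp (\<theta> * (real k + 1)) \<le> exp (\<Theta> * (real n + 1))"
        using \<theta>\<Theta> \<theta>0 k by (simp add: mult_mono)
    qed auto
    finally show ?thesis using \<theta>0 sb0[of k] by (simp add: add_increasing)
  qed
  have "(\<Sum>k\<le>n. max 0 (?h k - 1) / fact k) \<le>
    (\<Sum>k\<le>n. 2 * \<theta> * small_k_bound k + \<Psi>)" using each by (intro sum_mono) auto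
  also have "\<dots> = 2 * \<theta> * (\<Sum>k\<le>n. small_k_bound k) + (real n + 1) * \<Psi>"
    by (simp add: sum.distrib sum_distrib_left)
  also have "\<dots> \<le> 2 * \<Theta> * (\<Sum>k. small_k_bound k) + (real n + 1) * \<Psi>"
    using \<theta>\<Theta> \<theta>0 sb0 by (intro add_mono mult_mono sum_le_suminf summable_small_k_bound order_refl sum_nonneg) auto
  finally have 1: "(\<Sum>k\<le>n. max 0 (?h k - 1) / fact k) \<le>
     2 * \<Theta> * (\<Sum>k. small_k_bound k) + (real n + 1) * \<Psi>" .
  have 2: "(exp \<theta> - 1) * exp \<theta> \<le> (exp \<Theta> - 1) * exp \<Theta>"
    using \<theta>\<Theta> \<theta>0 by (intro mult_mono) auto
  have "second_moment_excess \<epsilon> n = 2 * (2 * \<Theta> * (\<Sum>k. small_k_bound k) + (real n + 1) * \<Psi>) + 2 * ((exp \<Theta> - 1) * exp \<Theta>)"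
    by (simp only: second_moment_excess_def Let_def \<Theta>_def \<Psi>_def)
  with 1 2 show ?thesis by (simp only: add_mono mult_left_mono zero_le_numeral)
qed

lemma tv_dist_le_below_threshold:
  assumes \<rho>: "0 \<le> \<rho>" "\<rho> \<le> 1 / 2" and \<epsilon>: "0 < \<epsilon>" "\<epsilon> \<le> 1" and n: "9 \<le> n"
    and thr: "\<rho>\<^sup>2 \<le> (4 - \<epsilon>) * ln (real n) / real n"
    and \<Theta>: "orbit_rate n (4 * ln (real n) / real n) \<le> 1 / 4"
  shows "tv_dist (planted_law n \<rho>) (null_law n) \<le>
    exp (- 2 * real n) + sqrt (second_moment_excess \<epsilon> n + 2 * exp (- 2 * real n))"
proof -
  let ?excess = "2 * (\<Sum>k\<le>n. max 0 (fixed_point_factor n \<rho> k * exp (orbit_rate n (\<rho>\<^sup>2) * (real k + 1)) - 1) / fact k)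
    + 2 * ((exp (orbit_rate n (\<rho>\<^sup>2)) - 1) * exp (orbit_rate n (\<rho>\<^sup>2)))"
  let ?S = "{\<pi>. \<pi> permutes {1..n}}"
  define \<theta> where "\<theta> = orbit_rate n (\<rho>\<^sup>2)"
  have "(4 - \<epsilon>) * ln (real n) / real n \<le> 4 * ln (real n) / real n"
    using \<epsilon> n by (intro divide_right_mono mult_right_mono) auto
  then have "\<theta> \<le> 1 / 4" using thr \<Theta> orbit_rate_mono[of "\<rho>\<^sup>2" "4 * ln (real n) / real n" n] by (simp add: \<theta>_def)
  moreover have \<theta>0: "0 \<le> \<theta>" by (simp add: \<theta>_def orbit_rate_def)
  \<comment> \<open>For \<theta> \<le> 1/4 this leads to (exp \<theta> - 1) exp \<theta> \<le>
    105/256 < 1/2, the condition for summing the two-cycle weights.\<close>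
  ultimately have "exp \<theta> \<le> 1 + \<theta> + \<theta>\<^sup>2" by (intro exp_bound) auto
  moreover have "\<theta>\<^sup>2 \<le> \<theta> / 4" using \<open>\<theta> \<le> 1 / 4\<close> \<theta>0 mult_left_mono[of \<theta> "1 / 4" \<theta>] by (simp add: power2_eq_square)
  ultimately have "exp \<theta> - 1 \<le> 5 / 16" "exp \<theta> \<le> 21 / 16" using \<open>\<theta> \<le> 1 / 4\<close> by linarith+
  then have "(exp \<theta> - 1) * exp \<theta> \<le> 5 / 16 * (21 / 16)" using \<theta>0 by (intro mult_mono) auto
  then have z: "(exp \<theta> - 1) * exp \<theta> \<le> 1 / 2" by simp
  have excess: "?excess \<le> second_moment_excess \<epsilon> n"
    unfolding \<theta>_def using n \<Theta> by (intro second_moment_sum_le \<rho> \<epsilon> thr) auto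
  have "0 \<le> ?excess"
    using \<theta>0 unfolding \<theta>_def by (intro add_nonneg_nonneg mult_nonneg_nonneg sum_nonneg divide_nonneg_nonneg) auto
  then have excess0: "0 \<le> second_moment_excess \<epsilon> n" using excess by linarith
  have L0: "0 \<le> likelihood n \<rho> \<pi> x" for \<pi> x using \<rho> by (intro likelihood_nonneg) auto
  show ?thesis
  proof (rule tv_dist_le_truncated_second_moment[where f = "\<lambda>x. (\<Sum>\<pi>\<in>?S. likelihood n \<rho> \<pi> x) / fact n"
        and g = "truncated_average n \<rho>"])
    show "planted_law n \<rho> = density (null_law n) (\<lambda>x. ennreal ((\<Sum>\<pi>\<in>?S. likelihood n \<rho> \<pi> x) / fact n))"
      using \<rho> by (intro planted_law_density) auto
    show "(\<lambda>x. (\<Sum>\<pi>\<in>?S. likelihood n \<rho> \<pi> x) / fact n) \<in> borel_measurable (null_law n)"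
    proof (intro borel_measurable_divide borel_measurable_sum)
      fix \<pi> assume "\<pi> \<in> ?S"
      then show "likelihood n \<rho> \<pi> \<in> borel_measurable (null_law n)"
        using likelihood_measurable[of \<pi> n \<rho>] by (simp cong: measurable_cong_sets)
    qed simp
    show "truncated_average n \<rho> \<in> borel_measurable (null_law n)"
      unfolding truncated_average_def using truncated_likelihood_measurable
      by (intro borel_measurable_divide borel_measurable_sum) auto
    show "0 \<le> truncated_average n \<rho> x" for x
      unfolding truncated_average_def using \<rho> by (intro divide_nonneg_nonneg sum_nonneg truncated_likelihood_nonneg) auto
    show "truncated_average n \<rho> x \<le> (\<Sum>\<pi>\<in>?S. likelihood n \<rho> \<pi> x) / fact n" for x
      unfolding truncated_average_def
    proof (intro divide_right_mono sum_mono)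
      fix \<pi>
      show "truncated_likelihood n \<rho> \<pi> x \<le> likelihood n \<rho> \<pi> x"
        using L0[of \<pi> x] by (auto simp: truncated_likelihood_def indicator_def)
    qed simp
    show "ennreal (1 - exp (- 2 * real n)) \<le> (\<integral>\<^sup>+x. ennreal (truncated_average n \<rho> x) \<partial>null_law n)"
      by (rule truncated_average_first_moment[OF \<rho> n])
    have "(\<integral>\<^sup>+x. ennreal ((truncated_average n \<rho> x)\<^sup>2) \<partial>null_law n) \<le>
      ennreal (1 + ?excess)"
      using z unfolding \<theta>_def by (rule truncated_average_second_moment[OF \<rho>])
    also have "\<dots> \<le> ennreal (1 + second_moment_excess \<epsilon> n)" using excess by (intro ennreal_leI) simp
    finally show "(\<integral>\<^sup>+x. ennreal ((truncated_average n \<rho> x)\<^sup>2) \<partial>null_law n) \<le> ennreal (1 + second_moment_excess \<epsilon> n)" .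
    show "0 < second_moment_excess \<epsilon> n + 2 * exp (- 2 * real n)" using excess0 by (simp add: add_nonneg_pos)
    show "0 \<le> (\<Sum>\<pi>\<in>?S. likelihood n \<rho> \<pi> x) / fact n" for x
      using L0 by (intro divide_nonneg_nonneg sum_nonneg) auto
  qed (use excess0 in \<open>auto intro: prob_space_planted_law prob_space_null_law\<close>)
qed

lemma tv_dist_below_threshold:
  fixes \<rho> :: "nat \<Rightarrow> real"
  assumes \<rho>: "\<And>n. 0 \<le> \<rho> n \<and> \<rho> n \<le> 1" and \<epsilon>: "0 < \<epsilon>"
    and thr: "\<forall>\<^sub>F n in sequentially. (\<rho> n)\<^sup>2 \<le> (4 - \<epsilon>) * ln (real n) / real n"
  shows "(\<lambda>n. tv_dist (planted_law n (\<rho> n)) (null_law n)) \<longlonglongrightarrow> 0"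
proof -
  \<comment> \<open>Shrinking \<epsilon> weakens the hypothesis, so it may be taken at most 1; this
    keeps \<open>4 - \<epsilon>'\<close> positive.\<close>
  define \<epsilon>' where "\<epsilon>' = min \<epsilon> 1"
  have \<epsilon>': "0 < \<epsilon>'" "\<epsilon>' \<le> 1" "\<epsilon>' \<le> \<epsilon>" using \<epsilon> by (auto simp: \<epsilon>'_def)
  let ?upper = "\<lambda>n. exp (- 2 * real n) + sqrt (second_moment_excess \<epsilon>' n + 2 * exp (- 2 * real n))"
  show ?thesis
  proof (rule tendsto_sandwich)
    show "\<forall>\<^sub>F n in sequentially. 0 \<le> tv_dist (planted_law n (\<rho> n)) (null_law n)"
      by (intro always_eventually allI tv_dist_nonneg prob_space_planted_law prob_space_null_law) simp
    have "\<forall>\<^sub>F n in sequentially. orbit_rate n (4 * ln (real n) / real n) \<le> 1 / 4"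
      unfolding orbit_rate_def by real_asymp
    moreover have "\<forall>\<^sub>F n in sequentially. 4 * ln (real n) / real n \<le> 1 / 4" by real_asymp
    ultimately show "\<forall>\<^sub>F n in sequentially. tv_dist (planted_law n (\<rho> n)) (null_law n) \<le> ?upper n"
      using thr eventually_ge_at_top[of 9]
    proof eventually_elim
      case (elim n)
      have lnn: "0 \<le> ln (real n)" using elim by simp
      have le: "(4 - \<epsilon>) * ln (real n) / real n \<le> (4 - \<epsilon>') * ln (real n) / real n"
        "(4 - \<epsilon>') * ln (real n) / real n \<le> 4 * ln (real n) / real n"
        using \<epsilon>' lnn by (auto intro!: divide_right_mono mult_right_mono)
      then have "(\<rho> n)\<^sup>2 \<le> 1 / 4" using elim by linarith
      then have "(\<rho> n)\<^sup>2 \<le> (1 / 2)\<^sup>2" by (simp add: power2_eq_square)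
      then have "\<rho> n \<le> 1 / 2" by (rule power2_le_imp_le) simp
      then show ?case
        using elim le \<rho>[of n] \<epsilon>' by (intro tv_dist_le_below_threshold) auto
    qed
    have "?upper \<longlonglongrightarrow> 0 + sqrt (0 + 2 * 0)"
      by (intro tendsto_intros second_moment_excess_tendsto \<epsilon>') real_asymp+
    then show "?upper \<longlonglongrightarrow> 0" by simp
  qed simp
qed

theorem theorem1:
  fixes \<rho> :: "nat \<Rightarrow> real"
  assumes "\<And>n. 0 \<le> \<rho> n \<and> \<rho> n \<le> 1"
  shows
    "((\<forall>\<^sub>F n in sequentially. (\<rho> n)\<^sup>2 \<ge> 4 * ln (real n) / (real n - 1)) \<longrightarrow>
       (\<lambda>n. tv_dist (planted_law n (\<rho> n)) (null_law n)) \<longlonglongrightarrow> 1) \<and>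
     (\<forall>\<epsilon>>0. (\<forall>\<^sub>F n in sequentially. (\<rho> n)\<^sup>2 \<le> (4 - \<epsilon>) * ln (real n) / real n) \<longrightarrow>
       (\<lambda>n. tv_dist (planted_law n (\<rho> n)) (null_law n)) \<longlonglongrightarrow> 0)"
  using tv_dist_above_threshold[of \<rho>, OF assms] tv_dist_below_threshold[of \<rho>, OF assms] by blast

end
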